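(* Fix $1<p<\infty$. There are constants $c_p,C_p>0$ such that for all $n\ge 2$, for every connected graph $G=(V,E)$ with $|V|=n$ and average degree $D_G$, and for every initial profile $f_0:V\to[0,1]$, the asynchronous $\ell^p$-energy minimization dynamics satisfy: (a) $\mathbb{E}[\mathcal{E}_p(f_t)]\le\mathcal{E}_p(f_0)\exp\bigl(-c_pF(n,p,D_G)\,t\bigr)$ for all $t>0$; (b) $\displaystyle\mathbb{E}[\tau_p(\epsilon)]\le\frac{C_p\log(n/\epsilon)}{F(n,p,D_G)}$ for all $\epsilon\in(0,1/2]$. Conversely, there exists $\tilde c_p>0$ such that for every large $N$ and every $D\ge 2$, there are a connected graph $G=(V,E)$ with $|V|\le N$ and $D_G\le D$, and an initial profile $f_0:V\to[0,1]$, such that $$\tau_p(1/2)\ge\frac{\tilde c_p}{F(N,p,D)}.$$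
   Context: All graphs are finite, undirected and simple (no self-loops or multiple edges). Given $1<p<\infty$, a connected graph $G=(V,E)$ and an initial profile $f_0:V\to[0,1]$, the asynchronous $\ell^p$-energy minimization dynamics choose at each integer step $t\ge 1$ a uniformly random vertex $v_t\in V$ (independently over steps) and set $f_t(v)=\mathrm{argmin}_{y\in\mathbb{R}}\sum_{w\sim v}|f_{t-1}(w)-y|^p$ if $v=v_t$ (the minimizer is unique) and $f_t(v)=f_{t-1}(v)$ if $v\ne v_t$. The $\ell^p$ energy is $\mathcal{E}_p(f)=\sum_{\{u,v\}\in E}|f(u)-f(v)|^p$; the oscillation is $\mathfrak{osc}(f)=\max_v f(v)-\min_w f(w)$; the $\epsilon$-consensus time is $\tau_p(\epsilon)=\min\{t\ge 0:\ \mathfrak{osc}(f_t)\le\epsilon\}$. The average degree of a graph $G=(V,E)$ is $D_G=\frac1{|V|}\sum_{v\in V}\deg(v)=2|E|/|V|$. The function $F$ is $$F(n,p,D)=n^{-\beta_p}(D/n)^{-\theta_p}=\begin{cases} n^{\frac{1-2p}{p-1}}D^{\frac{-1}{p-1}}, & 1<p\le 2,\\ n^{-3}D^{\frac{p-3}{p-1}}, & 2<p<3,\\ n^{-3}, & p\ge 3,\end{cases}$$ where $\beta_p=\max\{\frac{2p}{p-1},3\}$, $\theta_p=\frac1{p-1}$ for $1<p\le2$ and $\theta_p=\max\{\frac{3-p}{p-1},0\}$ for $p\ge2$.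
   Formalization: The converse is stated for 2 ≤ D ≤ N: for p<3 and fixed N, 1/F(N,p,D)→∞ as D→∞ while (b) bounds E[τ_p(1/2)] over all graphs with |V| ≤ N; for p≥3 the case D>N follows from D=N. Vertices are natural numbers (every finite graph is isomorphic to such a one). *)

theory Defs
  imports "Graph_Theory.Digraph_Component" "HOL-Probability.Probability"
begin

text \<open>
  Finite simple graphs are symmetric loop-free digraphs (locale \<^locale>\<open>pair_graph\<close>): the
  edge \<open>{u, v}\<close> is the pair of arcs \<open>(u, v)\<close>, \<open>(v, u)\<close>, so vertex degrees are out-degrees.
  Connectedness is \<open>Digraph_Component.connected\<close> (which includes nonemptiness); the
  qualifier keeps it apart from topological connectedness.
\<close>

definition avg_degree :: "'a pair_pre_digraph \<Rightarrow> real" where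
  "avg_degree G =
    (\<Sum>v\<in>pverts G. real (out_degree (with_proj G) v)) / real (card (pverts G))"

text \<open>Every edge occurs as two arcs, whence the factor 1/2.\<close>

definition energy :: "real \<Rightarrow> 'a pair_pre_digraph \<Rightarrow> ('a \<Rightarrow> real) \<Rightarrow> real" where
  "energy p G f = (\<Sum>(u, v)\<in>parcs G. \<bar>f u - f v\<bar> powr p) / 2"

definition osc :: "'a pair_pre_digraph \<Rightarrow> ('a \<Rightarrow> real) \<Rightarrow> real" where
  "osc G f = Max (f ` pverts G) - Min (f ` pverts G)"

definition update :: "real \<Rightarrow> 'a pair_pre_digraph \<Rightarrow> 'a \<Rightarrow> ('a \<Rightarrow> real) \<Rightarrow> 'a \<Rightarrow> real" where
  "update p G v f =
    f(v := arg_min (\<lambda>y. \<Sum>w | (v, w) \<in> parcs G. \<bar>f w - y\<bar> powr p) (\<lambda>_. True))"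

text \<open>
  Indices of the vertex sequence are shifted by one: \<open>\<omega> t\<close> is the vertex
  \<open>v\<^sub>t\<^sub>+\<^sub>1\<close> chosen at step \<open>t + 1\<close>.
\<close>

primrec profile ::
  "real \<Rightarrow> 'a pair_pre_digraph \<Rightarrow> ('a \<Rightarrow> real) \<Rightarrow> (nat \<Rightarrow> 'a) \<Rightarrow> nat \<Rightarrow> 'a \<Rightarrow> real" where
  "profile p G f0 \<omega> 0 = f0"
| "profile p G f0 \<omega> (Suc t) = update p G (\<omega> t) (profile p G f0 \<omega> t)"

text \<open>The law of an i.i.d. sequence of uniformly random vertices; its space is the set of all
  sequences in \<open>pverts G\<close>.\<close>

definition vertex_seq :: "'a pair_pre_digraph \<Rightarrow> (nat \<Rightarrow> 'a) measure" where
  "vertex_seq G = Pi\<^sub>M UNIV (\<lambda>_. uniform_count_measure (pverts G))"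

text \<open>Infinite if the oscillation never drops to \<open>\<epsilon>\<close>; otherwise the infimum is a minimum.\<close>

definition consensus_time ::
  "real \<Rightarrow> 'a pair_pre_digraph \<Rightarrow> ('a \<Rightarrow> real) \<Rightarrow> real \<Rightarrow> (nat \<Rightarrow> 'a) \<Rightarrow> ennreal" where
  "consensus_time p G f0 \<epsilon> \<omega> =
    (INF t \<in> {t. osc G (profile p G f0 \<omega> t) \<le> \<epsilon>}. of_nat t)"

definition beta_exp :: "real \<Rightarrow> real" where
  "beta_exp p = max (2 * p / (p - 1)) 3"

definition theta_exp :: "real \<Rightarrow> real" where
  "theta_exp p = (if p \<le> 2 then 1 / (p - 1) else max ((3 - p) / (p - 1)) 0)"

definition F :: "nat \<Rightarrow> real \<Rightarrow> real \<Rightarrow> real" where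
  "F n p D = real n powr (- beta_exp p) * (D / real n) powr (- theta_exp p)"

lemma F_cases:
  assumes "1 < p" "0 < n" "0 < D"
  shows "F n p D =
    (if p \<le> 2 then real n powr ((1 - 2 * p) / (p - 1)) * D powr (- 1 / (p - 1))
     else if p < 3 then real n powr (- 3) * D powr ((p - 3) / (p - 1))
     else real n powr (- 3))"
proof -
  have F: "F n p D = real n powr (theta_exp p - beta_exp p) * D powr (- theta_exp p)"
    using assms by (simp add: F_def powr_divide powr_diff powr_minus field_simps)
  consider "p \<le> 2" | "2 < p" "p < 3" | "3 \<le> p" by linarith
  then show ?thesis
  proof cases
    case 1
    then have b: "beta_exp p = 2 * p / (p - 1)"
      using assms by (simp add: beta_exp_def max_def field_simps)
    have "theta_exp p - beta_exp p = (1 - 2 * p) / (p - 1)"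
      using 1 by (simp add: b theta_exp_def diff_divide_distrib)
    then show ?thesis using F 1 by (simp add: theta_exp_def)
  next
    case 2
    then have b: "beta_exp p = 2 * p / (p - 1)"
      by (simp add: beta_exp_def max_def field_simps)
    have t: "theta_exp p = (3 - p) / (p - 1)"
      using 2 by (simp add: theta_exp_def max_def field_simps)
    have "theta_exp p - beta_exp p = ((3 - p) - 2 * p) / (p - 1)"
      by (simp only: b t diff_divide_distrib)
    also have "\<dots> = - 3"
      using 2 by (simp add: field_simps)
    finally have "theta_exp p - beta_exp p = - 3" .
    moreover have "- theta_exp p = (p - 3) / (p - 1)"
      by (simp add: t minus_divide_left)
    ultimately show ?thesis using F 2 by simp
  next
    case 3
    then have b: "beta_exp p = 3"
      by (simp add: beta_exp_def max_def field_simps)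
    have t: "theta_exp p = 0"
      using 3 by (simp add: theta_exp_def max_def field_simps)
    show ?thesis using F 3 assms by (simp add: b t)
  qed
qed

end

theory Submission
  imports Defs
begin

text \<open>
  Upper bound. Order the vertices by their values. Let \<open>M\<^sup>p\<^sup>-\<^sup>1\<close> be the largest flow
  \<open>\<Sum> |\<nabla>|\<^sup>p\<^sup>-\<^sup>1\<close> across a gap of the ordering; then every gap is at most \<open>M\<close> and the
  energy is at most \<open>n M\<^sup>p\<close>. Shifting each vertex below the maximal gap, one at a time, by the same
  \<open>\<delta>\<close> decreases the energies by \<open>p \<delta> M\<^sup>p\<^sup>-\<^sup>1\<close> in total up to Taylor remainders. For \<open>p > 2\<close> these are
  controlled by \<open>\<Sum> |\<nabla>|\<^sup>p\<^sup>-\<^sup>2\<close>, which is bounded by splitting the edges according to the size of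
  \<open>k |\<nabla>|\<close>, where \<open>k\<close> is the rank difference of the endpoints; \<open>p = 3\<close> is critical because
  the up to \<open>k\<close> upward edges of a vertex with \<open>|\<nabla>|\<close> about \<open>1/k\<close> contribute \<open>k\<^sup>3\<^sup>-\<^sup>p\<close>.

  Lower bound. Blow up the vertices of a path into layers that are joined completely. The
  \<open>\<ell>\<^sup>p\<close>-mean of two layers of widths \<open>w, w'\<close> is a weighted mean with weights \<open>w\<^sup>1\<^sup>/\<^sup>(\<^sup>p\<^sup>-\<^sup>1\<^sup>)\<close>, hence
  upper barriers that are constant on layers evolve linearly, like voltages in a resistor network.
  The barrier of a layer has to rise only after a fixed fraction of the layer was updated, and each
  rise dissipates a quadratic energy; the Cauchy-Schwarz inequality bounds the number of rises from below.
\<close>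

subsection \<open>Signed powers and \<open>\<ell>\<^sup>p\<close>-means\<close>

text \<open>The common shift is a trial move only. An update is optimal at its vertex, hence at
  least as good as the shift, and since \<open>phi\<close> is odd the first-order terms of edges
  inside the shifted set cancel, leaving the flow over one cut. Up to constants the shift is M times
  (nD)^(-1/(p-1)) for p \<le> 2, and M / (n D^k) with k = max(0, 3-p)/(p-1) for p > 2. One factor
  1/n from the energy bound n M^p and one from the random choice of the vertex turn this into
  \<open>F\<close>.

  In the lower bound the obstacle is that barriers must be constant on layers although updates hit
  single vertices. Hence two levels A \<le> B per layer: while at most a fraction \<epsilon> of a
  layer has been updated, it acts on its neighbours at most as if its value were (A + B) / 2,
  because |x|^(p-2) dx is a doubling measure. The argument holds for every sequence of vertices, so
  no randomness enters; the reflection 1 - f treats the other end. If layers of width m and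
  conductance c0, indexed by I, hang on a path of length L, the time is of order m c0 |I|^2 L, and
  two choices of parameters make this of order 1 / F.\<close>

definition phi :: "real \<Rightarrow> real \<Rightarrow> real" where
  "phi r x = sgn x * \<bar>x\<bar> powr r"

lemma phi_0 [simp]: "phi r 0 = 0"
  by (simp add: phi_def)

lemma phi_minus: "phi r (- x) = - phi r x"
  by (simp add: phi_def sgn_minus)

lemma phi_nonneg: "0 \<le> x \<Longrightarrow> phi r x = x powr r"
  by (cases "x = 0") (auto simp: phi_def)

lemma phi_nonpos: "x \<le> 0 \<Longrightarrow> phi r x = - ((- x) powr r)"
  using phi_nonneg[of "- x" r] phi_minus[of r x] by simp

lemma phi_mult: "0 \<le> a \<Longrightarrow> phi r (a * x) = a powr r * phi r x"
  by (cases "a = 0") (auto simp: phi_def sgn_mult abs_mult powr_mult)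

lemma phi_strict_mono:
  assumes "0 < r" "x < y"
  shows "phi r x < phi r y"
proof -
  consider "0 \<le> x" | "x < 0" "0 < y" | "x < 0" "y \<le> 0" using assms by linarith
  then show ?thesis
  proof cases
    case 1 then show ?thesis using assms powr_less_mono2[of r x y] by (simp add: phi_nonneg)
  next
    case 2
    then have "phi r x < 0" "0 < phi r y" by (auto simp: phi_def)
    then show ?thesis by simp
  next
    case 3 then show ?thesis
      using assms powr_less_mono2[of r "- y" "- x"] by (simp add: phi_nonpos)
  qed
qed

lemma phi_mono: "0 < r \<Longrightarrow> x \<le> y \<Longrightarrow> phi r x \<le> phi r y"
  using phi_strict_mono[of r x y] by (cases "x = y") auto

text \<open>Away from 0 the function is locally a smooth power; at 0 the difference quotient is
  bounded by |h|^(p-1), which tends to 0 as p > 1.\<close>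

lemma DERIV_abs_powr:
  assumes "1 < p"
  shows "((\<lambda>x::real. \<bar>x\<bar> powr p) has_real_derivative p * phi (p - 1) x) (at x)"
proof -
  consider "x < 0" | "x = 0" | "0 < x" by linarith
  then show ?thesis
  proof cases
    case 1
    have ev: "\<forall>\<^sub>F y in nhds x. \<bar>y\<bar> powr p = (- y) powr p"
      using 1 by (intro eventually_nhds_in_open[of "{..<0}" x, THEN eventually_mono]) auto
    have "((\<lambda>y. (- y) powr p) has_real_derivative p * (- x) powr (p - 1) * (- 1)) (at x)"
      using 1 by (auto intro!: derivative_eq_intros)
    then show ?thesis using ev 1 by (subst DERIV_cong_ev[OF refl ev refl]) (simp add: phi_nonpos)
  next
    case 3
    have ev: "\<forall>\<^sub>F y in nhds x. \<bar>y\<bar> powr p = y powr p"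
      using 3 by (intro eventually_nhds_in_open[of "{0<..}" x, THEN eventually_mono]) auto
    have "((\<lambda>y. y powr p) has_real_derivative p * x powr (p - 1)) (at x)"
      using 3 by (auto intro!: derivative_eq_intros)
    then show ?thesis using ev 3 by (subst DERIV_cong_ev[OF refl ev refl]) (simp add: phi_nonneg)
  next
    case 2
    have "((\<lambda>h. (\<bar>0 + h\<bar> powr p - \<bar>0\<bar> powr p) / h) \<longlongrightarrow> 0) (at (0::real))"
    proof (rule Lim_null_comparison)
      show "\<forall>\<^sub>F h in at (0::real). norm ((\<bar>0 + h\<bar> powr p - \<bar>0\<bar> powr p) / h) \<le> \<bar>h\<bar> powr (p - 1)"
        by (rule eventually_at_filter[THEN iffD2], rule always_eventually) (auto simp: powr_diff)
      show "((\<lambda>h::real. \<bar>h\<bar> powr (p - 1)) \<longlongrightarrow> 0) (at 0)"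
        using assms by (auto intro!: tendsto_eq_intros)
    qed
    then show ?thesis using 2 by (simp add: DERIV_def)
  qed
qed

lemma continuous_abs_powr: "1 < p \<Longrightarrow> continuous_on A (\<lambda>y::real. \<bar>c - y\<bar> powr p)"
  by (rule continuous_on_powr') (auto intro!: continuous_intros)

section \<open>Growth of powers and signed powers\<close>

lemma powr_diff_le:
  assumes "1 \<le> r" "0 \<le> b" "b \<le> (a::real)"
  shows "a powr r - b powr r \<le> r * (a - b) * a powr (r - 1)"
proof (cases "b = a \<or> a = 0")
  case False
  then have a: "0 < a" "b < a" using assms by (auto simp: less_le)
  show ?thesis
  proof (cases "b = 0")
    case True
    then have "a powr r = a * a powr (r - 1)" using a by (simp add: powr_diff)
    moreover have "a * a powr (r - 1) * 1 \<le> a * a powr (r - 1) * r"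
      using assms a by (intro mult_left_mono) auto
    ultimately show ?thesis using True by (simp add: mult_ac)
  next
    case False
    then have b: "0 < b" using assms by auto
    have "\<exists>z. b < z \<and> z < a \<and> a powr r - b powr r = (a - b) * (r * z powr (r - 1))"
      using a b by (intro MVT2) (auto intro!: derivative_eq_intros)
    then obtain z where z: "b < z" "z < a" "a powr r - b powr r = (a - b) * (r * z powr (r - 1))" by blast
    have "z powr (r - 1) \<le> a powr (r - 1)" using z b assms by (intro powr_mono2) auto
    then have "(a - b) * (r * z powr (r - 1)) \<le> (a - b) * (r * a powr (r - 1))"
      using a assms by (intro mult_left_mono) auto
    then show ?thesis using z by (simp add: mult_ac)
  qed
qed (use assms in auto)

text \<open>After scaling by \<open>a\<close> this reads 1 - t^r \<le> (1 - t)^r for t in [0, 1],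
  which holds because t and 1 - t are at most their own r-th powers.\<close>

lemma powr_subadd:
  assumes "0 < r" "r \<le> 1" "0 \<le> b" "b \<le> (a::real)"
  shows "a powr r - b powr r \<le> (a - b) powr r"
proof (cases "a = 0")
  case True then show ?thesis using assms by auto
next
  case False
  then have a: "0 < a" using assms by simp
  have *: "x \<le> x powr r" if "0 \<le> x" "x \<le> 1" for x :: real
    using powr_mono'[of r 1 x] that assms by (cases "x = 0") auto
  have "a powr r - b powr r = a powr r * (1 - (b / a) powr r)"
    using a assms by (simp add: powr_divide right_diff_distrib)
  also have "\<dots> \<le> a powr r * (1 - b / a)"
    using a assms by (intro mult_left_mono diff_left_mono *) auto
  also have "\<dots> = a powr r * ((a - b) / a)" using a by (simp add: diff_divide_distrib)
  also have "\<dots> \<le> a powr r * ((a - b) / a) powr r"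
    using a assms by (intro mult_left_mono *) auto
  also have "\<dots> = (a - b) powr r"
    using a assms by (simp add: powr_divide)
  finally show ?thesis .
qed

text \<open>Concavity, with the tangent at \<open>D\<close>. In this form a sum of s-th powers of
  degrees is bounded through the sum of the degrees alone.\<close>

lemma powr_tangent:
  fixes d D s :: real
  assumes "0 \<le> s" "s \<le> 1" "0 < D" "0 \<le> d"
  shows "d powr s \<le> D powr s + s * D powr s * (d / D - 1)"
proof (cases "d = 0")
  case True
  then show ?thesis using mult_right_mono[of s 1 "D powr s"] assms by simp
next
  case False
  have "(d / D) powr s = (1 + (d / D - 1)) powr s" by simp
  also have "\<dots> \<le> 1 + s * (d / D - 1)"
  proof (cases "s = 0")
    case True
    then show ?thesis using False assms by simp
  next
    case s: False
    let ?t = "d / D"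
    have t: "0 < ?t" using False assms by auto
    have "s * ln ?t \<le> ln (1 + s * (?t - 1))"
    proof -
      have "(1 - s) * ln 1 + s * ln ?t \<le> ln ((1 - s) * 1 + s * ?t)"
        using convex_onD[OF minus_log_convex[of "exp 1"], of s 1 ?t] t assms
        by (simp add: log_def)
      then show ?thesis by (simp add: algebra_simps)
    qed
    then have "?t powr s \<le> exp (ln (1 + s * (?t - 1)))"
      using t by (simp add: powr_def)
    also have "\<dots> = 1 + s * (?t - 1)"
    proof (rule exp_ln)
      have "1 + s * (?t - 1) = (1 - s) + s * ?t" by (simp add: algebra_simps)
      also have "\<dots> > 0" using s t assms by (intro add_nonneg_pos mult_pos_pos) auto
      finally show "1 + s * (?t - 1) > 0" .
    qed
    finally show ?thesis by simp
  qed
  finally have "D powr s * (d / D) powr s \<le> D powr s * (1 + s * (d / D - 1))"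
    by (intro mult_left_mono) auto
  then show ?thesis using assms by (simp add: powr_divide algebra_simps)
qed

text \<open>For equal signs this is subadditivity with constant 1; for different signs both |a| and
  |b| are at most a - b, whence the factor 2.\<close>

lemma phi_diff_Holder:
  assumes "0 < r" "r \<le> 1" "b \<le> a"
  shows "phi r a - phi r b \<le> 2 * (a - b) powr r"
proof -
  have ge: "(a - b) powr r \<ge> 0" by simp
  consider "0 \<le> b" | "b < 0" "0 \<le> a" | "a < 0" using assms by linarith
  then show ?thesis
  proof cases
    case 1
    then have "phi r a - phi r b \<le> (a - b) powr r"
      using assms powr_subadd[of r b a] by (simp add: phi_nonneg)
    then show ?thesis using ge by linarith
  next
    case 2
    have "a powr r \<le> (a - b) powr r" "(- b) powr r \<le> (a - b) powr r"
      using 2 assms by (auto intro!: powr_mono2)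
    then show ?thesis using 2 by (simp add: phi_nonneg phi_nonpos)
  next
    case 3
    then have "phi r a - phi r b \<le> (a - b) powr r"
      using assms powr_subadd[of r "- a" "- b"] by (simp add: phi_nonpos)
    then show ?thesis using ge by linarith
  qed
qed

lemma phi_diff_Lipschitz:
  assumes "1 \<le> r" "b \<le> a" "\<bar>a\<bar> \<le> D" "\<bar>b\<bar> \<le> D"
  shows "phi r a - phi r b \<le> r * (a - b) * D powr (r - 1)"
proof -
  have pm: "x powr (r - 1) \<le> D powr (r - 1)" if "0 \<le> x" "x \<le> D" for x
    using that assms by (intro powr_mono2) auto
  have step: "a' powr r - b' powr r \<le> r * (a' - b') * D powr (r - 1)"
    if "0 \<le> b'" "b' \<le> a'" "a' \<le> D" for a' b'
  proof -
    have "r * (a' - b') * a' powr (r - 1) \<le> r * (a' - b') * D powr (r - 1)"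
      using that assms by (intro mult_left_mono pm) auto
    then show ?thesis using powr_diff_le[of r b' a'] that assms by linarith
  qed
  consider "0 \<le> b" | "b < 0" "0 \<le> a" | "a < 0" using assms by linarith
  then show ?thesis
  proof cases
    case 1 then show ?thesis using assms step[of b a] by (simp add: phi_nonneg)
  next
    case 2
    then show ?thesis using step[of 0 a] step[of 0 "- b"] assms
      by (simp add: phi_nonneg phi_nonpos algebra_simps)
  next
    case 3 then show ?thesis using assms step[of "- a" "- b"] by (simp add: phi_nonpos)
  qed
qed

section \<open>First-order expansions of |x|^p\<close>

lemma abs_powr_MVT:
  assumes "1 < p" "d \<noteq> 0"
  shows "\<exists>z. \<bar>z - x\<bar> \<le> \<bar>d\<bar> \<and> \<bar>x + d\<bar> powr p - \<bar>x\<bar> powr p = p * phi (p - 1) z * d"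
proof (cases "0 < d")
  case True
  then have "\<exists>z. x < z \<and> z < x + d \<and> \<bar>x + d\<bar> powr p - \<bar>x\<bar> powr p = (x + d - x) * (p * phi (p - 1) z)"
    using assms by (intro MVT2 DERIV_abs_powr) auto
  then obtain z where "x < z" "z < x + d" "\<bar>x + d\<bar> powr p - \<bar>x\<bar> powr p = (x + d - x) * (p * phi (p - 1) z)" by blast
  then show ?thesis using True by (intro exI[of _ z]) (auto simp: algebra_simps)
next
  case False
  then have "\<exists>z. x + d < z \<and> z < x \<and> \<bar>x\<bar> powr p - \<bar>x + d\<bar> powr p = (x - (x + d)) * (p * phi (p - 1) z)"
    using assms by (intro MVT2 DERIV_abs_powr) auto
  then obtain z where "x + d < z" "z < x" "\<bar>x\<bar> powr p - \<bar>x + d\<bar> powr p = (x - (x + d)) * (p * phi (p - 1) z)" by blast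
  then show ?thesis using False by (intro exI[of _ z]) (auto simp: algebra_simps)
qed

text \<open>For p \<le> 2 the derivative is only Hoelder continuous of exponent p - 1. The remainder
  is then independent of \<open>x\<close>, so its sum over the arcs just counts arcs.\<close>

lemma abs_powr_Taylor_le2:
  assumes "1 < p" "p \<le> 2"
  shows "\<bar>x + d\<bar> powr p \<le> \<bar>x\<bar> powr p + p * phi (p - 1) x * d + 2 * p * \<bar>d\<bar> powr p"
proof (cases "d = 0")
  case False
  then obtain z where z: "\<bar>z - x\<bar> \<le> \<bar>d\<bar>" "\<bar>x + d\<bar> powr p - \<bar>x\<bar> powr p = p * phi (p - 1) z * d"
    using abs_powr_MVT[of p d x] assms by auto
  have H: "\<bar>phi (p - 1) z - phi (p - 1) x\<bar> \<le> 2 * \<bar>z - x\<bar> powr (p - 1)"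
    using phi_diff_Holder[of "p - 1" x z] phi_diff_Holder[of "p - 1" z x] phi_mono[of "p - 1" x z] phi_mono[of "p - 1" z x] assms
    by (cases "x \<le> z") auto
  also have "\<dots> \<le> 2 * \<bar>d\<bar> powr (p - 1)" using z assms by (auto intro!: powr_mono2)
  finally have H: "\<bar>phi (p - 1) z - phi (p - 1) x\<bar> \<le> 2 * \<bar>d\<bar> powr (p - 1)" .
  have "(phi (p - 1) z - phi (p - 1) x) * d \<le> \<bar>phi (p - 1) z - phi (p - 1) x\<bar> * \<bar>d\<bar>"
    by (metis abs_ge_self abs_mult)
  also have "\<dots> \<le> 2 * \<bar>d\<bar> powr (p - 1) * \<bar>d\<bar>" using H by (intro mult_right_mono) auto
  also have "\<dots> = 2 * \<bar>d\<bar> powr p" using False by (simp add: powr_diff)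
  finally have "p * ((phi (p - 1) z - phi (p - 1) x) * d) \<le> p * (2 * \<bar>d\<bar> powr p)"
    using assms by (intro mult_left_mono) auto
  then show ?thesis using z(2) by (simp add: algebra_simps)
qed simp

text \<open>For p > 2 the derivative has a local Lipschitz constant of order (|x| + |d|)^(p-2).
  Splitting this power isolates a quadratic term, whose sum over the edges is what
  \<open>ranked_edges.sum_powr_pred_le\<close> estimates.\<close>

lemma abs_powr_Taylor_gt2:
  assumes "2 < p"
  shows "\<bar>x + d\<bar> powr p \<le> \<bar>x\<bar> powr p + p * phi (p - 1) x * d
     + p * p * 2 powr (p - 2) * (\<bar>x\<bar> powr (p - 2) * d\<^sup>2 + \<bar>d\<bar> powr p)"
proof (cases "d = 0")
  case False
  then obtain z where z: "\<bar>z - x\<bar> \<le> \<bar>d\<bar>" "\<bar>x + d\<bar> powr p - \<bar>x\<bar> powr p = p * phi (p - 1) z * d"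
    using abs_powr_MVT[of p d x] assms by auto
  let ?D = "\<bar>x\<bar> + \<bar>d\<bar>"
  have H: "\<bar>phi (p - 1) z - phi (p - 1) x\<bar> \<le> (p - 1) * \<bar>z - x\<bar> * ?D powr (p - 1 - 1)"
    using phi_diff_Lipschitz[of "p - 1" x z ?D] phi_diff_Lipschitz[of "p - 1" z x ?D] phi_mono[of "p - 1" x z] phi_mono[of "p - 1" z x] assms z
    by (cases "x \<le> z") auto
  have D: "?D powr (p - 2) \<le> 2 powr (p - 2) * (\<bar>x\<bar> powr (p - 2) + \<bar>d\<bar> powr (p - 2))"
  proof -
    have "?D powr (p - 2) \<le> (2 * max \<bar>x\<bar> \<bar>d\<bar>) powr (p - 2)" using assms by (intro powr_mono2) auto
    also have "\<dots> = 2 powr (p - 2) * max \<bar>x\<bar> \<bar>d\<bar> powr (p - 2)" by (simp add: powr_mult)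
    also have "\<dots> \<le> 2 powr (p - 2) * (\<bar>x\<bar> powr (p - 2) + \<bar>d\<bar> powr (p - 2))"
      by (intro mult_left_mono) (auto simp: max_def)
    finally show ?thesis .
  qed
  have H2: "\<bar>phi (p - 1) z - phi (p - 1) x\<bar> \<le> p * \<bar>d\<bar> * (2 powr (p - 2) * (\<bar>x\<bar> powr (p - 2) + \<bar>d\<bar> powr (p - 2)))"
    by (rule order.trans[OF H]) (use z assms D in \<open>intro mult_mono; simp\<close>)
  have dd: "d\<^sup>2 = \<bar>d\<bar> * \<bar>d\<bar>" by (simp add: power2_eq_square)
  have "\<bar>phi (p - 1) z - phi (p - 1) x\<bar> * \<bar>d\<bar> \<le> p * \<bar>d\<bar> * (2 powr (p - 2) * (\<bar>x\<bar> powr (p - 2) + \<bar>d\<bar> powr (p - 2))) * \<bar>d\<bar>"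
    using H2 by (intro mult_right_mono) auto
  also have "\<dots> = p * 2 powr (p - 2) * (\<bar>x\<bar> powr (p - 2) * d\<^sup>2 + \<bar>d\<bar> powr (p - 2) * d\<^sup>2)"
    by (simp only: dd) (simp only: algebra_simps)
  also have "\<bar>d\<bar> powr (p - 2) * d\<^sup>2 = \<bar>d\<bar> powr p"
    using False by (simp add: powr_diff power2_eq_square powr_numeral)
  finally have "\<bar>phi (p - 1) z - phi (p - 1) x\<bar> * \<bar>d\<bar> \<le> p * 2 powr (p - 2) * (\<bar>x\<bar> powr (p - 2) * d\<^sup>2 + \<bar>d\<bar> powr p)" .
  moreover have "(phi (p - 1) z - phi (p - 1) x) * d \<le> \<bar>phi (p - 1) z - phi (p - 1) x\<bar> * \<bar>d\<bar>"
    by (metis abs_ge_self abs_mult)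
  ultimately have "p * ((phi (p - 1) z - phi (p - 1) x) * d) \<le> p * (p * 2 powr (p - 2) * (\<bar>x\<bar> powr (p - 2) * d\<^sup>2 + \<bar>d\<bar> powr p))"
    using assms by (intro mult_left_mono) auto
  then show ?thesis using z(2) by (simp add: algebra_simps)
qed simp

section \<open>Existence and balance of the minimiser\<close>

lemma lp_mean:
  fixes x :: "'a \<Rightarrow> real"
  assumes p: "1 < p" and S: "finite S" "S \<noteq> {}"
  defines "y \<equiv> arg_min (\<lambda>y. \<Sum>w\<in>S. \<bar>x w - y\<bar> powr p) (\<lambda>_. True)"
  shows lp_mean_min: "(\<Sum>w\<in>S. \<bar>x w - y\<bar> powr p) \<le> (\<Sum>w\<in>S. \<bar>x w - z\<bar> powr p)"
    and lp_mean_balance: "(\<Sum>w\<in>S. phi (p - 1) (y - x w)) = 0"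
proof -
  let ?h = "\<lambda>y. \<Sum>w\<in>S. \<bar>x w - y\<bar> powr p"
  let ?a = "Min (x ` S)" and ?b = "Max (x ` S)"
  have ab: "?a \<le> x w" "x w \<le> ?b" if "w \<in> S" for w using that S by auto
  then have "?a \<le> ?b" using S by (metis Min_in Max_ge finite_imageI image_is_empty)
  then obtain y0 where y0: "y0 \<in> {?a..?b}" "\<And>z. z \<in> {?a..?b} \<Longrightarrow> ?h y0 \<le> ?h z"
  proof -
    have "continuous_on {?a..?b} ?h" using p by (intro continuous_on_sum continuous_abs_powr)
    then have "\<exists>y0\<in>{?a..?b}. \<forall>z\<in>{?a..?b}. ?h y0 \<le> ?h z"
      using \<open>?a \<le> ?b\<close> by (intro continuous_attains_inf) auto
    then show thesis using that by blast
  qed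
  have out: "?h y0 \<le> ?h z" for z
  proof -
    \<comment> \<open>Clamping \<open>z\<close> to the range of the data moves it no farther from
      any \<open>x w\<close>, so the minimum on the compact interval is global.\<close>
    define c where "c = max ?a (min ?b z)"
    have "?h y0 \<le> ?h c" using \<open>?a \<le> ?b\<close> by (intro y0) (auto simp: c_def)
    also have "\<dots> \<le> ?h z"
      using ab p \<open>?a \<le> ?b\<close> by (intro sum_mono powr_mono2) (force simp: c_def max_def min_def)+
    finally show ?thesis .
  qed
  \<comment> \<open>\<open>arg_min\<close> is a choice operator; its defining property follows from
    the existence of \<open>y0\<close>.\<close>
  have "is_arg_min ?h (\<lambda>_. True) y"
    unfolding y_def arg_min_def by (rule someI[of _ y0]) (use out in \<open>auto simp: is_arg_min_def not_less\<close>)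
  then have min: "?h y \<le> ?h z" for z by (auto simp: is_arg_min_def not_less)
  then show "?h y \<le> ?h z" .
  have "((\<lambda>y. \<Sum>w\<in>S. \<bar>y - x w\<bar> powr p) has_real_derivative (\<Sum>w\<in>S. p * phi (p - 1) (y - x w))) (at y)"
  proof (intro DERIV_sum)
    fix w
    have "((\<lambda>z. \<bar>z\<bar> powr p) has_real_derivative p * phi (p - 1) (y - x w)) (at (y - x w))"
      by (rule DERIV_abs_powr[OF p])
    then show "((\<lambda>y. \<bar>y - x w\<bar> powr p) has_real_derivative p * phi (p - 1) (y - x w)) (at y)"
      using DERIV_shift[of "\<lambda>z. \<bar>z\<bar> powr p" "p * phi (p - 1) (y - x w)" y "- x w"] by simp
  qed
  then have "(\<Sum>w\<in>S. p * phi (p - 1) (y - x w)) = 0"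
    using min by (intro DERIV_local_min[of _ _ _ 1]) (auto simp: abs_minus_commute)
  then show "(\<Sum>w\<in>S. phi (p - 1) (y - x w)) = 0"
    using p by (simp flip: sum_distrib_left)
qed

text \<open>The balance is strictly increasing in its argument and vanishes at the mean, so its sign
  at \<open>B\<close> decides on which side \<open>B\<close> lies.\<close>

lemma lp_mean_le:
  fixes x :: "'a \<Rightarrow> real"
  assumes p: "1 < p" and S: "finite S" "S \<noteq> {}" and B: "0 \<le> (\<Sum>w\<in>S. phi (p - 1) (B - x w))"
  shows "arg_min (\<lambda>y. \<Sum>w\<in>S. \<bar>x w - y\<bar> powr p) (\<lambda>_. True) \<le> B" (is "?y \<le> B")
proof (rule ccontr)
  assume "\<not> ?y \<le> B"
  then have "(\<Sum>w\<in>S. phi (p - 1) (B - x w)) < (\<Sum>w\<in>S. phi (p - 1) (?y - x w))"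
    using p S by (intro sum_strict_mono phi_strict_mono) auto
  then show False using B lp_mean_balance[OF p S, of x] by simp
qed

lemma lp_mean_ge:
  fixes x :: "'a \<Rightarrow> real"
  assumes p: "1 < p" and S: "finite S" "S \<noteq> {}" and B: "(\<Sum>w\<in>S. phi (p - 1) (B - x w)) \<le> 0"
  shows "B \<le> arg_min (\<lambda>y. \<Sum>w\<in>S. \<bar>x w - y\<bar> powr p) (\<lambda>_. True)" (is "B \<le> ?y")
proof (rule ccontr)
  assume "\<not> B \<le> ?y"
  then have "(\<Sum>w\<in>S. phi (p - 1) (?y - x w)) < (\<Sum>w\<in>S. phi (p - 1) (B - x w))"
    using p S by (intro sum_strict_mono phi_strict_mono) auto
  then show False using B lp_mean_balance[OF p S, of x] by simp
qed

subsection \<open>Flow across the gaps of a ranked graph\<close>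

text \<open>Vertices are replaced by their ranks, edges point to larger ranks, and gap
  \<open>m\<close> lies between the ranks m - 1 and m. Connectedness survives as \<open>cut\<close>,
  an edge over every gap. In the application r = p - 1.\<close>

locale ranked_edges =
  fixes n :: nat and A :: "(nat \<times> nat) set" and x :: "nat \<Rightarrow> real" and r :: real
  assumes n2: "2 \<le> n"
    and A_sub: "A \<subseteq> {(i, j). i < j \<and> j < n}"
    and cut: "\<And>m. 0 < m \<Longrightarrow> m < n \<Longrightarrow> \<exists>(i, j)\<in>A. i < m \<and> m \<le> j"
    and mono: "\<And>i j. i \<le> j \<Longrightarrow> j < n \<Longrightarrow> x i \<le> x j"
    and r0: "0 < r"
begin

definition flow :: "nat \<Rightarrow> real" where
  "flow m = (\<Sum>(i, j)\<in>{e\<in>A. fst e < m \<and> m \<le> snd e}. (x j - x i) powr r)"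

lemma finite_A: "finite A"
  by (rule finite_subset[of _ "{..<n} \<times> {..<n}"]) (use A_sub in auto)

lemma A_D: "(i, j) \<in> A \<Longrightarrow> i < j \<and> j < n \<and> x i \<le> x j"
  using A_sub mono[of i j] by auto

text \<open>Double counting: the edge (i, j) crosses exactly the gaps i + 1, ..., j. Gap lengths as
  weights \<open>c\<close> give the energy, constant weights the rank differences.\<close>

lemma sum_over_gaps:
  fixes c :: "nat \<Rightarrow> real"
  shows "(\<Sum>(i, j)\<in>A. (x j - x i) powr r * (\<Sum>m\<in>{Suc i..j}. c m)) = (\<Sum>m\<in>{1..<n}. c m * flow m)"
proof -
  have "(\<Sum>(i, j)\<in>A. (x j - x i) powr r * (\<Sum>m\<in>{Suc i..j}. c m))
      = (\<Sum>e\<in>A. \<Sum>m\<in>{m\<in>{1..<n}. fst e < m \<and> m \<le> snd e}. c m * (x (snd e) - x (fst e)) powr r)"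
  proof (intro sum.cong refl, clarify)
    fix i j assume "(i, j) \<in> A"
    then have "{m\<in>{1..<n}. i < m \<and> m \<le> j} = {Suc i..j}" using A_D by fastforce
    then show "(x j - x i) powr r * (\<Sum>m\<in>{Suc i..j}. c m) =
        (\<Sum>m\<in>{m\<in>{1..<n}. fst (i, j) < m \<and> m \<le> snd (i, j)}. c m * (x (snd (i, j)) - x (fst (i, j))) powr r)"
      by (simp add: sum_distrib_left sum_distrib_right mult.commute)
  qed
  also have "\<dots> = (\<Sum>m\<in>{1..<n}. \<Sum>e\<in>{e\<in>A. fst e < m \<and> m \<le> snd e}. c m * (x (snd e) - x (fst e)) powr r)"
    by (rule sum.swap_restrict) (auto simp: finite_A)
  also have "\<dots> = (\<Sum>m\<in>{1..<n}. c m * flow m)"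
    by (simp add: flow_def sum_distrib_left case_prod_beta)
  finally show ?thesis .
qed

lemma gap_le_flow:
  assumes "0 < m" "m < n"
  shows "(x m - x (m - 1)) powr r \<le> flow m"
proof -
  obtain i j where ij: "(i, j) \<in> A" "i < m" "m \<le> j" using cut[OF assms] by auto
  have "x i \<le> x (m - 1)" "x m \<le> x j" "x (m - 1) \<le> x m"
    using ij A_D assms by (auto intro!: mono)
  then have "(x m - x (m - 1)) powr r \<le> (x j - x i) powr r"
    using r0 by (intro powr_mono2) auto
  also have "\<dots> = (\<Sum>(i, j)\<in>{(i, j)}. (x j - x i) powr r)" by simp
  also have "\<dots> \<le> flow m" unfolding flow_def
    using ij finite_A by (intro sum_mono2) auto
  finally show ?thesis .
qed

text \<open>The \<open>M\<close> of the overview: the root gives it the dimension of a difference of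
  values.\<close>

definition height :: real where
  "height = Max (flow ` {1..<n}) powr (1 / r)"

lemma flow_nonneg: "0 \<le> flow m"
  unfolding flow_def by (intro sum_nonneg) auto

lemma height_nonneg: "0 \<le> height"
  by (simp add: height_def)

lemma height_powr: "height powr r = Max (flow ` {1..<n})"
proof -
  have "0 \<le> Max (flow ` {1..<n})"
    using n2 flow_nonneg[of 1] by (intro order.trans[OF flow_nonneg[of 1]] Max_ge) auto
  then show ?thesis using r0 by (simp add: height_def powr_powr)
qed

lemma flow_le: "0 < m \<Longrightarrow> m < n \<Longrightarrow> flow m \<le> height powr r"
  unfolding height_powr by (intro Max_ge) auto

lemma gap_le: 
  assumes "0 < m" "m < n"
  shows "x m - x (m - 1) \<le> height"
proof -
  have "(x m - x (m - 1)) powr r \<le> height powr r"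
    using gap_le_flow[OF assms] flow_le[OF assms] by linarith
  then show ?thesis
    using r0 height_nonneg powr_less_mono2[of r height "x m - x (m - 1)"] by force
qed

lemma flow_max: obtains m where "0 < m" "m < n" "flow m = height powr r"
proof -
  have "Max (flow ` {1..<n}) \<in> flow ` {1..<n}" using n2 by (intro Max_in) auto
  then obtain m where "m \<in> {1..<n}" "flow m = Max (flow ` {1..<n})" by (metis imageE)
  then show thesis using that[of m] by (simp add: height_powr)
qed

text \<open>One factor x j - x i is telescoped over the gaps; after exchanging the sums every gap
  contributes its length, at most \<open>height\<close>, times its flow, at most
  \<open>height powr r\<close>.\<close>

lemma sum_powr_Suc_le: "(\<Sum>(i, j)\<in>A. (x j - x i) powr (r + 1)) \<le> n * height powr (r + 1)"
proof -
  have "(\<Sum>(i, j)\<in>A. (x j - x i) powr (r + 1))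
      = (\<Sum>(i, j)\<in>A. (x j - x i) powr r * (\<Sum>m\<in>{Suc i..j}. x m - x (m - 1)))"
  proof (intro sum.cong refl, clarify)
    fix i j assume "(i, j) \<in> A"
    then have ij: "i < j" "x i \<le> x j" using A_D by auto
    then have "(\<Sum>m\<in>{Suc i..j}. x m - x (m - 1)) = x j - x i"
      by (intro sum_telescope'') simp
    then show "(x j - x i) powr (r + 1) = (x j - x i) powr r * (\<Sum>m\<in>{Suc i..j}. x m - x (m - 1))"
      using ij by (simp add: powr_add)
  qed
  also have "\<dots> = (\<Sum>m\<in>{1..<n}. (x m - x (m - 1)) * flow m)" by (rule sum_over_gaps)
  also have "\<dots> \<le> (\<Sum>m\<in>{1..<n}. height * height powr r)"
    by (intro sum_mono mult_mono gap_le flow_le height_nonneg flow_nonneg) auto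
  also have "\<dots> = (n - 1) * height powr (r + 1)"
    using height_nonneg n2 by (simp add: powr_add)
  also have "\<dots> \<le> n * height powr (r + 1)" by (intro mult_right_mono) auto
  finally show ?thesis .
qed

lemma sum_length_le: "(\<Sum>(i, j)\<in>A. (x j - x i) powr r * real (j - i)) \<le> n * height powr r"
proof -
  have "(\<Sum>(i, j)\<in>A. (x j - x i) powr r * real (j - i))
      = (\<Sum>(i, j)\<in>A. (x j - x i) powr r * (\<Sum>m\<in>{Suc i..j}. 1))" by simp
  also have "\<dots> = (\<Sum>m\<in>{1..<n}. 1 * flow m)" by (rule sum_over_gaps)
  also have "\<dots> \<le> (\<Sum>m\<in>{1..<n}. height powr r)"
    using flow_le by (intro sum_mono) auto
  also have "\<dots> \<le> n * height powr r" by (simp add: mult_right_mono)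
  finally show ?thesis .
qed

lemma diff_eq_0_if_height_0:
  assumes "height = 0" "(i, j) \<in> A"
  shows "x j = x i"
proof -
  have "(\<Sum>(i, j)\<in>A. (x j - x i) powr r * real (j - i)) = 0"
    using sum_length_le assms by (intro antisym sum_nonneg) auto
  then have "(x j - x i) powr r * real (j - i) = 0"
    using assms finite_A by (subst (asm) sum_nonneg_eq_0_iff) auto
  then show ?thesis using A_D[OF assms(2)] by auto
qed

definition up_deg :: "nat \<Rightarrow> nat" where
  "up_deg i = card {j. (i, j) \<in> A}"

lemma finite_up: "finite {j. (i, j) \<in> A}"
  by (rule finite_subset[of _ "{..<n}"]) (use A_sub in auto)

lemma sum_fibres: "(\<Sum>(i, j)\<in>A. g i j) = (\<Sum>i<n. \<Sum>j\<in>{j. (i, j) \<in> A}. g i j)" for g :: "nat \<Rightarrow> nat \<Rightarrow> real"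
proof -
  have "A = Sigma {..<n} (\<lambda>i. {j. (i, j) \<in> A})" using A_sub by auto
  then show ?thesis using finite_up sum.Sigma[of "{..<n}" "\<lambda>i. {j. (i, j) \<in> A}" g] by simp
qed

lemma card_A: "real (card A) = (\<Sum>i<n. real (up_deg i))"
  using sum_fibres[of "\<lambda>_ _. 1"] by (simp add: up_deg_def)

text \<open>Short edges: the farthest one bounds the whole fibre, since differences grow with rank.\<close>

lemma short_edges_at:
  assumes "1 < r" "0 < L"
  shows "(\<Sum>j\<in>{j. (i, j) \<in> A \<and> real (j - i) * (x j - x i) \<le> L}. (x j - x i) powr (r - 1))
      \<le> L powr (r - 1) * real (up_deg i) powr (max 0 (2 - r))"
proof (cases "{j. (i, j) \<in> A \<and> real (j - i) * (x j - x i) \<le> L} = {}")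
  case False
  define U where "U = {j. (i, j) \<in> A \<and> real (j - i) * (x j - x i) \<le> L}"
  have finU: "finite U" by (rule finite_subset[OF _ finite_up[of i]]) (auto simp: U_def)
  define K where "K = Max U - i"
  have MU: "Max U \<in> U" using False finU by (intro Max_in) (auto simp: U_def)
  have K0: "0 < K" using MU A_D by (auto simp: K_def U_def)
  have "U \<subseteq> {Suc i..i + K}"
  proof
    fix j assume j: "j \<in> U"
    then have "j \<le> Max U" "i < j" using finU A_D by (auto simp: U_def)
    then show "j \<in> {Suc i..i + K}" by (simp add: K_def)
  qed
  then have cK: "card U \<le> K" using card_mono[of "{Suc i..i + K}" U] by simp
  have U0: "0 < card U" using MU finU by (metis card_gt_0_iff empty_iff)
  have cd: "card U \<le> up_deg i" unfolding up_deg_def by (intro card_mono finite_up) (auto simp: U_def)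
  have "x j - x i \<le> L / K" if "j \<in> U" for j
  proof -
    have "x j \<le> x (Max U)" using that MU A_D finU by (intro mono) (auto simp: U_def)
    moreover have "real K * (x (Max U) - x i) \<le> L" using MU by (simp add: U_def K_def)
    then have "x (Max U) - x i \<le> L / K" using K0 by (simp add: field_simps)
    ultimately show ?thesis by simp
  qed
  then have "(\<Sum>j\<in>U. (x j - x i) powr (r - 1)) \<le> (\<Sum>j\<in>U. (L / K) powr (r - 1))"
    using assms A_D by (intro sum_mono powr_mono2) (auto simp: U_def)
  also have "\<dots> = L powr (r - 1) * (real (card U) * real K powr (1 - r))"
    using assms by (simp add: powr_divide powr_diff field_simps)
  \<comment> \<open>The exponent 1 - r is negative, so the distance \<open>K\<close> may be replaced
    by the smaller number of short edges; what remains is a (2 - r)-th power of a degree.\<close>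
  also have "\<dots> \<le> L powr (r - 1) * (real (card U) * real (card U) powr (1 - r))"
    using assms cK U0 by (intro mult_left_mono powr_mono2') auto
  also have "real (card U) * real (card U) powr (1 - r) = real (card U) powr (2 - r)"
    using U0 by (simp add: powr_diff powr_numeral power2_eq_square)
  also have "L powr (r - 1) * real (card U) powr (2 - r) \<le> L powr (r - 1) * real (up_deg i) powr (max 0 (2 - r))"
  proof (intro mult_left_mono)
    have "real (card U) powr (2 - r) \<le> real (card U) powr (max 0 (2 - r))"
      using U0 by (intro powr_mono) auto
    also have "\<dots> \<le> real (up_deg i) powr (max 0 (2 - r))"
      using cd by (intro powr_mono2) auto
    finally show "real (card U) powr (2 - r) \<le> real (up_deg i) powr (max 0 (2 - r))" .
  qed auto
  finally show ?thesis by (simp add: U_def)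
next
  case True
  show ?thesis unfolding True by simp
qed

text \<open>Edges whose rank difference times value difference exceeds \<open>l * height\<close> are
  charged to \<open>sum_length_le\<close>, the others to their lower endpoint by
  \<open>short_edges_at\<close>. Since s \<le> 1, concavity turns the degrees of the endpoints into
  their average.\<close>

lemma sum_powr_pred_le:
  fixes D :: real
  assumes r: "1 < r" and D: "1 \<le> D" "real (card A) \<le> n * D"
  shows "(\<Sum>(i, j)\<in>A. (x j - x i) powr (r - 1)) \<le> 2 * n * height powr (r - 1) * D powr (max 0 (2 - r) / r)"
proof (cases "height = 0")
  case True
  have "(\<Sum>(i, j)\<in>A. (x j - x i) powr (r - 1)) = 0"
    using diff_eq_0_if_height_0[OF True] by (intro sum.neutral) auto
  then show ?thesis by simp
next
  case False
  then have h: "0 < height" using height_nonneg by linarith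
  define s where "s = max 0 (2 - r)"
  \<comment> \<open>This threshold balances the two contributions: 1 / l for the long edges and
    l^(r-1) D^s for the short ones both become D^(s/r).\<close>
  define l where "l = D powr (- (s / r))"
  have l0: "0 < l" using D by (auto simp: l_def)
  have s01: "0 \<le> s" "s \<le> 1" using r by (auto simp: s_def)
  have split: "(x j - x i) powr (r - 1) \<le> (x j - x i) powr r * real (j - i) / (l * height)
      + (if real (j - i) * (x j - x i) \<le> l * height then (x j - x i) powr (r - 1) else 0)"
    if "(i, j) \<in> A" for i j
  proof (cases "real (j - i) * (x j - x i) \<le> l * height")
    case True
    then show ?thesis using l0 h by simp
  next
    case False
    then have *: "l * height < real (j - i) * (x j - x i)" by simp
    then have pos: "0 < x j - x i"
      using l0 h A_D[OF that] by (smt (verit) mult_nonneg_nonpos mult_pos_pos of_nat_0_le_iff)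
    have "(x j - x i) powr (r - 1) * (l * height) \<le> (x j - x i) powr (r - 1) * (real (j - i) * (x j - x i))"
      using * by (intro mult_left_mono) auto
    also have "\<dots> = (x j - x i) powr r * real (j - i)"
      using pos by (simp add: powr_diff)
    finally show ?thesis using False l0 h by (simp add: field_simps)
  qed
  have "(\<Sum>(i, j)\<in>A. (x j - x i) powr (r - 1))
    \<le> (\<Sum>(i, j)\<in>A. (x j - x i) powr r * real (j - i) / (l * height)
      + (if real (j - i) * (x j - x i) \<le> l * height then (x j - x i) powr (r - 1) else 0))"
    using split by (intro sum_mono) auto
  also have "\<dots> = (\<Sum>(i, j)\<in>A. (x j - x i) powr r * real (j - i)) / (l * height)
      + (\<Sum>(i, j)\<in>A. if real (j - i) * (x j - x i) \<le> l * height then (x j - x i) powr (r - 1) else 0)"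
    by (simp add: case_prod_beta sum.distrib sum_divide_distrib)
  also have "(\<Sum>(i, j)\<in>A. (x j - x i) powr r * real (j - i)) / (l * height) \<le> n * height powr r / (l * height)"
    using l0 h by (intro divide_right_mono sum_length_le) auto
  also have "n * height powr r / (l * height) = n * height powr (r - 1) * D powr (s / r)"
    using h D by (simp add: l_def powr_diff powr_minus field_simps)
  also have "(\<Sum>(i, j)\<in>A. if real (j - i) * (x j - x i) \<le> l * height then (x j - x i) powr (r - 1) else 0)
      = (\<Sum>i<n. \<Sum>j\<in>{j. (i, j) \<in> A \<and> real (j - i) * (x j - x i) \<le> l * height}. (x j - x i) powr (r - 1))"
    unfolding sum_fibres[of "\<lambda>i j. if real (j - i) * (x j - x i) \<le> l * height then (x j - x i) powr (r - 1) else 0"]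
  proof (rule sum.cong[OF refl])
    fix i
    show "(\<Sum>j\<in>{j. (i, j) \<in> A}. if real (j - i) * (x j - x i) \<le> l * height then (x j - x i) powr (r - 1) else 0)
        = (\<Sum>j\<in>{j. (i, j) \<in> A \<and> real (j - i) * (x j - x i) \<le> l * height}. (x j - x i) powr (r - 1))"
      using sum.inter_filter[OF finite_up, of "\<lambda>j. (x j - x i) powr (r - 1)" i
          "\<lambda>j. real (j - i) * (x j - x i) \<le> l * height"] by simp
  qed
  also have "\<dots> \<le> (\<Sum>i<n. (l * height) powr (r - 1) * real (up_deg i) powr s)"
    unfolding s_def using l0 h by (intro sum_mono short_edges_at r) auto
  \<comment> \<open>Jensen's inequality in the form of a tangent at \<open>D\<close>; the linear
    terms sum to something nonpositive because the average of \<open>up_deg\<close> is at most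
    \<open>D\<close>.\<close>
  also have "\<dots> \<le> (\<Sum>i<n. (l * height) powr (r - 1) * (D powr s + s * D powr s * (real (up_deg i) / D - 1)))"
    using D s01 by (intro sum_mono mult_left_mono powr_tangent) auto
  also have "\<dots> = (l * height) powr (r - 1) * (n * D powr s + s * D powr s * ((\<Sum>i<n. real (up_deg i)) / D - n))"
    by (simp add: sum_distrib_left[symmetric] sum.distrib sum_subtractf sum_divide_distrib[symmetric])
  also have "\<dots> \<le> (l * height) powr (r - 1) * (n * D powr s)"
  proof (intro mult_left_mono)
    have "(\<Sum>i<n. real (up_deg i)) / D \<le> n" using D card_A by (simp add: field_simps)
    then have "s * D powr s * ((\<Sum>i<n. real (up_deg i)) / D - n) \<le> 0"
      using s01 by (intro mult_nonneg_nonpos) auto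
    then show "n * D powr s + s * D powr s * ((\<Sum>i<n. real (up_deg i)) / D - n) \<le> n * D powr s" by simp
  qed auto
  also have "\<dots> = n * height powr (r - 1) * D powr (s / r)"
  proof -
    have "l powr (r - 1) * D powr s = D powr (- (s / r) * (r - 1) + s)"
      by (simp only: l_def powr_powr powr_add)
    also have "- (s / r) * (r - 1) + s = s / r" using r by (simp add: field_simps)
    finally show ?thesis using l0 h by (simp add: powr_mult mult_ac)
  qed
  finally show ?thesis by (simp add: s_def)
qed

end

subsection \<open>Energy decrease in one step\<close>

locale finite_connected =
  fixes G :: "'a pair_pre_digraph"
  assumes fin: "finite (pverts G)"
    and arcD: "(u, v) \<in> parcs G \<Longrightarrow> u \<in> pverts G \<and> v \<in> pverts G \<and> u \<noteq> v"
    and sym: "(u, v) \<in> parcs G \<Longrightarrow> (v, u) \<in> parcs G"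
    and card2: "2 \<le> card (pverts G)"
    and cut: "S \<subseteq> pverts G \<Longrightarrow> S \<noteq> {} \<Longrightarrow> S \<noteq> pverts G \<Longrightarrow> \<exists>(u, v)\<in>parcs G. u \<in> S \<and> v \<notin> S"

text \<open>By symmetry of the arcs connectedness gives directed reachability, and without an arc
  leaving \<open>S\<close> everything reachable from a vertex of \<open>S\<close> would stay in
  \<open>S\<close>.\<close>

lemma finite_connected_if_pair_graph:
  assumes G: "pair_graph G" and con: "Digraph_Component.connected (with_proj G)"
    and n: "2 \<le> card (pverts G)"
  shows "finite_connected G"
proof -
  interpret pair_graph G by fact
  show ?thesis
  proof
    show "finite (pverts G)" by (rule pair_finite_verts)
    show "u \<in> pverts G \<and> v \<in> pverts G \<and> u \<noteq> v" if "(u, v) \<in> parcs G" for u v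
      using that pair_no_loops in_arcsD1 in_arcsD2 by fastforce
    show "(v, u) \<in> parcs G" if "(u, v) \<in> parcs G" for u v
      using that pair_sym_arcs by (auto simp: symmetric_def symD)
    show "2 \<le> card (pverts G)" by (rule n)
    fix S assume S: "S \<subseteq> pverts G" "S \<noteq> {}" "S \<noteq> pverts G"
    then obtain u v where uv: "u \<in> S" "v \<in> pverts G" "v \<notin> S" by auto
    show "\<exists>(u, v)\<in>parcs G. u \<in> S \<and> v \<notin> S"
    proof (rule ccontr)
      assume no: "\<not> ?thesis"
      have "strongly_connected (with_proj G)"
        using symmetric_connected_imp_strongly_connected[OF pair_sym_arcs con] .
      then have "u \<rightarrow>\<^sup>*\<^bsub>with_proj G\<^esub> v" using uv S by (auto simp: strongly_connected_def)
      then have "v \<in> S"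
        by (induction rule: reachable_induct) (use no uv in auto)
      then show False using uv by simp
    qed
  qed
qed

context finite_connected
begin

abbreviation "V \<equiv> pverts G"
abbreviation "E \<equiv> parcs G"
abbreviation "n \<equiv> card (pverts G)"
abbreviation "N v \<equiv> {w. (v, w) \<in> parcs G}"

lemma finite_E: "finite E"
  by (rule finite_subset[of _ "V \<times> V"]) (use fin arcD in auto)

lemma finite_N: "finite (N v)"
  by (rule finite_subset[of _ V]) (use fin arcD in auto)

lemma N_nonempty:
  assumes "v \<in> V"
  shows "N v \<noteq> {}"
proof -
  have "{v} \<noteq> V"
  proof
    assume "{v} = V"
    then have "n = card {v}" by simp
    then show False using card2 by simp
  qed
  then show ?thesis using cut[of "{v}"] assms by auto
qed

lemma sum_E: "(\<Sum>(v, w)\<in>E. g v w) = (\<Sum>v\<in>V. \<Sum>w\<in>N v. g v w)" for g :: "'a \<Rightarrow> 'a \<Rightarrow> real"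
proof -
  have "E = Sigma V N" using arcD by auto
  then show ?thesis using fin finite_N sum.Sigma[of V N g] by simp
qed

lemma card_E: "real (card E) = n * avg_degree G"
proof -
  have "out_degree (with_proj G) v = card (N v)" for v
  proof -
    have "{e \<in> E. fst e = v} = Pair v ` N v" by auto
    then show ?thesis by (simp add: out_degree_def out_arcs_def card_image inj_on_def)
  qed
  moreover have "real (card E) = (\<Sum>v\<in>V. real (card (N v)))"
    using sum_E[of "\<lambda>_ _. 1"] by simp
  ultimately show ?thesis using card2 by (simp add: avg_degree_def)
qed

lemma avg_degree_ge_1: "1 \<le> avg_degree G"
proof -
  have "real n = (\<Sum>v\<in>V. 1)" by simp
  also have "\<dots> \<le> (\<Sum>v\<in>V. real (card (N v)))"
    using N_nonempty finite_N by (intro sum_mono) (simp add: Suc_le_eq card_gt_0_iff)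
  also have "\<dots> = n * avg_degree G" using sum_E[of "\<lambda>_ _. 1"] card_E by simp
  finally show ?thesis using card2 by simp
qed

lemma avg_degree_le: "avg_degree G \<le> n"
proof -
  have "card E \<le> card (V \<times> V)" using fin arcD by (intro card_mono) auto
  then have "real (card E) \<le> real n * real n" by (simp add: card_cartesian_product flip: of_nat_mult)
  then show ?thesis using card_E card2 by simp
qed

lemma sum_E_swap: "(\<Sum>(v, w)\<in>{e\<in>E. P (fst e) (snd e)}. g v w) = (\<Sum>(v, w)\<in>{e\<in>E. P (snd e) (fst e)}. g w v)"
  for g :: "'a \<Rightarrow> 'a \<Rightarrow> real"
  by (rule sum.reindex_bij_witness[of _ prod.swap prod.swap]) (auto dest: sym)

text \<open>Each edge at \<open>v\<close> occurs once as an arc from \<open>v\<close> and once as an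
  arc to \<open>v\<close>, which cancels the factor 1/2 of the energy.\<close>

lemma energy_fun_upd:
  "energy p G (f(v := y)) = energy p G f + ((\<Sum>w\<in>N v. \<bar>f w - y\<bar> powr p) - (\<Sum>w\<in>N v. \<bar>f w - f v\<bar> powr p))"
proof -
  have E_split: "E = Pair v ` N v \<union> ((\<lambda>w. (w, v)) ` N v \<union> {e\<in>E. fst e \<noteq> v \<and> snd e \<noteq> v})"
    using sym by force
  have *: "(\<Sum>(u, w)\<in>E. \<bar>g u - g w\<bar> powr p) = 2 * (\<Sum>w\<in>N v. \<bar>g w - g v\<bar> powr p)
      + (\<Sum>(u, w)\<in>{e\<in>E. fst e \<noteq> v \<and> snd e \<noteq> v}. \<bar>g u - g w\<bar> powr p)" for g :: "'a \<Rightarrow> real"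
    apply (subst E_split)
    apply (subst sum.union_disjoint)
    subgoal by (simp add: finite_N)
    subgoal by (simp add: finite_N finite_E)
    subgoal using arcD by auto
    apply (subst sum.union_disjoint)
    subgoal by (simp add: finite_N)
    subgoal by (simp add: finite_E)
    subgoal by auto
    by (simp add: sum.reindex inj_on_def abs_minus_commute)
  have "(\<Sum>(u, w)\<in>{e\<in>E. fst e \<noteq> v \<and> snd e \<noteq> v}. \<bar>(f(v := y)) u - (f(v := y)) w\<bar> powr p)
     = (\<Sum>(u, w)\<in>{e\<in>E. fst e \<noteq> v \<and> snd e \<noteq> v}. \<bar>f u - f w\<bar> powr p)"
    by (intro sum.cong refl) auto
  moreover have "(\<Sum>w\<in>N v. \<bar>(f(v := y)) w - (f(v := y)) v\<bar> powr p) = (\<Sum>w\<in>N v. \<bar>f w - y\<bar> powr p)"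
    using arcD by (intro sum.cong refl) auto
  ultimately show ?thesis unfolding energy_def * by (simp add: field_simps)
qed

text \<open>Any trial value bounds the energy after an update from above; the exact minimiser never
  has to be known.\<close>

lemma energy_update_le:
  assumes "1 < p" "v \<in> V"
  shows "energy p G (update p G v f) \<le> energy p G (f(v := y))"
  unfolding update_def energy_fun_upd
  using lp_mean_min[OF assms(1) finite_N N_nonempty[OF assms(2)], of f y] by simp

lemma energy_nonneg: "0 \<le> energy p G f"
  unfolding energy_def by (intro divide_nonneg_nonneg sum_nonneg) auto

text \<open>The trial value is f v + d on \<open>L\<close> and f v elsewhere. Each shift is tested
  with the other vertices frozen, so an edge inside \<open>L\<close> is counted from both ends; its
  two first-order terms are opposite. Only arcs leaving \<open>L\<close> keep a first-order
  term.\<close>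

lemma sum_energy_update_le:
  assumes p: "1 < p" and L: "L \<subseteq> V"
    and R: "\<And>x. \<bar>x + d\<bar> powr p \<le> \<bar>x\<bar> powr p + p * phi (p - 1) x * d + R x" and R0: "\<And>x. 0 \<le> R x"
  shows "(\<Sum>v\<in>V. energy p G (update p G v f)) \<le> n * energy p G f
     + p * d * (\<Sum>(v, w)\<in>{e\<in>E. fst e \<in> L \<and> snd e \<notin> L}. phi (p - 1) (f v - f w)) + (\<Sum>(v, w)\<in>E. R (f v - f w))"
proof -
  have one: "energy p G (update p G v f) \<le> energy p G f
      + (\<Sum>w\<in>N v. (if v \<in> L then p * d * phi (p - 1) (f v - f w) else 0) + R (f v - f w))" if v: "v \<in> V" for v
  proof (cases "v \<in> L")
    case True
    have "(\<Sum>w\<in>N v. \<bar>f w - (f v + d)\<bar> powr p) \<le> (\<Sum>w\<in>N v. \<bar>f w - f v\<bar> powr p + (p * d * phi (p - 1) (f v - f w) + R (f v - f w)))"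
    proof (intro sum_mono)
      fix w
      show "\<bar>f w - (f v + d)\<bar> powr p \<le> \<bar>f w - f v\<bar> powr p + (p * d * phi (p - 1) (f v - f w) + R (f v - f w))"
        using R[of "f v - f w"] abs_minus_commute[of "f w" "f v"] abs_minus_commute[of "f w" "f v + d"]
        by (simp add: algebra_simps)
    qed
    then show ?thesis
      using energy_update_le[OF p v, of f "f v + d"] True by (simp add: energy_fun_upd sum.distrib)
  next
    case False
    then show ?thesis
      using energy_update_le[OF p v, of f "f v"] R0 by (simp add: sum_nonneg add_increasing2)
  qed
  have "(\<Sum>v\<in>V. energy p G (update p G v f)) \<le> (\<Sum>v\<in>V. energy p G f
      + (\<Sum>w\<in>N v. (if v \<in> L then p * d * phi (p - 1) (f v - f w) else 0) + R (f v - f w)))"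
    by (intro sum_mono one)
  also have "\<dots> = n * energy p G f + (\<Sum>(v, w)\<in>E. if v \<in> L then p * d * phi (p - 1) (f v - f w) else 0) + (\<Sum>(v, w)\<in>E. R (f v - f w))"
    by (simp add: sum.distrib sum_E)
  also have "(\<Sum>(v, w)\<in>E. if v \<in> L then p * d * phi (p - 1) (f v - f w) else 0)
     = p * d * (\<Sum>(v, w)\<in>{e\<in>E. fst e \<in> L}. phi (p - 1) (f v - f w))"
    unfolding sum_distrib_left
    by (subst sum.inter_filter[OF finite_E]) (auto intro!: sum.cong)
  also have "(\<Sum>(v, w)\<in>{e\<in>E. fst e \<in> L}. phi (p - 1) (f v - f w))
     = (\<Sum>(v, w)\<in>{e\<in>E. fst e \<in> L \<and> snd e \<in> L}. phi (p - 1) (f v - f w))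
     + (\<Sum>(v, w)\<in>{e\<in>E. fst e \<in> L \<and> snd e \<notin> L}. phi (p - 1) (f v - f w))"
    by (subst sum.union_disjoint[symmetric]) (auto simp: finite_E intro!: sum.cong)
  \<comment> \<open>Reversing arcs permutes this set and changes the sign of every term.\<close>
  also have "(\<Sum>(v, w)\<in>{e\<in>E. fst e \<in> L \<and> snd e \<in> L}. phi (p - 1) (f v - f w)) = 0"
  proof -
    have "(\<Sum>(v, w)\<in>{e\<in>E. fst e \<in> L \<and> snd e \<in> L}. phi (p - 1) (f v - f w))
        = (\<Sum>(v, w)\<in>{e\<in>E. snd e \<in> L \<and> fst e \<in> L}. phi (p - 1) (f w - f v))"
      by (rule sum_E_swap[where P = "\<lambda>v w. v \<in> L \<and> w \<in> L" and g = "\<lambda>v w. phi (p - 1) (f v - f w)"])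
    also have "\<dots> = (\<Sum>(v, w)\<in>{e\<in>E. fst e \<in> L \<and> snd e \<in> L}. - phi (p - 1) (f v - f w))"
      using phi_minus[of "p - 1"] by (intro sum.cong) (auto, metis minus_diff_eq)
    also have "\<dots> = - (\<Sum>(v, w)\<in>{e\<in>E. fst e \<in> L \<and> snd e \<in> L}. phi (p - 1) (f v - f w))"
      by (simp add: sum_negf[symmetric] case_prod_beta)
    finally show ?thesis by simp
  qed
  finally show ?thesis by simp
qed

section \<open>Ranking the vertices by value\<close>

lemma ranking:
  obtains \<sigma> :: "nat \<Rightarrow> 'a" where "bij_betw \<sigma> {..<n} V" "\<And>i j. i \<le> j \<Longrightarrow> j < n \<Longrightarrow> (f (\<sigma> i) :: real) \<le> f (\<sigma> j)"
proof -
  obtain xs where xs: "set xs = V" "distinct xs" using finite_distinct_list[OF fin] by blast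
  let ?ys = "sort_key f xs"
  have len: "length ?ys = n" using xs distinct_card[of xs] by simp
  have "bij_betw ((!) ?ys) {..<n} V"
    using xs len by (intro bij_betw_nth) auto
  moreover have "f (?ys ! i) \<le> f (?ys ! j)" if "i \<le> j" "j < n" for i j
    using sorted_nth_mono[of "map f ?ys" i j] that len by simp
  ultimately show thesis using that by blast
qed

definition ranked :: "(nat \<Rightarrow> 'a) \<Rightarrow> (nat \<times> nat) set" where
  "ranked \<sigma> = {(i, j). i < j \<and> j < n \<and> (\<sigma> i, \<sigma> j) \<in> E}"

context
  fixes \<sigma> :: "nat \<Rightarrow> 'a"
  assumes bij: "bij_betw \<sigma> {..<n} V"
begin

lemma \<sigma>_inj: "i < n \<Longrightarrow> j < n \<Longrightarrow> \<sigma> i = \<sigma> j \<longleftrightarrow> i = j"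
  using bij by (auto simp: bij_betw_def inj_on_def)

lemma \<sigma>_surj: "v \<in> V \<Longrightarrow> \<exists>i<n. v = \<sigma> i"
  using bij by (auto simp: bij_betw_def)

lemma finite_ranked: "finite (ranked \<sigma>)"
  by (rule finite_subset[of _ "{..<n} \<times> {..<n}"]) (auto simp: ranked_def)

lemma E_ranked: "E = map_prod \<sigma> \<sigma> ` ranked \<sigma> \<union> (prod.swap \<circ> map_prod \<sigma> \<sigma>) ` ranked \<sigma>"
proof (intro set_eqI iffI)
  fix e assume e: "e \<in> E"
  then obtain i j where ij: "i < n" "j < n" "e = (\<sigma> i, \<sigma> j)"
    using \<sigma>_surj arcD by (metis prod.collapse)
  then have "i \<noteq> j" using e arcD by auto
  then have "(i, j) \<in> ranked \<sigma> \<or> (j, i) \<in> ranked \<sigma>"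
    using e ij sym by (auto simp: ranked_def)
  then show "e \<in> map_prod \<sigma> \<sigma> ` ranked \<sigma> \<union> (prod.swap \<circ> map_prod \<sigma> \<sigma>) ` ranked \<sigma>"
    using ij by force
qed (auto simp: ranked_def sym)

lemma inj_ranked: "inj_on (map_prod \<sigma> \<sigma>) (ranked \<sigma>)"
  by (auto simp: inj_on_def ranked_def \<sigma>_inj)

lemma sum_E_ranked:
  fixes g :: "'a \<Rightarrow> 'a \<Rightarrow> real"
  assumes "\<And>u v. g u v = g v u"
  shows "(\<Sum>(u, v)\<in>E. g u v) = 2 * (\<Sum>(i, j)\<in>ranked \<sigma>. g (\<sigma> i) (\<sigma> j))"
proof -
  have "(\<Sum>(u, v)\<in>E. g u v) = (\<Sum>(u, v)\<in>map_prod \<sigma> \<sigma> ` ranked \<sigma>. g u v)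
      + (\<Sum>(u, v)\<in>(prod.swap \<circ> map_prod \<sigma> \<sigma>) ` ranked \<sigma>. g u v)"
    by (subst E_ranked, rule sum.union_disjoint)
      (use finite_ranked in \<open>auto simp: ranked_def \<sigma>_inj\<close>)
  also have "(\<Sum>(u, v)\<in>map_prod \<sigma> \<sigma> ` ranked \<sigma>. g u v) = (\<Sum>(i, j)\<in>ranked \<sigma>. g (\<sigma> i) (\<sigma> j))"
    by (subst sum.reindex[OF inj_ranked]) (auto intro!: sum.cong)
  also have "(\<Sum>(u, v)\<in>(prod.swap \<circ> map_prod \<sigma> \<sigma>) ` ranked \<sigma>. g u v) = (\<Sum>(i, j)\<in>ranked \<sigma>. g (\<sigma> i) (\<sigma> j))"
    by (subst sum.reindex) (use inj_ranked in \<open>auto intro!: sum.cong comp_inj_on simp: assms\<close>)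
  finally show ?thesis by simp
qed

lemma card_ranked: "real (card (ranked \<sigma>)) \<le> n * avg_degree G"
  using sum_E_ranked[of "\<lambda>_ _. 1"] card_E by simp

text \<open>The edge over gap \<open>m\<close> comes from connectedness applied to the set of the m
  lowest vertices.\<close>

lemma ranked_edges_ranked:
  assumes mono: "\<And>i j. i \<le> j \<Longrightarrow> j < n \<Longrightarrow> f (\<sigma> i) \<le> f (\<sigma> j)" and "1 < p"
  shows "ranked_edges n (ranked \<sigma>) (\<lambda>i. f (\<sigma> i)) (p - 1)"
proof
  fix m assume m: "0 < m" "m < n"
  have "\<sigma> ` {..<m} \<noteq> V"
  proof
    assume "\<sigma> ` {..<m} = V"
    then have "n \<le> m" using card_image_le[of "{..<m}" \<sigma>] by simp
    then show False using m by simp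
  qed
  moreover have "\<sigma> ` {..<m} \<subseteq> V" using bij m by (auto simp: bij_betw_def)
  moreover have "\<sigma> ` {..<m} \<noteq> {}" using m by auto
  ultimately obtain u v where uv: "(u, v) \<in> E" "u \<in> \<sigma> ` {..<m}" "v \<notin> \<sigma> ` {..<m}"
    using cut[of "\<sigma> ` {..<m}"] by blast
  then obtain i j where "u = \<sigma> i" "i < m" "v = \<sigma> j" "j < n" using \<sigma>_surj arcD by blast
  then show "\<exists>(i, j)\<in>ranked \<sigma>. i < m \<and> m \<le> j"
    using uv by (intro bexI[of _ "(i, j)"]) (auto simp: ranked_def not_less[symmetric])
qed (use card2 assms in \<open>auto simp: ranked_def\<close>)

end

text \<open>\<open>M\<close> is fixed before \<open>d\<close> and \<open>R\<close>, so the size of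
  the shift can be tuned to \<open>M\<close> for either Taylor bound. Passing from ranked edges to
  arcs doubles the constant 2 of \<open>sum_powr_pred_le\<close> to 4.\<close>

lemma shift_low_vertices:
  assumes p: "1 < p"
  obtains M where "0 \<le> M" "energy p G f \<le> n * M powr p"
    "2 < p \<Longrightarrow> (\<Sum>(v, w)\<in>E. \<bar>f v - f w\<bar> powr (p - 2)) \<le> 4 * n * M powr (p - 2) * avg_degree G powr (max 0 (3 - p) / (p - 1))"
    "\<And>d R. (\<And>x. \<bar>x + d\<bar> powr p \<le> \<bar>x\<bar> powr p + p * phi (p - 1) x * d + R x) \<Longrightarrow> (\<And>x. 0 \<le> R x) \<Longrightarrow>
       (\<Sum>v\<in>V. energy p G (update p G v f)) \<le> n * energy p G f - p * d * M powr (p - 1) + (\<Sum>(v, w)\<in>E. R (f v - f w))"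
proof -
  obtain \<sigma> where bij: "bij_betw \<sigma> {..<n} V" and mono: "\<And>i j. i \<le> j \<Longrightarrow> j < n \<Longrightarrow> f (\<sigma> i) \<le> f (\<sigma> j)"
    using ranking by blast
  interpret R: ranked_edges n "ranked \<sigma>" "\<lambda>i. f (\<sigma> i)" "p - 1"
    using bij mono p by (rule ranked_edges_ranked)
  have abs_eq: "\<bar>f (\<sigma> i) - f (\<sigma> j)\<bar> = f (\<sigma> j) - f (\<sigma> i)" if "(i, j) \<in> ranked \<sigma>" for i j
    using R.A_D[OF that] by simp
  have sumE: "(\<Sum>(v, w)\<in>E. \<bar>f v - f w\<bar> powr q) = 2 * (\<Sum>(i, j)\<in>ranked \<sigma>. (f (\<sigma> j) - f (\<sigma> i)) powr q)" for q
    by (subst sum_E_ranked[OF bij]) (auto simp: abs_minus_commute abs_eq intro!: sum.cong)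
  obtain m where m: "0 < m" "m < n" "R.flow m = R.height powr (p - 1)" by (rule R.flow_max)
  \<comment> \<open>The vertices below the gap of maximal flow. All arcs leaving \<open>L\<close> go
    up, so moving \<open>L\<close> up by \<open>d\<close> > 0 gains to first order.\<close>
  define L where "L = \<sigma> ` {..<m}"
  have L: "L \<subseteq> V" using bij m by (auto simp: L_def bij_betw_def)
  have memL: "\<sigma> i \<in> L \<longleftrightarrow> i < m" if "i < n" for i
    using that m \<sigma>_inj[OF bij] by (auto simp: L_def)
  have flow: "(\<Sum>(v, w)\<in>{e\<in>E. fst e \<in> L \<and> snd e \<notin> L}. phi (p - 1) (f v - f w)) = - R.flow m"
  proof -
    have "{e\<in>E. fst e \<in> L \<and> snd e \<notin> L} = map_prod \<sigma> \<sigma> ` {e\<in>ranked \<sigma>. fst e < m \<and> m \<le> snd e}"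
      by (subst E_ranked[OF bij]) (auto simp: ranked_def memL not_less image_iff)
    then have "(\<Sum>(v, w)\<in>{e\<in>E. fst e \<in> L \<and> snd e \<notin> L}. phi (p - 1) (f v - f w))
       = (\<Sum>(i, j)\<in>{e\<in>ranked \<sigma>. fst e < m \<and> m \<le> snd e}. phi (p - 1) (f (\<sigma> i) - f (\<sigma> j)))"
      using inj_on_subset[OF inj_ranked[OF bij], of "{e\<in>ranked \<sigma>. fst e < m \<and> m \<le> snd e}"]
      by (auto simp: sum.reindex intro!: sum.cong)
    also have "\<dots> = (\<Sum>(i, j)\<in>{e\<in>ranked \<sigma>. fst e < m \<and> m \<le> snd e}. - ((f (\<sigma> j) - f (\<sigma> i)) powr (p - 1)))"
      using R.A_D by (intro sum.cong refl) (auto simp: phi_nonpos)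
    finally show ?thesis by (simp add: R.flow_def sum_negf case_prod_beta)
  qed
  show thesis
  proof (rule that)
    show "0 \<le> R.height" by (rule R.height_nonneg)
    show "energy p G f \<le> n * R.height powr p"
      using R.sum_powr_Suc_le by (simp add: energy_def sumE)
    show "(\<Sum>(v, w)\<in>E. \<bar>f v - f w\<bar> powr (p - 2)) \<le> 4 * n * R.height powr (p - 2) * avg_degree G powr (max 0 (3 - p) / (p - 1))"
      if "2 < p"
      using R.sum_powr_pred_le[OF _ avg_degree_ge_1 card_ranked[OF bij]] that by (simp add: sumE mult_ac)
    show "(\<Sum>v\<in>V. energy p G (update p G v f)) \<le> n * energy p G f - p * d * R.height powr (p - 1) + (\<Sum>(v, w)\<in>E. R (f v - f w))"
      if "\<And>x. \<bar>x + d\<bar> powr p \<le> \<bar>x\<bar> powr p + p * phi (p - 1) x * d + R x" "\<And>x. 0 \<le> R x" for d R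
      using sum_energy_update_le[OF p L that, of f] by (simp add: flow m)
  qed
qed

end

text \<open>With d = c M q the remainder 2 p d^p on n D arcs consumes exactly p - 1 of the p units d
  M^(p-1) gained to first order. The unit left is c q M^p, at least c q / n times the
  energy.\<close>

lemma energy_step_le2:
  assumes p: "1 < p" "p \<le> 2"
  obtains c where "0 < c" "\<And>(G :: 'a pair_pre_digraph) f. finite_connected G \<Longrightarrow>
    (\<Sum>v\<in>pverts G. energy p G (update p G v f)) \<le> card (pverts G) * energy p G f * (1 - c * F (card (pverts G)) p (avg_degree G))"
proof -
  \<comment> \<open>Solves 2 p c^(p-1) = p - 1, the balance between remainder and gain.\<close>
  define c where "c = ((p - 1) / (2 * p)) powr (1 / (p - 1))"
  have c0: "0 < c" using p by (simp add: c_def)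
  have cp: "c powr (p - 1) = (p - 1) / (2 * p)" using p by (simp add: c_def powr_powr)
  show thesis
  proof (rule that[OF c0])
    fix G :: "'a pair_pre_digraph" and f assume "finite_connected G"
    then interpret finite_connected G .
    let ?D = "avg_degree G"
    have D: "1 \<le> ?D" "0 < n" using avg_degree_ge_1 card2 by auto
    obtain M where M: "0 \<le> M" "energy p G f \<le> n * M powr p"
      and shift: "\<And>d R. (\<And>x. \<bar>x + d\<bar> powr p \<le> \<bar>x\<bar> powr p + p * phi (p - 1) x * d + R x) \<Longrightarrow> (\<And>x. 0 \<le> R x) \<Longrightarrow>
       (\<Sum>v\<in>V. energy p G (update p G v f)) \<le> n * energy p G f - p * d * M powr (p - 1) + (\<Sum>(v, w)\<in>E. R (f v - f w))"
      by (rule shift_low_vertices[OF p(1), of f]) blast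
    define q where "q = (n * ?D) powr (- 1 / (p - 1))"
    define d where "d = c * M * q"
    have q0: "0 < q" using D by (simp add: q_def)
    have d0: "0 \<le> d" using c0 M q0 by (simp add: d_def)
    have dp: "n * ?D * d powr p = d * ((p - 1) / (2 * p)) * M powr (p - 1)"
    proof (cases "M = 0")
      case False
      then have M0: "0 < M" using M by simp
      have "d powr p = d * d powr (p - 1)" using M0 c0 q0 by (simp add: d_def powr_diff)
      also have "d powr (p - 1) = c powr (p - 1) * M powr (p - 1) * q powr (p - 1)"
        using M0 c0 q0 by (simp add: d_def powr_mult)
      also have "q powr (p - 1) = 1 / (n * ?D)"
      proof -
        have "- 1 / (p - 1) * (p - 1) = - 1" using p by simp
        then have "q powr (p - 1) = (n * ?D) powr (- 1)" by (simp only: q_def powr_powr)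
        then show ?thesis using D by (simp add: powr_minus_divide)
      qed
      finally show ?thesis using D by (simp add: cp)
    qed (simp add: d_def)
    have "(\<Sum>v\<in>V. energy p G (update p G v f)) \<le> n * energy p G f - p * d * M powr (p - 1) + (\<Sum>(v, w)\<in>E. 2 * p * \<bar>d\<bar> powr p)"
      using p abs_powr_Taylor_le2 by (intro shift) auto
    also have "(\<Sum>(v, w)\<in>E. 2 * p * \<bar>d\<bar> powr p) = 2 * p * (n * ?D * d powr p)"
      using d0 card_E by simp
    also have "\<dots> = (p - 1) * d * M powr (p - 1)" unfolding dp using p by simp
    also have "n * energy p G f - p * d * M powr (p - 1) + (p - 1) * d * M powr (p - 1) = n * energy p G f - c * q * M powr p"
    proof -
      have "d * M powr (p - 1) = c * q * M powr p"
        using M by (cases "M = 0") (auto simp: d_def powr_diff)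
      then show ?thesis by (simp add: algebra_simps)
    qed
    also have "\<dots> \<le> n * energy p G f - c * q * (energy p G f / n)"
      using M c0 q0 D by (intro diff_left_mono mult_left_mono) (auto simp: field_simps)
    also have "\<dots> = n * energy p G f * (1 - c * (q * n powr (-2)))"
      using D by (simp add: powr_minus powr_numeral field_simps power2_eq_square)
    also have "q * n powr (-2) = F n p ?D"
    proof -
      have "q * n powr (-2) = n powr (- 1 / (p - 1) - 2) * ?D powr (- 1 / (p - 1))"
        using D by (simp add: q_def powr_mult powr_diff powr_minus_divide)
      also have "- 1 / (p - 1) - 2 = (1 - 2 * p) / (p - 1)" using p by (simp add: field_simps)
      finally show ?thesis using D p by (subst F_cases) auto
    qed
    finally show "(\<Sum>v\<in>V. energy p G (update p G v f)) \<le> n * energy p G f * (1 - c * F n p ?D)" .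
  qed
qed

text \<open>Here the quadratic remainder dictates the shift: its sum is of order n D^k M^(p-2) d^2,
  which is comparable to d M^(p-1) when d is about M / (n D^k).\<close>

lemma energy_step_gt2:
  assumes p: "2 < p"
  obtains c where "0 < c" "\<And>(G :: 'a pair_pre_digraph) f. finite_connected G \<Longrightarrow>
    (\<Sum>v\<in>pverts G. energy p G (update p G v f)) \<le> card (pverts G) * energy p G f * (1 - c * F (card (pverts G)) p (avg_degree G))"
proof -
  define C where "C = p * p * 2 powr (p - 2)"
  \<comment> \<open>The quadratic remainder contributes 4 C c and the pure power C c units of d
    M^(p-1); this choice keeps their sum below one unit.\<close>
  define c where "c = min 1 (1 / (5 * C))"
  have C0: "0 < C" using p by (simp add: C_def)
  have c0: "0 < c" "c \<le> 1" "5 * C * c \<le> 1" using C0 by (auto simp: c_def min_def field_simps)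
  show thesis
  proof (rule that[OF c0(1)])
    fix G :: "'a pair_pre_digraph" and f assume "finite_connected G"
    then interpret finite_connected G .
    let ?D = "avg_degree G"
    have D: "1 \<le> ?D" "0 < n" "?D \<le> n" using avg_degree_ge_1 avg_degree_le card2 by auto
    have p1: "1 < p" using p by simp
    define s where "s = max 0 (3 - p)"
    define k where "k = s / (p - 1)"
    obtain M where M: "0 \<le> M" "energy p G f \<le> n * M powr p"
      and S: "2 < p \<Longrightarrow> (\<Sum>(v, w)\<in>E. \<bar>f v - f w\<bar> powr (p - 2)) \<le> 4 * n * M powr (p - 2) * ?D powr k"
      and shift: "\<And>d R. (\<And>x. \<bar>x + d\<bar> powr p \<le> \<bar>x\<bar> powr p + p * phi (p - 1) x * d + R x) \<Longrightarrow> (\<And>x. 0 \<le> R x) \<Longrightarrow>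
       (\<Sum>v\<in>V. energy p G (update p G v f)) \<le> n * energy p G f - p * d * M powr (p - 1) + (\<Sum>(v, w)\<in>E. R (f v - f w))"
      unfolding k_def s_def by (rule shift_low_vertices[OF p1, of f]) blast
    define q where "q = 1 / (n * ?D powr k)"
    define d where "d = c * M * q"
    have q0: "0 < q" using D by (simp add: q_def)
    have d0: "0 \<le> d" using c0 M q0 by (simp add: d_def)
    have dM: "d * M powr (p - 1) = c * q * M powr p"
      using M by (cases "M = 0") (auto simp: d_def powr_diff)
    have T1: "4 * n * M powr (p - 2) * ?D powr k * d\<^sup>2 = 4 * c * (d * M powr (p - 1))"
    proof (cases "M = 0")
      case False
      then have "M powr (p - 1) = M * M powr (p - 2)" using M by (simp add: powr_diff power2_eq_square powr_numeral)
      then show ?thesis using D by (simp add: d_def q_def power2_eq_square field_simps)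
    qed (simp add: d_def)
    \<comment> \<open>The pure power remainder is no worse than the quadratic one: by D \<le> n and
      s \<le> 1 the left side is at most n^(3-p-s), and s \<ge> 3 - p.\<close>
    have small: "n * ?D * q powr (p - 1) \<le> 1"
    proof -
      have "k * (p - 1) = s" using p by (simp add: k_def)
      then have "q powr (p - 1) = 1 / (n powr (p - 1) * ?D powr s)"
        using D by (simp add: q_def powr_divide powr_mult powr_powr)
      then have "n * ?D * q powr (p - 1) = n powr (2 - p) * ?D powr (1 - s)"
      proof -
        have "real n powr (2 - p) = n / n powr (p - 1)"
          using D powr_diff[of "real n" 1 "p - 1"] by simp
        moreover have "?D powr (1 - s) = ?D / ?D powr s" using D by (simp add: powr_diff)
        ultimately show ?thesis using \<open>q powr (p - 1) = _\<close> by simp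
      qed
      also have "\<dots> \<le> n powr (2 - p) * n powr (1 - s)"
        using D p by (intro mult_left_mono powr_mono2) (auto simp: s_def)
      also have "\<dots> = n powr (3 - p - s)" using D by (simp add: powr_add[symmetric] algebra_simps)
      also have "\<dots> \<le> n powr 0" using D by (intro powr_mono) (auto simp: s_def)
      finally show ?thesis using D by simp
    qed
    have T2: "n * ?D * d powr p \<le> c * (d * M powr (p - 1))"
    proof (cases "M = 0")
      case False
      then have M0: "0 < M" using M by simp
      have "d powr p = d * d powr (p - 1)" using M0 c0 q0 by (simp add: d_def powr_diff)
      also have "d powr (p - 1) = c powr (p - 1) * M powr (p - 1) * q powr (p - 1)"
        using M0 c0 q0 by (simp add: d_def powr_mult)
      finally have "n * ?D * d powr p = (n * ?D * q powr (p - 1)) * (c powr (p - 1) * (d * M powr (p - 1)))"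
        by (simp add: mult_ac)
      also have "\<dots> \<le> 1 * (c powr (p - 1) * (d * M powr (p - 1)))"
        using small d0 by (intro mult_right_mono) auto
      also have "\<dots> \<le> 1 * (c powr 1 * (d * M powr (p - 1)))"
        using c0 p d0 by (intro mult_left_mono mult_right_mono powr_mono') auto
      finally show ?thesis using c0 by simp
    qed (simp add: d_def)
    have "(\<Sum>(v, w)\<in>E. C * (\<bar>f v - f w\<bar> powr (p - 2) * d\<^sup>2 + \<bar>d\<bar> powr p))
        = C * ((\<Sum>(v, w)\<in>E. \<bar>f v - f w\<bar> powr (p - 2)) * d\<^sup>2 + n * ?D * d powr p)"
      using d0 card_E by (simp add: sum_distrib_left sum_distrib_right sum.distrib case_prod_beta distrib_left)
    also have "\<dots> \<le> C * (4 * n * M powr (p - 2) * ?D powr k * d\<^sup>2 + c * (d * M powr (p - 1)))"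
      using S[OF p] T2 C0 by (intro mult_left_mono add_mono mult_right_mono) auto
    also have "\<dots> = 5 * C * c * (d * M powr (p - 1))" unfolding T1 by (simp add: algebra_simps)
    also have "\<dots> \<le> 1 * (d * M powr (p - 1))" using c0 d0 by (intro mult_right_mono) auto
    finally have err: "(\<Sum>(v, w)\<in>E. C * (\<bar>f v - f w\<bar> powr (p - 2) * d\<^sup>2 + \<bar>d\<bar> powr p)) \<le> 1 * (d * M powr (p - 1))" .
    have "(\<Sum>v\<in>V. energy p G (update p G v f)) \<le> n * energy p G f - p * d * M powr (p - 1)
        + (\<Sum>(v, w)\<in>E. C * (\<bar>f v - f w\<bar> powr (p - 2) * d\<^sup>2 + \<bar>d\<bar> powr p))"
      using p C0 abs_powr_Taylor_gt2[OF p] by (intro shift) (auto simp: C_def)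
    also have "\<dots> \<le> n * energy p G f - p * d * M powr (p - 1) + 1 * (d * M powr (p - 1))"
      by (rule add_left_mono[OF err])
    also have "\<dots> = n * energy p G f - (p - 1) * (d * M powr (p - 1))" by (simp add: algebra_simps)
    also have "\<dots> \<le> n * energy p G f - 1 * (d * M powr (p - 1))"
      using p d0 by (intro diff_left_mono mult_right_mono) auto
    also have "\<dots> = n * energy p G f - c * q * M powr p" by (simp add: dM)
    also have "\<dots> \<le> n * energy p G f - c * q * (energy p G f / n)"
      using M c0 q0 D by (intro diff_left_mono mult_left_mono) (auto simp: field_simps)
    also have "\<dots> = n * energy p G f * (1 - c * (q * n powr (-2)))"
      using D by (simp add: powr_minus powr_numeral field_simps power2_eq_square)
    also have "q * n powr (-2) = F n p ?D"
    proof -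
      have "q = real n powr (- 1) * ?D powr (- k)" using D by (simp add: q_def powr_minus_divide)
      then have "q * n powr (-2) = n powr (- 3) * ?D powr (- k)"
        using powr_add[of "real n" "- 1" "- 2"] by simp
      also have "\<dots> = F n p ?D"
      proof (cases "p < 3")
        case True
        then have "- k = (p - 3) / (p - 1)" by (simp add: k_def s_def minus_divide_left)
        then show ?thesis using D p True by (subst F_cases) auto
      next
        case False
        then have "k = 0" by (simp add: k_def s_def)
        then show ?thesis using D p False by (subst F_cases) auto
      qed
      finally show ?thesis .
    qed
    finally show "(\<Sum>v\<in>V. energy p G (update p G v f)) \<le> n * energy p G f * (1 - c * F n p ?D)" .
  qed
qed

subsection \<open>Expected energy and consensus time\<close>

lemma F_pos: "0 < n \<Longrightarrow> 0 < D \<Longrightarrow> 0 < F n p D"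
  by (simp add: F_def)

lemma F_le_1:
  assumes "1 < p" "0 < n" "1 \<le> D"
  shows "F n p D \<le> 1"
proof -
  have *: "real n powr a \<le> 1" if "a \<le> 0" for a
    using powr_mono[OF that, of "real n"] assms by simp
  have **: "D powr a \<le> 1" if "a \<le> 0" for a
    using powr_mono[OF that, of D] assms by simp
  have "(1 - 2 * p) / (p - 1) \<le> 0" "- 1 / (p - 1) \<le> 0" "p < 3 \<Longrightarrow> (p - 3) / (p - 1) \<le> 0"
    using assms by (auto simp: divide_nonpos_pos)
  then show ?thesis
    using assms by (subst F_cases) (auto intro!: mult_le_one * **)
qed

text \<open>Exposes the first step: after it, the rest of the sequence drives the dynamics started
  at the updated profile.\<close>

lemma profile_shift: "profile p G f (case_nat v \<omega>) (Suc t) = profile p G (update p G v f) \<omega> t"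
  by (induction t) auto

context finite_connected
begin

abbreviation "unif \<equiv> uniform_count_measure (pverts G)"

lemma V_nonempty: "V \<noteq> {}"
  using card2 by auto

lemma prob_unif: "prob_space unif"
  using fin V_nonempty by (rule prob_space_uniform_count_measure)

sublocale seq: sequence_space unif
  by (simp add: sequence_space_def product_prob_space_def product_prob_space_axioms_def
      product_sigma_finite_def prob_unif prob_space_imp_sigma_finite)

text \<open>Profiles carry the discrete sigma-algebra, so that any function of a profile is
  measurable. This is possible because every step draws from a finite set.\<close>

lemma profile_measurable: "(\<lambda>\<omega>. profile p G f \<omega> t) \<in> measurable (vertex_seq G) (count_space UNIV)"
proof (induction t)
  case 0
  then show ?case by simp
next
  case (Suc t)
  have 1: "(\<lambda>\<omega>. update p G v (profile p G f \<omega> t)) \<in> measurable (vertex_seq G) (count_space UNIV)" for v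
    by (rule measurable_compose[OF Suc]) simp
  have 2: "(\<lambda>\<omega>. \<omega> t) \<in> measurable (vertex_seq G) (count_space V)"
  proof -
    have "(\<lambda>\<omega>. \<omega> t) \<in> measurable (vertex_seq G) unif"
      unfolding vertex_seq_def by (rule measurable_component_singleton) simp
    then show ?thesis
      by (simp add: measurable_cong_sets[OF refl sets_uniform_count_measure_count_space])
  qed
  have "(\<lambda>\<omega>. update p G (\<omega> t) (profile p G f \<omega> t)) \<in> measurable (vertex_seq G) (count_space UNIV)"
    by (rule measurable_compose_countable'[OF 1 2]) (use fin in \<open>auto intro: countable_finite\<close>)
  then show ?case by simp
qed

lemma energy_profile_measurable [measurable]:
  "(\<lambda>\<omega>. ennreal (energy p G (profile p G f \<omega> t))) \<in> borel_measurable (vertex_seq G)"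
  by (rule measurable_compose[OF profile_measurable]) simp

text \<open>Induction with arbitrary start, conditioning on the first step:
  \<open>seq.PiM_iter\<close> splits the law into the first vertex and an independent copy of the
  sequence, and the induction hypothesis applies to each updated profile.\<close>

lemma expected_energy_decay:
  assumes q: "0 \<le> q"
    and step: "\<And>f. (\<Sum>v\<in>V. energy p G (update p G v f)) \<le> n * energy p G f * q"
  shows "(\<integral>\<^sup>+\<omega>. ennreal (energy p G (profile p G f \<omega> t)) \<partial>vertex_seq G) \<le> ennreal (energy p G f * q ^ t)"
proof (induction t arbitrary: f)
  case 0
  have "emeasure (vertex_seq G) (space (vertex_seq G)) = 1"
    unfolding vertex_seq_def by (rule seq.P.emeasure_space_1)
  then show ?case by simp
next
  case (Suc t)
  have S: "vertex_seq G = seq.S" by (simp add: vertex_seq_def)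
  have meas: "(\<lambda>\<omega>. ennreal (energy p G (profile p G f \<omega> (Suc t)))) \<in> borel_measurable seq.S"
    using energy_profile_measurable[of p f "Suc t"] by (simp only: S)
  have cn: "(\<lambda>(s, \<omega>). case_nat s \<omega>) \<in> measurable (unif \<Otimes>\<^sub>M seq.S) seq.S"
    by (simp add: case_prod_beta)
  have meas2: "(\<lambda>x. ennreal (energy p G (profile p G f (case x of (s, \<omega>) \<Rightarrow> case_nat s \<omega>) (Suc t)))) \<in> borel_measurable (unif \<Otimes>\<^sub>M seq.S)"
    by (rule measurable_compose[OF cn meas])
  have "(\<integral>\<^sup>+\<omega>. ennreal (energy p G (profile p G f \<omega> (Suc t))) \<partial>vertex_seq G)
      = (\<integral>\<^sup>+\<omega>. ennreal (energy p G (profile p G f \<omega> (Suc t))) \<partial>distr (unif \<Otimes>\<^sub>M seq.S) seq.S (\<lambda>(s, \<omega>). case_nat s \<omega>))"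
    by (simp only: S seq.PiM_iter)
  also have "\<dots> = (\<integral>\<^sup>+x. ennreal (energy p G (profile p G f (case x of (s, \<omega>) \<Rightarrow> case_nat s \<omega>) (Suc t))) \<partial>(unif \<Otimes>\<^sub>M seq.S))"
    by (rule nn_integral_distr[OF cn]) (simp only: measurable_distr_eq1 meas)
  also have "\<dots> = (\<integral>\<^sup>+v. \<integral>\<^sup>+\<omega>. ennreal (energy p G (profile p G f (case_nat v \<omega>) (Suc t))) \<partial>seq.S \<partial>unif)"
    by (subst seq.P.nn_integral_fst[symmetric, OF meas2]) simp
  also have "\<dots> = (\<integral>\<^sup>+v. \<integral>\<^sup>+\<omega>. ennreal (energy p G (profile p G (update p G v f) \<omega> t)) \<partial>vertex_seq G \<partial>unif)"
    by (simp only: profile_shift S)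
  also have "\<dots> \<le> (\<integral>\<^sup>+v. ennreal (energy p G (update p G v f) * q ^ t) \<partial>unif)"
    by (intro nn_integral_mono Suc.IH)
  also have "\<dots> = (\<Sum>v\<in>V. ennreal (1 / n) * ennreal (energy p G (update p G v f) * q ^ t))"
    unfolding uniform_count_measure_def by (rule nn_integral_point_measure_finite[OF fin])
  also have "\<dots> = ennreal (\<Sum>v\<in>V. 1 / n * (energy p G (update p G v f) * q ^ t))"
  proof (subst sum_ennreal[symmetric])
    show "(\<Sum>v\<in>V. ennreal (1 / n) * ennreal (energy p G (update p G v f) * q ^ t))
        = (\<Sum>v\<in>V. ennreal (1 / n * (energy p G (update p G v f) * q ^ t)))"
      using energy_nonneg q by (intro sum.cong refl ennreal_mult[symmetric]) auto
  qed (use energy_nonneg q in auto)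
  also have "(\<Sum>v\<in>V. 1 / n * (energy p G (update p G v f) * q ^ t)) = (\<Sum>v\<in>V. energy p G (update p G v f)) * (q ^ t / n)"
    by (simp add: sum_distrib_right sum_divide_distrib)
  also have "ennreal \<dots> \<le> ennreal (n * energy p G f * q * (q ^ t / n))"
    using q by (intro ennreal_leI mult_right_mono step) auto
  also have "n * energy p G f * q * (q ^ t / n) = energy p G f * q ^ Suc t"
    using card2 by simp
  finally show ?case .
qed

text \<open>A pointwise Markov inequality. Every gap lies under some edge, whose difference is at
  most the p-th root of the energy, and fewer than n gaps make up the oscillation.\<close>

lemma osc_energy:
  assumes p: "1 < p" and e: "0 < \<epsilon>" "\<epsilon> < osc G f"
  shows "1 \<le> (n / \<epsilon>) powr p * energy p G f"
proof -
  obtain \<sigma> where bij: "bij_betw \<sigma> {..<n} V" and mono: "\<And>i j. i \<le> j \<Longrightarrow> j < n \<Longrightarrow> f (\<sigma> i) \<le> f (\<sigma> j)"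
    using ranking by blast
  interpret R: ranked_edges n "ranked \<sigma>" "\<lambda>i. f (\<sigma> i)" "p - 1"
    using bij mono p by (rule ranked_edges_ranked)
  define g where "g = energy p G f powr (1 / p)"
  have arc: "f (\<sigma> j) - f (\<sigma> i) \<le> g" if "(i, j) \<in> ranked \<sigma>" for i j
  proof -
    have "(f (\<sigma> j) - f (\<sigma> i)) powr p = (\<Sum>(i, j)\<in>{(i, j)}. \<bar>f (\<sigma> i) - f (\<sigma> j)\<bar> powr p)"
      using R.A_D[OF that] by simp
    also have "\<dots> \<le> (\<Sum>(i, j)\<in>ranked \<sigma>. \<bar>f (\<sigma> i) - f (\<sigma> j)\<bar> powr p)"
      using that by (intro sum_mono2) (auto simp: finite_ranked[OF bij])
    also have "\<dots> = energy p G f"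
      unfolding energy_def by (subst sum_E_ranked[OF bij]) (auto simp: abs_minus_commute)
    finally have "((f (\<sigma> j) - f (\<sigma> i)) powr p) powr (1 / p) \<le> g"
      unfolding g_def using p by (intro powr_mono2) auto
    then show ?thesis using p R.A_D[OF that] by (simp add: powr_powr)
  qed
  have g0: "0 \<le> g" by (simp add: g_def)
  have gap: "f (\<sigma> (Suc m)) - f (\<sigma> m) \<le> g" if m: "Suc m < n" for m
  proof -
    obtain i j where ij: "(i, j) \<in> ranked \<sigma>" "i < Suc m" "Suc m \<le> j" using R.cut[of "Suc m"] m by auto
    then have "f (\<sigma> i) \<le> f (\<sigma> m)" "f (\<sigma> (Suc m)) \<le> f (\<sigma> j)" using m R.A_D[OF ij(1)] by (auto intro!: mono)
    then show ?thesis using arc[OF ij(1)] by linarith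
  qed
  have "f (\<sigma> m) - f (\<sigma> 0) \<le> m * g" if "m < n" for m
    using that
  proof (induction m)
    case (Suc m)
    then show ?case using gap[of m] by (simp add: algebra_simps)
  qed simp
  from this[of "n - 1"] have ends: "f (\<sigma> (n - 1)) - f (\<sigma> 0) \<le> n * g"
    using card2 g0 mult_right_mono[of "real (n - 1)" "real n" g] by auto
  have ne: "finite (f ` V)" "f ` V \<noteq> {}" using fin V_nonempty by auto
  obtain v w where vw: "v \<in> V" "w \<in> V" "osc G f = f v - f w"
    using Max_in[OF ne] Min_in[OF ne] unfolding osc_def by (metis imageE)
  obtain i j where ij: "i < n" "j < n" "v = \<sigma> i" "w = \<sigma> j"
    using \<sigma>_surj[OF bij vw(1)] \<sigma>_surj[OF bij vw(2)] by blast
  have "f v \<le> f (\<sigma> (n - 1))" "f (\<sigma> 0) \<le> f w" using ij by (auto intro!: mono)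
  then have "\<epsilon> \<le> n * g" using ends vw e by linarith
  then have "1 \<le> n / \<epsilon> * g" using e by (simp add: field_simps)
  then have "1 powr p \<le> (n / \<epsilon> * g) powr p" using p by (intro powr_mono2) auto
  also have "\<dots> = (n / \<epsilon>) powr p * g powr p" by (rule powr_mult)
  also have "g powr p = energy p G f" using p energy_nonneg by (simp add: g_def powr_powr)
  finally show ?thesis by simp
qed

lemma energy_le_square:
  assumes "1 < p" "f \<in> V \<rightarrow> {0..1}"
  shows "energy p G f \<le> (real n)\<^sup>2"
proof -
  have "(\<Sum>(u, v)\<in>E. \<bar>f u - f v\<bar> powr p) \<le> (\<Sum>(u, v)\<in>E. 1)"
  proof (intro sum_mono, clarify)
    fix u v assume "(u, v) \<in> E"
    then have "f u \<in> {0..1}" "f v \<in> {0..1}" using assms arcD by blast+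
    then have "\<bar>f u - f v\<bar> \<le> 1" by (auto simp: abs_le_iff)
    then show "\<bar>f u - f v\<bar> powr p \<le> 1" using powr_mono2[of p "\<bar>f u - f v\<bar>" 1] assms by auto
  qed
  also have "\<dots> = n * avg_degree G" using card_E by (simp add: case_prod_beta)
  also have "\<dots> \<le> real n * real n" using avg_degree_le by (intro mult_left_mono) auto
  finally have "(\<Sum>(u, v)\<in>E. \<bar>f u - f v\<bar> powr p) \<le> (real n)\<^sup>2" by (simp add: power2_eq_square)
  moreover have "0 \<le> (real n)\<^sup>2" by simp
  ultimately show ?thesis unfolding energy_def by linarith
qed

text \<open>By \<open>osc_energy\<close> each term is at least 1 while the oscillation exceeds
  \<epsilon>, so the series counts the waiting time after \<open>T\<close>. If consensus is never
  reached from \<open>T\<close> on, it diverges.\<close>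

lemma consensus_time_le:
  assumes "1 < p" "0 < \<epsilon>"
  shows "consensus_time p G f \<epsilon> \<omega>
    \<le> of_nat T + (\<Sum>k. ennreal ((n / \<epsilon>) powr p) * ennreal (energy p G (profile p G f \<omega> (T + k))))"
proof -
  define a where "a k = ennreal ((n / \<epsilon>) powr p) * ennreal (energy p G (profile p G f \<omega> (T + k)))" for k
  have a1: "1 \<le> a k" if "\<not> osc G (profile p G f \<omega> (T + k)) \<le> \<epsilon>" for k
    using osc_energy[OF assms, of "profile p G f \<omega> (T + k)"] that energy_nonneg
    by (simp add: a_def ennreal_mult[symmetric])
  show ?thesis
  proof (cases "\<exists>k. osc G (profile p G f \<omega> (T + k)) \<le> \<epsilon>")
    case True
    define k where "k = (LEAST k. osc G (profile p G f \<omega> (T + k)) \<le> \<epsilon>)"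
    have k: "osc G (profile p G f \<omega> (T + k)) \<le> \<epsilon>" unfolding k_def using True by (rule LeastI_ex)
    have less: "\<not> osc G (profile p G f \<omega> (T + j)) \<le> \<epsilon>" if "j < k" for j
      using not_less_Least that unfolding k_def by blast
    have "consensus_time p G f \<epsilon> \<omega> \<le> of_nat (T + k)"
      unfolding consensus_time_def using k by (intro INF_lower) auto
    also have "\<dots> = of_nat T + (\<Sum>j<k. 1)" by simp
    also have "\<dots> \<le> of_nat T + (\<Sum>j<k. a j)" using less a1 by (intro add_left_mono sum_mono) auto
    also have "\<dots> \<le> of_nat T + (\<Sum>j. a j)" by (intro add_left_mono sum_le_suminf) auto
    finally show ?thesis by (simp add: a_def)
  next
    case False
    have "of_nat N \<le> (\<Sum>j. a j)" for N
    proof -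
      have "of_nat N = (\<Sum>j<N. 1 :: ennreal)" by simp
      also have "\<dots> \<le> (\<Sum>j<N. a j)" using False a1 by (intro sum_mono) auto
      also have "\<dots> \<le> (\<Sum>j. a j)" by (intro sum_le_suminf) auto
      finally show ?thesis .
    qed
    then have "(\<Sum>j. a j) = \<top>"
      by (metis ennreal_Ex_less_of_nat leD less_top)
    then show ?thesis by (simp add: a_def)
  qed
qed

lemma expected_consensus_time:
  assumes p: "1 < p" and e: "0 < \<epsilon>" "\<epsilon> \<le> 1 / 2" and f: "f \<in> V \<rightarrow> {0..1}" and c: "0 < c" "c \<le> 1"
    and F: "0 < F'" "F' \<le> 1"
    and decay: "\<And>t. (\<integral>\<^sup>+\<omega>. ennreal (energy p G (profile p G f \<omega> t)) \<partial>vertex_seq G) \<le> ennreal (energy p G f * exp (- c * F') ^ t)"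
  shows "integral\<^sup>N (vertex_seq G) (consensus_time p G f \<epsilon>) \<le> ennreal (((p + 3) / c + 2) * ln (n / \<epsilon>) / F')"
proof -
  define q where "q = exp (- c * F')"
  define K where "K = (n / \<epsilon>) powr p"
  \<comment> \<open>The time at which the bound n^2 exp(- c F' t) on the expected energy, multiplied
    by \<open>K\<close>, reaches 1; from then on the series is dominated by a geometric one.\<close>
  define X where "X = ln (K * (real n)\<^sup>2) / (c * F')"
  define T where "T = nat \<lceil>X\<rceil>"
  have n2: "2 \<le> real n" using card2 by simp
  have cF: "0 < c * F'" using c F by simp
  have q: "0 < q" "q < 1" using cF by (auto simp: q_def)
  \<comment> \<open>Since 4 exceeds e, the logarithm of n / \<epsilon> is at least 1 and absorbs
    additive constants.\<close>
  have ne: "4 \<le> n / \<epsilon>" 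
  proof -
    have "4 * \<epsilon> \<le> n" using e n2 by linarith
    then show ?thesis using e by (simp add: le_divide_eq)
  qed
  have ne0: "0 < n / \<epsilon>" using ne by simp
  have K0: "0 < K" using ne0 unfolding K_def powr_gt_zero by linarith
  have lnn: "0 \<le> ln (real n)" "ln (real n) \<le> ln (n / \<epsilon>)"
  proof -
    have "real n \<le> n / \<epsilon>" using e n2 by (simp add: field_simps)
    then show "ln (real n) \<le> ln (n / \<epsilon>)" using n2 by simp
  qed (use n2 in auto)
  have lnne: "1 \<le> ln (n / \<epsilon>)"
  proof -
    have "exp 1 \<le> n / \<epsilon>" using exp_le ne by linarith
    then show ?thesis using ne by (simp add: ln_ge_iff)
  qed
  have lnK: "ln (K * (real n)\<^sup>2) = p * ln (n / \<epsilon>) + 2 * ln (real n)"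
    using K0 n2 ne0 by (simp add: ln_mult_pos K_def ln_powr ln_realpow)
  then have X0: "0 \<le> X" using lnn lnne p cF by (auto simp: X_def intro!: divide_nonneg_pos)
  have X_le: "X \<le> (p + 2) / c * (ln (n / \<epsilon>) / F')"
  proof -
    have "ln (K * (real n)\<^sup>2) \<le> (p + 2) * ln (n / \<epsilon>)" unfolding lnK using lnn by (simp add: algebra_simps)
    then have "X \<le> (p + 2) * ln (n / \<epsilon>) / (c * F')" unfolding X_def using cF by (intro divide_right_mono) auto
    then show ?thesis by simp
  qed
  have TX: "X \<le> T" "T \<le> X + 1" using X0 by (auto simp: T_def of_nat_nat)
  have small: "K * (energy p G f * q ^ T) \<le> 1"
  proof -
    have "q ^ T = exp (- (c * F') * T)" by (simp add: q_def exp_of_nat_mult[symmetric] mult.commute)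
    also have "\<dots> \<le> exp (- (c * F') * X)"
      using mult_left_mono[OF TX(1), of "c * F'"] cF by simp
    also have "- (c * F') * X = - ln (K * (real n)\<^sup>2)" using c F by (simp add: X_def)
    also have "exp \<dots> = 1 / (K * (real n)\<^sup>2)" using K0 n2 by (simp add: exp_minus divide_inverse)
    finally have "K * (energy p G f * q ^ T) \<le> K * ((real n)\<^sup>2 * (1 / (K * (real n)\<^sup>2)))"
      using energy_le_square[OF p f] K0 energy_nonneg q by (intro mult_left_mono mult_mono) auto
    then show ?thesis using K0 n2 by simp
  qed
  have geo: "1 / (1 - q) \<le> 1 + 1 / (c * F')"
  proof -
    have "1 + c * F' \<le> exp (c * F')" by (rule exp_ge_add_one_self)
    then have "q \<le> 1 / (1 + c * F')" using cF by (simp add: q_def exp_minus field_simps)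
    then have "1 - 1 / (1 + c * F') \<le> 1 - q" by simp
    moreover have "1 - 1 / (1 + c * F') = c * F' / (1 + c * F')" using cF by (simp add: field_simps)
    ultimately have "c * F' / (1 + c * F') \<le> 1 - q" by simp
    then have "1 / (1 - q) \<le> 1 / (c * F' / (1 + c * F'))" using cF q by (intro divide_left_mono mult_pos_pos) auto
    also have "\<dots> = 1 + 1 / (c * F')" using c F by (simp add: field_simps)
    finally show ?thesis .
  qed
  have "integral\<^sup>N (vertex_seq G) (consensus_time p G f \<epsilon>)
      \<le> (\<integral>\<^sup>+\<omega>. of_nat T + (\<Sum>k. ennreal K * ennreal (energy p G (profile p G f \<omega> (T + k)))) \<partial>vertex_seq G)"
    unfolding K_def by (intro nn_integral_mono consensus_time_le p e)
  also have "\<dots> = of_nat T + (\<Sum>k. ennreal K * (\<integral>\<^sup>+\<omega>. ennreal (energy p G (profile p G f \<omega> (T + k))) \<partial>vertex_seq G))"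
  proof -
    have "emeasure (vertex_seq G) (space (vertex_seq G)) = 1"
      unfolding vertex_seq_def by (rule seq.P.emeasure_space_1)
    then show ?thesis
      by (subst nn_integral_add) (auto simp: nn_integral_suminf nn_integral_cmult)
  qed
  also have "\<dots> \<le> of_nat T + (\<Sum>k. ennreal (q ^ k))"
  proof (intro add_left_mono suminf_le allI)
    fix k
    have "ennreal K * (\<integral>\<^sup>+\<omega>. ennreal (energy p G (profile p G f \<omega> (T + k))) \<partial>vertex_seq G)
        \<le> ennreal K * ennreal (energy p G f * q ^ (T + k))"
      using decay[of "T + k"] unfolding q_def by (intro mult_left_mono) auto
    also have "\<dots> = ennreal ((K * (energy p G f * q ^ T)) * q ^ k)"
      using K0 energy_nonneg q by (simp add: ennreal_mult[symmetric] power_add mult_ac)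
    also have "\<dots> \<le> ennreal (1 * q ^ k)"
      using small q by (intro ennreal_leI mult_right_mono) auto
    finally show "ennreal K * (\<integral>\<^sup>+\<omega>. ennreal (energy p G (profile p G f \<omega> (T + k))) \<partial>vertex_seq G) \<le> ennreal (q ^ k)" by simp
  qed auto
  also have "(\<Sum>k. ennreal (q ^ k)) = ennreal (1 / (1 - q))"
    using q by (subst suminf_ennreal2) (auto simp: suminf_geometric summable_geometric)
  also have "of_nat T + ennreal (1 / (1 - q)) = ennreal (T + 1 / (1 - q))"
    using q by (simp add: ennreal_of_nat_eq_real_of_nat)
  also have "\<dots> \<le> ennreal (((p + 3) / c + 2) * ln (n / \<epsilon>) / F')"
  proof (rule ennreal_leI)
    define Y where "Y = ln (n / \<epsilon>) / F'"
    have Y1: "1 \<le> Y" using lnne F frac_le[of 1 "ln (n / \<epsilon>)" F' 1] by (auto simp: Y_def)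
    have "1 / F' \<le> Y" unfolding Y_def using lnne F by (intro divide_right_mono) auto
    then have "1 / (c * F') \<le> Y / c" using c divide_right_mono[of "1 / F'" Y c] by (simp add: mult.commute)
    \<comment> \<open>The share p + 2 comes from \<open>X\<close>, the 2 from rounding
      \<open>X\<close> up and from the constant in \<open>geo\<close>, and Y / c from 1 / (c
      F').\<close>
    then have "T + 1 / (1 - q) \<le> (p + 2) / c * Y + 2 + Y / c"
      using geo TX X_le unfolding Y_def[symmetric] by linarith
    also have "\<dots> \<le> (p + 2) / c * Y + 2 * Y + Y / c" using Y1 by simp
    also have "\<dots> = ((p + 3) / c + 2) * Y" using c by (simp add: field_simps)
    finally show "T + 1 / (1 - q) \<le> ((p + 3) / c + 2) * ln (n / \<epsilon>) / F'" by (simp add: Y_def)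
  qed
  finally show ?thesis .
qed

end

subsection \<open>Barriers in a resistor network\<close>

text \<open>For equal signs this is the mean value theorem for r \<ge> 1 and the tangent inequality
  for r < 1, in elementary form; for different signs b - c is at most 2 m and the increment is at
  least m^r.\<close>

lemma phi_diff_ge:
  assumes r: "0 < r" and cb: "c < b"
  defines "m \<equiv> max \<bar>b\<bar> \<bar>c\<bar>"
  shows "min 1 r / 2 * (b - c) * m powr (r - 1) \<le> phi r b - phi r c"
proof -
  have same: "min 1 r / 2 * (y - z) * y powr (r - 1) \<le> y powr r - z powr r" if yz: "0 \<le> z" "z < y" for y z :: real
  proof -
    have "min 1 r * (y - z) * y powr (r - 1) \<le> y powr r - z powr r"
    proof (cases "1 \<le> r")
      case True
      have "z powr r \<le> z * y powr (r - 1)"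
      proof (cases "z = 0")
        case False
        then have "z powr r = z * z powr (r - 1)" using yz by (simp add: powr_diff)
        also have "\<dots> \<le> z * y powr (r - 1)" using yz True by (intro mult_left_mono powr_mono2) auto
        finally show ?thesis .
      qed simp
      moreover have "y powr r = y * y powr (r - 1)" using yz by (simp add: powr_diff)
      ultimately show ?thesis using True by (simp add: algebra_simps)
    next
      case False
      have "z powr r \<le> y powr r + r * y powr r * (z / y - 1)"
        using False yz r by (intro powr_tangent) auto
      moreover have "y powr r * (z / y - 1) = y powr (r - 1) * (z - y)"
      proof -
        have "y * q * (z / y - 1) = q * (z - y)" for q using yz by (simp add: field_simps)
        moreover have yy: "y powr r = y * y powr (r - 1)" using yz by (simp add: powr_diff)
        ultimately show ?thesis by (simp only: yy)
      qed
      then have "r * y powr r * (z / y - 1) = r * (y powr (r - 1) * (z - y))" by (simp add: mult.assoc)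
      ultimately show ?thesis using False by (simp add: algebra_simps)
    qed
    moreover have "0 \<le> min 1 r * (y - z) * y powr (r - 1)" using yz r by simp
    ultimately show ?thesis by (simp add: field_simps)
  qed
  consider "0 \<le> c" | "c < 0" "0 < b" | "b \<le> 0" using cb by linarith
  then show ?thesis
  proof cases
    case 1
    then have "m = b" using cb by (simp add: m_def)
    then show ?thesis using 1 cb same[of c b] by (simp add: phi_nonneg)
  next
    case 2
    have m: "0 < m" "b - c \<le> 2 * m" using 2 by (auto simp: m_def)
    have "min 1 r * (b - c) * m powr (r - 1) \<le> 1 * (2 * m) * m powr (r - 1)"
      using m cb by (intro mult_right_mono mult_mono) auto
    also have "\<dots> = 2 * m powr r" using m by (simp add: powr_diff)
    also have "m powr r \<le> phi r b - phi r c"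
      using 2 by (auto simp: m_def max_def phi_nonneg phi_nonpos)
    finally show ?thesis by (simp add: field_simps)
  next
    case 3
    then have "m = - c" using cb by (simp add: m_def)
    then show ?thesis using 3 cb same[of "- b" "- c"] by (simp add: phi_nonpos algebra_simps)
  qed
qed

text \<open>The increment of \<open>phi r\<close> over the upper half of an interval is at least a
  fixed fraction of the increment over the whole: |x|^(r-1) dx is doubling. The half is bounded
  below by \<open>phi_diff_ge\<close>, the whole above by \<open>whole\<close>, both through the
  same maximum.\<close>

lemma phi_doubling:
  assumes r: "0 < r"
  obtains \<epsilon> where "0 < \<epsilon>" "\<epsilon> < 1" "\<And>s e. 0 \<le> e \<Longrightarrow> phi r (s - e / 2) \<le> (1 - \<epsilon>) * phi r s + \<epsilon> * phi r (s - e)"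
proof -
  define C where "C = (if 1 \<le> r then r * 3 powr (r - 1) else 8)"
  have C0: "0 < C" using r by (auto simp: C_def)
  have whole: "phi r b - phi r a \<le> C * (b - a) * max \<bar>b\<bar> \<bar>(a + b) / 2\<bar> powr (r - 1)" if ab: "a < b" for a b
  proof (cases "1 \<le> r")
    case True
    let ?m = "max \<bar>b\<bar> \<bar>(a + b) / 2\<bar>"
    \<comment> \<open>As a = 2 * midpoint - b, the far endpoint is at most three times the
      maximum.\<close>
    have "\<bar>a\<bar> \<le> 3 * ?m" "\<bar>b\<bar> \<le> 3 * ?m" by (auto simp: max_def abs_if field_simps)
    then have "phi r b - phi r a \<le> r * (b - a) * (3 * ?m) powr (r - 1)"
      using True ab by (intro phi_diff_Lipschitz) auto
    then show ?thesis using True by (simp add: C_def powr_mult mult_ac)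
  next
    case False
    define m where "m = max \<bar>b\<bar> \<bar>(a + b) / 2\<bar>"
    have m: "0 < m" using ab by (auto simp: m_def max_def)
    have m_cases: "m = \<bar>b\<bar> \<or> m = \<bar>(a + b) / 2\<bar>" by (auto simp: m_def max_def)
    \<comment> \<open>Either the interval has length at least m / 4 and the Hoelder bound suffices,
      or it is too short to come within m / 4 of 0, where the derivative is singular.\<close>
    have near: "phi r b - phi r a \<le> (b - a) * (m / 4) powr (r - 1) * 2"
    proof (cases "m / 4 \<le> b - a")
      case True
      have "phi r b - phi r a \<le> 2 * (b - a) powr r" using False r ab by (intro phi_diff_Holder) auto
      also have "\<dots> = 2 * ((b - a) * (b - a) powr (r - 1))" using ab by (simp add: powr_diff)
      also have "\<dots> \<le> 2 * ((b - a) * (m / 4) powr (r - 1))"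
        using True False ab m by (intro mult_left_mono powr_mono2') auto
      finally show ?thesis by (simp add: mult_ac)
    next
      case ge: False
      have step: "y powr r - z powr r \<le> (y - z) * (m / 4) powr (r - 1)" if "m / 4 \<le> z" "z \<le> y" for y z
      proof -
        have "0 < z" "0 < y" using that m by linarith+
        then have "y powr r = y * y powr (r - 1)" "z powr r = z * z powr (r - 1)"
          by (auto simp: powr_diff)
        moreover have "y * y powr (r - 1) \<le> y * z powr (r - 1)"
          using that \<open>0 < z\<close> \<open>0 < y\<close> False by (intro mult_left_mono powr_mono2') auto
        moreover have "(y - z) * z powr (r - 1) \<le> (y - z) * (m / 4) powr (r - 1)"
          using that m False by (intro mult_left_mono powr_mono2') auto
        ultimately show ?thesis by (simp add: algebra_simps)
      qed
      have nn: "0 \<le> (b - a) * (m / 4) powr (r - 1)" using ab by simp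
      have "m / 4 \<le> a \<or> b \<le> - (m / 4)"
      proof -
        consider "m = b" | "m = - b" | "m = (a + b) / 2" | "m = - ((a + b) / 2)"
          using m_cases by (metis abs_if)
        then show ?thesis
        proof cases
          case 1 then show ?thesis using ge ab m by (intro disjI1) linarith
        next
          case 2 then show ?thesis using ge ab m by (intro disjI2) linarith
        next
          case 3 then show ?thesis using ge ab m by (intro disjI1) argo
        next
          case 4 then show ?thesis using ge ab m by (intro disjI2) argo
        qed
      qed
      then show ?thesis
      proof
        assume *: "m / 4 \<le> a"
        then show ?thesis using step[of a b] ab m nn phi_nonneg[of a r] phi_nonneg[of b r] by linarith
      next
        assume *: "b \<le> - (m / 4)"
        then have "(- a) powr r - (- b) powr r \<le> (b - a) * (m / 4) powr (r - 1)"
          using step[of "- b" "- a"] ab by simp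
        moreover have "phi r a = - ((- a) powr r)" "phi r b = - ((- b) powr r)"
          using * ab m by (intro phi_nonpos; linarith)+
        ultimately show ?thesis using nn by linarith
      qed
    qed
    have "(1 / 4) powr (r - 1) \<le> (1 / 4 :: real) powr (- 1)" using r by (intro powr_mono') auto
    then have "(m / 4) powr (r - 1) \<le> 4 * m powr (r - 1)"
      using m mult_right_mono[of "(1 / 4) powr (r - 1)" 4 "m powr (r - 1)"]
      by (simp add: powr_divide powr_minus)
    then have "(b - a) * (m / 4) powr (r - 1) * 2 \<le> (b - a) * (4 * m powr (r - 1)) * 2"
      using ab by (intro mult_right_mono mult_left_mono) auto
    with near have "phi r b - phi r a \<le> (b - a) * (4 * m powr (r - 1)) * 2" by (rule order.trans)
    then have "phi r b - phi r a \<le> 8 * (b - a) * m powr (r - 1)" by (simp add: algebra_simps)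
    moreover have "C = 8" using False by (simp add: C_def)
    ultimately show ?thesis by (simp only: m_def)
  qed
  define \<epsilon> where "\<epsilon> = min (1 / 2) (min 1 r / (4 * C))"
  have e0: "0 < \<epsilon>" "\<epsilon> < 1" using C0 r by (auto simp: \<epsilon>_def)
  have main: "\<epsilon> * (phi r b - phi r a) \<le> phi r b - phi r ((a + b) / 2)" if ab: "a < b" for a b
  proof -
    let ?m = "max \<bar>b\<bar> \<bar>(a + b) / 2\<bar>"
    have "\<epsilon> * (phi r b - phi r a) \<le> \<epsilon> * (C * (b - a) * ?m powr (r - 1))"
      using whole[OF ab] e0 by (intro mult_left_mono) auto
    also have "\<dots> \<le> min 1 r / (4 * C) * (C * (b - a) * ?m powr (r - 1))"
      using C0 ab by (intro mult_right_mono) (auto simp: \<epsilon>_def)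
    also have "\<dots> = min 1 r / 2 * (b - (a + b) / 2) * ?m powr (r - 1)"
      using C0 by (simp add: field_simps)
    also have "\<dots> \<le> phi r b - phi r ((a + b) / 2)"
      using ab r by (intro phi_diff_ge) auto
    finally show ?thesis .
  qed
  show thesis
  proof (rule that[OF e0])
    fix s e :: real assume "0 \<le> e"
    show "phi r (s - e / 2) \<le> (1 - \<epsilon>) * phi r s + \<epsilon> * phi r (s - e)"
    proof (cases "e = 0")
      case False
      then have "\<epsilon> * (phi r s - phi r (s - e)) \<le> phi r s - phi r ((s - e + s) / 2)"
        using \<open>0 \<le> e\<close> by (intro main) auto
      moreover have eq: "(s - e + s) / 2 = s - e / 2" by (simp add: field_simps)
      ultimately have "\<epsilon> * (phi r s - phi r (s - e)) \<le> phi r s - phi r (s - e / 2)" by (simp only: eq)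
      then show ?thesis by (simp add: algebra_simps)
    qed (simp add: algebra_simps)
  qed
qed

text \<open>\<open>B i\<close> bounds the values in layer \<open>i\<close>, and \<open>A i\<close> those of its vertices that were not
  updated since the last change of \<open>A i\<close>; the averages \<open>(A j + B j) / 2\<close> enter as effective
  bounds of the layers.\<close>

locale network =
  fixes H :: nat and c :: "nat \<Rightarrow> nat \<Rightarrow> real"
  assumes c_nonneg: "0 \<le> c i j" and c_sym: "c i j = c j i"
begin

definition tot :: "nat \<Rightarrow> real" where
  "tot i = (\<Sum>j\<le>H. c i j)"

text \<open>Voltages balancing the averaged bounds of the neighbours, which depend on
  \<open>B\<close> again; node \<open>H\<close> is a boundary node.\<close>

definition barrier :: "(nat \<Rightarrow> real) \<Rightarrow> (nat \<Rightarrow> real) \<Rightarrow> bool" where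
  "barrier A B \<longleftrightarrow> (\<forall>i<H. tot i * B i = (\<Sum>j\<le>H. c i j * ((A j + B j) / 2))) \<and> B H = A H"

text \<open>A Dirichlet energy whose Euler-Lagrange equation in \<open>B\<close>, with
  \<open>B H\<close> fixed, is the equation of \<open>barrier\<close>. It also records the
  discrepancy between \<open>A\<close> and \<open>B\<close>, so that raising \<open>A\<close> lowers
  it.\<close>

definition Psi :: "(nat \<Rightarrow> real) \<Rightarrow> (nat \<Rightarrow> real) \<Rightarrow> real" where
  "Psi A B = (\<Sum>i\<le>H. \<Sum>j\<le>H. c i j * ((B i - B j)\<^sup>2 / 8 + (B i - A j)\<^sup>2 / 4))"

lemma tot_nonneg: "0 \<le> tot i"
  unfolding tot_def by (intro sum_nonneg c_nonneg)

lemma Psi_nonneg: "0 \<le> Psi A B"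
  unfolding Psi_def by (intro sum_nonneg mult_nonneg_nonneg c_nonneg) auto

lemma Psi_self_le: "Psi A A \<le> (\<Sum>i\<le>H. \<Sum>j\<le>H. c i j * (A i - A j)\<^sup>2)"
  unfolding Psi_def by (intro sum_mono mult_left_mono c_nonneg) auto

text \<open>Monotone iteration from a subsolution: the iterates increase and stay below 1, and the
  limit is a fixed point. That the solution lies above \<open>B0\<close> is what makes barriers rise
  only.\<close>

lemma barrier_exists:
  assumes tot: "\<And>i. i < H \<Longrightarrow> 0 < tot i"
    and sub: "\<And>i. i < H \<Longrightarrow> tot i * B0 i \<le> (\<Sum>j\<le>H. c i j * ((A j + B0 j) / 2))"
    and bd: "B0 H = A H" "\<And>i. i \<le> H \<Longrightarrow> A i \<le> 1" "\<And>i. i \<le> H \<Longrightarrow> B0 i \<le> 1"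
  obtains B where "barrier A B" "\<And>i. i \<le> H \<Longrightarrow> B0 i \<le> B i" "\<And>i. i \<le> H \<Longrightarrow> B i \<le> 1"
proof -
  define T where "T B i = (if i < H then (\<Sum>j\<le>H. c i j * ((A j + B j) / 2)) / tot i else B0 i)" for B i
  define b where "b n = (T ^^ n) B0" for n
  have bS: "b (Suc n) = T (b n)" for n by (simp add: b_def)
  have T_mono: "T B i \<le> T B' i" if "\<And>j. j \<le> H \<Longrightarrow> B j \<le> B' j" for B B' i
  proof (cases "i < H")
    case True
    have "(\<Sum>j\<le>H. c i j * ((A j + B j) / 2)) \<le> (\<Sum>j\<le>H. c i j * ((A j + B' j) / 2))"
      using that by (intro sum_mono mult_left_mono c_nonneg) auto
    then show ?thesis unfolding T_def using True tot_nonneg by (simp add: divide_right_mono)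
  qed (simp add: T_def)
  have inc: "b n i \<le> b (Suc n) i" if "i \<le> H" for n i
    using that
  proof (induction n arbitrary: i)
    case 0 then show ?case using sub[of i] tot[of i] by (auto simp: b_def T_def field_simps)
  next
    case (Suc n) then show ?case unfolding bS by (intro T_mono) (use Suc bS in auto)
  qed
  have le1: "b n i \<le> 1" if "i \<le> H" for n i
    using that
  proof (induction n arbitrary: i)
    case 0 then show ?case using bd by (simp add: b_def)
  next
    case (Suc n)
    have "(\<Sum>j\<le>H. c i j * ((A j + b n j) / 2)) \<le> tot i"
      unfolding tot_def using bd Suc by (intro sum_mono mult_left_le c_nonneg) fastforce
    then show ?case unfolding bS using tot[of i] bd Suc.prems by (auto simp: T_def)
  qed
  define B where "B i = (SUP n. b n i)" for i
  have incseq: "incseq (\<lambda>n. b n i)" if "i \<le> H" for i using inc[OF that] by (rule incseq_SucI)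
  have bdd: "bdd_above (range (\<lambda>n. b n i))" if "i \<le> H" for i using le1[OF that] by (intro bdd_aboveI[of _ 1]) auto
  have lim: "(\<lambda>n. b n i) \<longlonglongrightarrow> B i" if "i \<le> H" for i
    unfolding B_def by (intro LIMSEQ_incseq_SUP incseq bdd that)
  have "T B i = B i" if "i \<le> H" for i
  proof (rule LIMSEQ_unique)
    show "(\<lambda>n. b (Suc n) i) \<longlonglongrightarrow> B i" using lim[OF that] by (rule LIMSEQ_Suc)
    show "(\<lambda>n. b (Suc n) i) \<longlonglongrightarrow> T B i"
      unfolding bS T_def using lim tot by (cases "i < H") (auto intro!: tendsto_intros simp: less_imp_neq[symmetric])
  qed
  then have TB: "T B i = B i" if "i \<le> H" for i using that by blast
  have "barrier A B"
    unfolding barrier_def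
  proof (intro conjI allI impI)
    fix i assume "i < H"
    then show "tot i * B i = (\<Sum>j\<le>H. c i j * ((A j + B j) / 2))"
      using TB[of i] tot[of i] unfolding T_def by (simp add: field_simps)
    next
    show "B H = A H" using TB[of H] bd unfolding T_def by simp
  qed
  moreover have "B0 i \<le> B i" if "i \<le> H" for i
    using cSUP_upper[OF _ bdd[OF that], of 0] by (simp add: B_def b_def)
  moreover have "B i \<le> 1" if "i \<le> H" for i
    unfolding B_def using le1[OF that] by (intro cSUP_least) auto
  ultimately show thesis using that by blast
qed

text \<open>\<open>Psi A\<close> is a convex quadratic function of \<open>B\<close>. Expanded at the
  solution \<open>B'\<close>, the first-order term vanishes by the barrier equation and, at node
  \<open>H\<close>, by equality of boundary values.\<close>

lemma Psi_min:
  assumes B': "barrier A B'" and H: "B H = B' H"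
  shows "Psi A B' \<le> Psi A B"
proof -
  define D where "D i = B i - B' i" for i
  have swap: "(\<Sum>i\<le>H. \<Sum>j\<le>H. c i j * ((B' i - B' j) * D j)) = - (\<Sum>i\<le>H. \<Sum>j\<le>H. c i j * ((B' i - B' j) * D i))"
    by (subst sum.swap) (simp add: c_sym[of _ _] algebra_simps sum_negf[symmetric] cong: sum.cong)
  have "Psi A B - Psi A B' = (\<Sum>i\<le>H. \<Sum>j\<le>H. c i j * ((D i - D j)\<^sup>2 / 8 + (D i)\<^sup>2 / 4
       + (B' i - B' j) * (D i - D j) / 4 + (B' i - A j) * D i / 2))"
    unfolding Psi_def D_def sum_subtractf[symmetric]
    by (intro sum.cong refl) (simp add: power2_eq_square field_simps)
  also have "\<dots> = (\<Sum>i\<le>H. \<Sum>j\<le>H. c i j * ((D i - D j)\<^sup>2 / 8 + (D i)\<^sup>2 / 4))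
     + ((\<Sum>i\<le>H. \<Sum>j\<le>H. c i j * ((B' i - B' j) * D i)) / 4 - (\<Sum>i\<le>H. \<Sum>j\<le>H. c i j * ((B' i - B' j) * D j)) / 4
       + (\<Sum>i\<le>H. \<Sum>j\<le>H. c i j * ((B' i - A j) * D i)) / 2)"
    unfolding sum_divide_distrib sum.distrib[symmetric] sum_subtractf[symmetric]
    by (intro sum.cong refl) (simp add: field_simps)
  also have "(\<Sum>i\<le>H. \<Sum>j\<le>H. c i j * ((B' i - B' j) * D i)) / 4 - (\<Sum>i\<le>H. \<Sum>j\<le>H. c i j * ((B' i - B' j) * D j)) / 4
       + (\<Sum>i\<le>H. \<Sum>j\<le>H. c i j * ((B' i - A j) * D i)) / 2
     = (\<Sum>i\<le>H. D i * (tot i * B' i - (\<Sum>j\<le>H. c i j * ((A j + B' j) / 2))))"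
    unfolding swap tot_def sum_distrib_left sum_distrib_right sum_subtractf[symmetric] sum_divide_distrib
      minus_divide_left[symmetric] diff_minus_eq_add sum.distrib[symmetric]
    by (intro sum.cong refl) (simp add: field_simps)
  also have "\<dots> = 0"
  proof (intro sum.neutral ballI)
    fix i assume "i \<in> {..H}"
    then show "D i * (tot i * B' i - (\<Sum>j\<le>H. c i j * ((A j + B' j) / 2))) = 0"
      using B' H by (cases "i = H") (auto simp: barrier_def D_def)
  qed
  finally have "Psi A B - Psi A B' = (\<Sum>i\<le>H. \<Sum>j\<le>H. c i j * ((D i - D j)\<^sup>2 / 8 + (D i)\<^sup>2 / 4))" by simp
  also have "\<dots> \<ge> 0" by (intro sum_nonneg mult_nonneg_nonneg c_nonneg) auto
  finally show ?thesis by simp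
qed

text \<open>Only terms containing \<open>A k\<close> change. They yield the stated square and a
  multiple of the total current into \<open>k\<close>, which by the barrier equation is a
  nonnegative combination of the differences B i - A i.\<close>

lemma Psi_raise:
  assumes B: "barrier A B" and AB: "\<And>i. i \<le> H \<Longrightarrow> A i \<le> B i" and k: "k < H"
  shows "Psi (A(k := B k)) B \<le> Psi A B - tot k * (B k - A k)\<^sup>2 / 4"
proof -
  have "Psi A B - Psi (A(k := B k)) B
      = (\<Sum>i\<le>H. \<Sum>j\<le>H. if j = k then c i k * ((B i - A k)\<^sup>2 - (B i - B k)\<^sup>2) / 4 else 0)"
    unfolding Psi_def sum_subtractf[symmetric]
    by (intro sum.cong refl) (simp add: field_simps)
  also have "\<dots> = (\<Sum>i\<le>H. c i k * ((B i - A k)\<^sup>2 - (B i - B k)\<^sup>2) / 4)"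
    using k by simp
  also have "\<dots> = (\<Sum>i\<le>H. c k i * (B k - A k)\<^sup>2 / 4 + (B k - A k) / 2 * (c k i * (B i - B k)))"
    by (intro sum.cong refl) (simp add: c_sym[of _ k] power2_eq_square field_simps)
  also have "\<dots> = tot k * (B k - A k)\<^sup>2 / 4 + (B k - A k) / 2 * (\<Sum>i\<le>H. c k i * (B i - B k))"
    by (simp add: sum.distrib tot_def sum_distrib_right sum_distrib_left sum_divide_distrib)
  also have "(\<Sum>i\<le>H. c k i * (B i - B k)) = (\<Sum>i\<le>H. c k i * ((B i - A i) / 2))"
  proof -
    have "(\<Sum>i\<le>H. c k i * (B i - B k)) = (\<Sum>i\<le>H. c k i * B i) - tot k * B k"
      by (simp add: tot_def right_diff_distrib sum_subtractf sum_distrib_right)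
    also have "tot k * B k = (\<Sum>j\<le>H. c k j * ((A j + B j) / 2))" using B k by (simp add: barrier_def)
    also have "(\<Sum>i\<le>H. c k i * B i) - \<dots> = (\<Sum>i\<le>H. c k i * ((B i - A i) / 2))"
      unfolding sum_subtractf[symmetric] by (intro sum.cong refl) (simp add: field_simps)
    finally show ?thesis .
  qed
  finally have "Psi A B - Psi (A(k := B k)) B
      = tot k * (B k - A k)\<^sup>2 / 4 + (B k - A k) / 2 * (\<Sum>i\<le>H. c k i * ((B i - A i) / 2))" .
  moreover have "0 \<le> (B k - A k) / 2 * (\<Sum>i\<le>H. c k i * ((B i - A i) / 2))"
    using AB k by (intro mult_nonneg_nonneg sum_nonneg c_nonneg) auto
  ultimately show ?thesis by linarith
qed

end

subsection \<open>Dynamics on layered graphs\<close>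

locale layered =
  fixes V :: "'a set" and lay :: "'a \<Rightarrow> nat" and H :: nat and r :: real
  assumes fin: "finite V"
    and layers: "\<And>i. i \<le> H \<Longrightarrow> \<exists>v\<in>V. lay v = i"
    and r0: "0 < r"
begin

definition layer :: "nat \<Rightarrow> 'a set" where
  "layer i = {v\<in>V. lay v = i}"

definition width :: "nat \<Rightarrow> nat" where
  "width i = card (layer i)"

definition \<mu> :: "nat \<Rightarrow> real" where
  "\<mu> i = real (width i) powr (1 / r)"

definition near :: "nat \<Rightarrow> nat set" where
  "near i = {j. j = Suc i \<or> i = Suc j}"

text \<open>The equation at layer \<open>i\<close> involves only the weights \<open>\<mu> j\<close>
  of its neighbours; the factor \<open>\<mu> i\<close> makes the conductances symmetric, so that an
  energy exists.\<close>

definition cond :: "nat \<Rightarrow> nat \<Rightarrow> real" where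
  "cond i j = (if j \<in> near i then \<mu> i * \<mu> j else 0)"

definition nbrs :: "'a \<Rightarrow> 'a set" where
  "nbrs v = {w\<in>V. lay w \<in> near (lay v)}"

sublocale network H cond
proof
  show "0 \<le> cond i j" for i j by (simp add: cond_def \<mu>_def)
  show "cond i j = cond j i" for i j by (auto simp: cond_def near_def)
qed

lemma finite_layer: "finite (layer i)"
  using fin by (simp add: layer_def)

lemma width_pos: "i \<le> H \<Longrightarrow> 0 < width i"
  using layers[of i] finite_layer[of i] by (auto simp: width_def layer_def card_gt_0_iff)

lemma \<mu>_pos: "i \<le> H \<Longrightarrow> 0 < \<mu> i"
  using width_pos by (simp add: \<mu>_def)

lemma \<mu>_powr: "\<mu> i powr r = width i"
  using r0 by (simp add: \<mu>_def powr_powr)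

lemma sum_cond:
  assumes "i < H"
  shows "(\<Sum>j\<le>H. cond i j * g j) = \<mu> i * (\<Sum>j\<in>near i. \<mu> j * g j)"
proof -
  have "(\<Sum>j\<le>H. cond i j * g j) = (\<Sum>j\<in>near i. cond i j * g j)"
    using assms by (intro sum.mono_neutral_right) (auto simp: near_def cond_def)
  then show ?thesis by (simp add: cond_def sum_distrib_left mult.assoc)
qed

lemma tot_ge:
  assumes "i < H" "j \<in> near i"
  shows "\<mu> i * \<mu> j \<le> tot i"
proof -
  have "cond i j \<le> tot i" unfolding tot_def
    using assms by (intro member_le_sum c_nonneg) (auto simp: near_def)
  then show ?thesis using assms by (simp add: cond_def)
qed

lemma tot_pos:
  assumes "i < H"
  shows "0 < tot i"
proof -
  have "0 < \<mu> i * \<mu> (Suc i)" using assms \<mu>_pos by simp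
  also have "\<dots> \<le> tot i" using assms by (intro tot_ge) (auto simp: near_def)
  finally show ?thesis .
qed

lemma sum_near: "(\<Sum>j\<in>near i. g j) = (if i = 0 then g 1 else g (i - 1) + g (i + 1))" for g :: "nat \<Rightarrow> real"
proof (cases i)
  case 0
  then have "near i = {1}" by (auto simp: near_def)
  then show ?thesis using 0 by simp
next
  case (Suc k)
  then have "near i = {k, Suc (Suc k)}" by (auto simp: near_def)
  then show ?thesis using Suc by simp
qed

text \<open>\<open>U\<close> holds the vertices updated since the last rise of \<open>A\<close> in
  their layer; these may reach \<open>B\<close>. From layer \<open>H\<close> on only the bound 1 is
  kept.\<close>

definition dominated :: "(nat \<Rightarrow> real) \<Rightarrow> (nat \<Rightarrow> real) \<Rightarrow> 'a set \<Rightarrow> ('a \<Rightarrow> real) \<Rightarrow> bool" where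
  "dominated A B U f \<longleftrightarrow> (\<forall>v\<in>V. f v \<le> 1) \<and> (\<forall>v\<in>V. lay v < H \<longrightarrow> f v \<le> (if v \<in> U then B (lay v) else A (lay v)))"

text \<open>With at most a fraction \<epsilon> of the layer at the level \<open>B j\<close> and the
  rest at \<open>A j\<close>, the doubling inequality bounds the pull of the layer by that of a
  layer constant at the average. Layer \<open>H\<close> has constant bound 1.\<close>

lemma layer_balance:
  fixes \<epsilon> :: real
  assumes \<epsilon>: "0 < \<epsilon>" "\<epsilon> < 1"
    and dbl: "\<And>s e. 0 \<le> e \<Longrightarrow> phi r (s - e / 2) \<le> (1 - \<epsilon>) * phi r s + \<epsilon> * phi r (s - e)"
    and dom: "dominated A B U f" and H1: "A H = 1" "B H = 1" and AB: "A j \<le> B j"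
    and j: "j \<le> H" and U: "j < H \<Longrightarrow> card (U \<inter> layer j) \<le> \<epsilon> * width j"
  shows "width j * phi r (b - (A j + B j) / 2) \<le> (\<Sum>u\<in>layer j. phi r (b - f u))"
proof (cases "j = H")
  case True
  have "(\<Sum>u\<in>layer j. phi r (b - 1)) \<le> (\<Sum>u\<in>layer j. phi r (b - f u))"
    using dom r0 by (intro sum_mono phi_mono) (auto simp: dominated_def layer_def)
  then show ?thesis using True H1 by (simp add: width_def)
next
  case False
  then have jH: "j < H" using j by simp
  let ?k = "card (U \<inter> layer j)"
  have k: "?k \<le> width j" unfolding width_def by (intro card_mono finite_layer) auto
  have mono: "phi r (b - B j) \<le> phi r (b - A j)" using AB r0 by (intro phi_mono) auto
  have "phi r (b - (A j + B j) / 2) \<le> (1 - \<epsilon>) * phi r (b - A j) + \<epsilon> * phi r (b - B j)"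
  proof -
    have eq: "b - A j - (B j - A j) / 2 = b - (A j + B j) / 2" by (simp add: field_simps)
    show ?thesis using dbl[of "B j - A j" "b - A j"] AB unfolding eq by simp
  qed
  then have "width j * phi r (b - (A j + B j) / 2) \<le> width j * ((1 - \<epsilon>) * phi r (b - A j) + \<epsilon> * phi r (b - B j))"
    by (intro mult_left_mono) auto
  also have "\<dots> = width j * phi r (b - A j) - \<epsilon> * width j * (phi r (b - A j) - phi r (b - B j))"
    by (simp add: algebra_simps)
  also have "\<dots> \<le> width j * phi r (b - A j) - ?k * (phi r (b - A j) - phi r (b - B j))"
    using U[OF jH] mono by (intro diff_left_mono mult_right_mono) auto
  also have "\<dots> = (\<Sum>u\<in>U \<inter> layer j. phi r (b - B j)) + (\<Sum>u\<in>layer j - U. phi r (b - A j))"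
  proof -
    have "card (layer j - U) = width j - ?k"
      using card_Diff_subset_Int[of "layer j" U] finite_layer[of j] by (simp add: width_def Int_commute)
    then show ?thesis using k by (simp add: of_nat_diff algebra_simps)
  qed
  also have "\<dots> = (\<Sum>u\<in>layer j. if u \<in> U then phi r (b - B j) else phi r (b - A j))"
    by (subst sum.If_cases[OF finite_layer]) (simp add: Int_commute Diff_eq)
  also have "\<dots> \<le> (\<Sum>u\<in>layer j. phi r (b - f u))"
    using dom jH r0 by (intro sum_mono) (auto simp: dominated_def layer_def intro!: phi_mono)
  finally show ?thesis .
qed

text \<open>A layer has at most two neighbours, so the linear barrier equation equates two numbers
  up to sign. This survives applying the odd function \<open>phi r\<close>, and since
  \<open>\<mu> j powr r\<close> is the width it becomes the nonlinear balance with the averaged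
  bounds. Monotonicity of the balance then compares \<open>y\<close> with \<open>B\<close>.\<close>

lemma update_le_barrier:
  fixes \<epsilon> :: real
  assumes \<epsilon>: "0 < \<epsilon>" "\<epsilon> < 1"
    and dbl: "\<And>s e. 0 \<le> e \<Longrightarrow> phi r (s - e / 2) \<le> (1 - \<epsilon>) * phi r s + \<epsilon> * phi r (s - e)"
    and dom: "dominated A B U f" and bar: "barrier A B" and H1: "A H = 1"
    and AB: "\<And>j. j \<le> H \<Longrightarrow> A j \<le> B j"
    and U: "\<And>j. j < H \<Longrightarrow> card (U \<inter> layer j) \<le> \<epsilon> * width j"
    and v: "v \<in> V" "lay v < H"
    and y: "(\<Sum>u\<in>nbrs v. phi r (y - f u)) = 0"
  shows "y \<le> B (lay v)"
proof -
  define i where "i = lay v"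
  have iH: "i < H" using v by (simp add: i_def)
  define C where "C j = (A j + B j) / 2" for j
  have nbrs: "nbrs v = (\<Union>j\<in>near i. layer j)" by (auto simp: nbrs_def layer_def i_def)
  have finn: "finite (near i)" by (rule finite_subset[of _ "{..Suc i}"]) (auto simp: near_def)
  have "tot i * B i = (\<Sum>j\<le>H. cond i j * C j)" using bar iH by (simp add: barrier_def C_def)
  then have "(\<Sum>j\<le>H. cond i j * (B i - C j)) = 0"
    by (simp add: right_diff_distrib sum_subtractf tot_def sum_distrib_right)
  then have z: "(\<Sum>j\<in>near i. \<mu> j * (B i - C j)) = 0"
    using iH \<mu>_pos[of i] by (simp add: sum_cond)
  have "(\<Sum>j\<in>near i. phi r (\<mu> j * (B i - C j))) = 0"
  proof (cases "i = 0")
    case True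
    have "(\<Sum>j\<in>near i. g j) = g 1" for g :: "nat \<Rightarrow> real" using True by (simp add: sum_near)
    then show ?thesis using z by (simp only: phi_0)
  next
    case False
    have "\<mu> (i + 1) * (B i - C (i + 1)) = - (\<mu> (i - 1) * (B i - C (i - 1)))"
      using z False by (simp add: sum_near)
    then have "phi r (\<mu> (i + 1) * (B i - C (i + 1))) = - phi r (\<mu> (i - 1) * (B i - C (i - 1)))"
      by (metis phi_minus)
    then show ?thesis using False by (simp add: sum_near)
  qed
  moreover have "phi r (\<mu> j * (B i - C j)) = width j * phi r (B i - C j)" for j
    by (subst phi_mult) (auto simp: \<mu>_powr, simp add: \<mu>_def)
  ultimately have "0 = (\<Sum>j\<in>near i. width j * phi r (B i - C j))" by simp
  also have "\<dots> \<le> (\<Sum>j\<in>near i. \<Sum>u\<in>layer j. phi r (B i - f u))"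
  proof (rule sum_mono)
    fix j assume "j \<in> near i"
    then have "j \<le> H" using iH by (auto simp: near_def)
    then show "width j * phi r (B i - C j) \<le> (\<Sum>u\<in>layer j. phi r (B i - f u))"
      unfolding C_def using bar H1 AB by (intro layer_balance[OF \<epsilon> dbl dom] U) (auto simp: barrier_def)
  qed
  also have "\<dots> = (\<Sum>u\<in>nbrs v. phi r (B i - f u))"
    unfolding nbrs by (rule sum.UNION_disjoint[symmetric]) (use finn finite_layer in \<open>auto simp: layer_def\<close>)
  finally have ge: "(\<Sum>u\<in>nbrs v. phi r (y - f u)) \<le> (\<Sum>u\<in>nbrs v. phi r (B i - f u))" using y by simp
  have ne: "nbrs v \<noteq> {}" "finite (nbrs v)"
    using layers[of "Suc i"] iH fin by (auto simp: nbrs_def near_def i_def)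
  show ?thesis
  proof (rule ccontr)
    assume "\<not> y \<le> B (lay v)"
    then have "(\<Sum>u\<in>nbrs v. phi r (B i - f u)) < (\<Sum>u\<in>nbrs v. phi r (y - f u))"
      using ne r0 by (intro sum_strict_mono phi_strict_mono) (auto simp: i_def)
    then show False using ge by simp
  qed
qed

text \<open>A potential argument. A rise of a layer in \<open>I\<close> by e satisfies e \<le> a e^2
  + 1/(4a): the square is paid by the drop of \<open>Psi\<close>, the constant by the \<epsilon> m
  updates the layer has received since its last rise. This replaces Cauchy-Schwarz over the whole
  history by an invariant of a single step.\<close>

lemma slow_rise:
  fixes fs :: "nat \<Rightarrow> 'a \<Rightarrow> real" and \<epsilon> :: real
  assumes \<epsilon>: "0 < \<epsilon>" "\<epsilon> < 1"
    and dbl: "\<And>s e. 0 \<le> e \<Longrightarrow> phi r (s - e / 2) \<le> (1 - \<epsilon>) * phi r s + \<epsilon> * phi r (s - e)"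
    and step: "\<And>t. \<exists>v\<in>V. \<exists>y. fs (Suc t) = (fs t)(v := y) \<and> (\<Sum>u\<in>nbrs v. phi r (y - fs t u)) = 0"
    and le1: "\<And>t v. v \<in> V \<Longrightarrow> fs t v \<le> 1"
    and A0: "A0 H = 1" "\<And>i. i \<le> H \<Longrightarrow> A0 i \<le> 1"
      "\<And>i. i < H \<Longrightarrow> tot i * A0 i \<le> (\<Sum>j\<le>H. cond i j * A0 j)"
    and init: "\<And>v. v \<in> V \<Longrightarrow> lay v < H \<Longrightarrow> fs 0 v \<le> A0 (lay v)"
    and I: "I \<subseteq> {..<H}" "\<And>i. i \<in> I \<Longrightarrow> A0 i = 0" "\<And>i. i \<in> I \<Longrightarrow> m \<le> width i" "\<And>i. i \<in> I \<Longrightarrow> c0 \<le> tot i"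
    and pos: "0 < m" "0 < c0" "0 < Q" "I \<noteq> {}"
    and Q: "(\<Sum>i\<le>H. \<Sum>j\<le>H. cond i j * (A0 i - A0 j)\<^sup>2) \<le> Q"
    and high: "\<And>v. v \<in> V \<Longrightarrow> lay v \<in> I \<Longrightarrow> 1 / 5 \<le> fs T v"
  shows "\<epsilon> * real m * c0 * (real (card I))\<^sup>2 / (100 * Q) \<le> T"
proof -
  have finI: "finite I" using I(1) finite_subset by blast
  then have cI: "0 < real (card I)" using pos by (simp add: card_gt_0_iff)
  \<comment> \<open>Chosen so that the total energy budget \<open>K1 * Q\<close> is card I / 10,
    half of the rise card I / 5 that \<open>high\<close> forces.\<close>
  define a where "a = card I * c0 / (40 * Q)"
  have a0: "0 < a" using cI pos by (simp add: a_def)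
  define K1 where "K1 = 4 * a / c0"
  define K2 where "K2 = 1 / (4 * a * \<epsilon> * m)"
  have K: "0 < K1" "0 < K2" using a0 pos \<epsilon> by (auto simp: K1_def K2_def)
  \<comment> \<open>The subtracted cardinalities are updates not yet spent on a rise.\<close>
  define inv where "inv t A B U \<longleftrightarrow> barrier A B \<and> A H = 1 \<and> (\<forall>i\<le>H. A i \<le> B i \<and> B i \<le> 1)
      \<and> (\<forall>i<H. card (U \<inter> layer i) \<le> \<epsilon> * width i) \<and> dominated A B U (fs t)
      \<and> (\<Sum>i\<in>I. A i) \<le> K1 * (Q - Psi A B) + K2 * (t - (\<Sum>i\<in>I. real (card (U \<inter> layer i))))" for t A B U
  have "\<exists>A B U. inv t A B U" for t
  proof (induction t)
    case 0
    obtain B where B: "barrier A0 B" "\<And>i. i \<le> H \<Longrightarrow> A0 i \<le> B i" "\<And>i. i \<le> H \<Longrightarrow> B i \<le> 1"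
      using barrier_exists[of A0 A0] tot_pos A0 by auto
    have "Psi A0 B \<le> Psi A0 A0" using B A0 by (intro Psi_min) (auto simp: barrier_def)
    also have "\<dots> \<le> Q" using Psi_self_le Q by (rule order.trans)
    finally have "0 \<le> K1 * (Q - Psi A0 B)" using K by simp
    then have "inv 0 A0 B {}"
      using B A0 I init le1 \<epsilon> by (auto simp: inv_def dominated_def)
    then show ?case by blast
  next
    case (Suc t)
    then obtain A B U where inv: "inv t A B U" by blast
    then have bar: "barrier A B" and AH: "A H = 1" and AB: "\<And>i. i \<le> H \<Longrightarrow> A i \<le> B i"
      and B1: "\<And>i. i \<le> H \<Longrightarrow> B i \<le> 1" and cU: "\<And>i. i < H \<Longrightarrow> card (U \<inter> layer i) \<le> \<epsilon> * width i"
      and dom: "dominated A B U (fs t)"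
      and pot: "(\<Sum>i\<in>I. A i) \<le> K1 * (Q - Psi A B) + K2 * (t - (\<Sum>i\<in>I. real (card (U \<inter> layer i))))"
      by (auto simp: inv_def)
    obtain v y where v: "v \<in> V" and fS: "fs (Suc t) = (fs t)(v := y)" and y: "(\<Sum>u\<in>nbrs v. phi r (y - fs t u)) = 0"
      using step by blast
    show ?case
    proof (cases "lay v < H")
      case False
      have "dominated A B U (fs (Suc t))"
        using dom le1[of _ "Suc t"] False by (auto simp: dominated_def fS)
      moreover have "K2 * (t - (\<Sum>i\<in>I. real (card (U \<inter> layer i)))) \<le> K2 * (Suc t - (\<Sum>i\<in>I. real (card (U \<inter> layer i))))"
        using K by (intro mult_left_mono) auto
      ultimately have "inv (Suc t) A B U" using inv unfolding inv_def by (auto intro: order.trans)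
      then show ?thesis by blast
    next
      case vH: True
      define i where "i = lay v"
      have iH: "i < H" using vH by (simp add: i_def)
      have yB: "y \<le> B i" unfolding i_def
        by (rule update_le_barrier[OF \<epsilon> dbl dom bar AH AB cU v vH y])
      define U' where "U' = insert v U"
      have U'other: "U' \<inter> layer j = U \<inter> layer j" if "j \<noteq> i" for j
        using that by (auto simp: U'_def layer_def i_def)
      have dom': "dominated A B U' (fs (Suc t))"
        using dom le1[of _ "Suc t"] yB AB vH by (auto simp: dominated_def fS U'_def i_def)
      have cardU': "card (U' \<inter> layer i) \<le> card (U \<inter> layer i) + 1"
      proof -
        have "U' \<inter> layer i \<subseteq> insert v (U \<inter> layer i)" by (auto simp: U'_def)
        then have "card (U' \<inter> layer i) \<le> card (insert v (U \<inter> layer i))"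
          using finite_layer by (intro card_mono) auto
        also have "\<dots> \<le> card (U \<inter> layer i) + 1" using card_insert_le_m1 finite_layer by (simp add: card_insert_if)
        finally show ?thesis .
      qed
      have split_I: "(\<Sum>j\<in>I. real (card (X \<inter> layer j))) = (if i \<in> I then real (card (X \<inter> layer i)) else 0) + (\<Sum>j\<in>I - {i}. real (card (X \<inter> layer j)))" for X
        using finI sum.remove[of I i "\<lambda>j. real (card (X \<inter> layer j))"] by auto
      show ?thesis
      proof (cases "card (U' \<inter> layer i) \<le> \<epsilon> * width i")
        case True
        have c': "\<forall>j<H. card (U' \<inter> layer j) \<le> \<epsilon> * width j"
          using True cU U'other by metis
        have "(\<Sum>j\<in>I. real (card (U' \<inter> layer j))) \<le> (\<Sum>j\<in>I. real (card (U \<inter> layer j))) + 1"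
          unfolding split_I[of U] split_I[of U'] using cardU' U'other by (auto intro!: sum_mono)
        then have "K2 * (t - (\<Sum>j\<in>I. real (card (U \<inter> layer j)))) \<le> K2 * (Suc t - (\<Sum>j\<in>I. real (card (U' \<inter> layer j))))"
          using K by (intro mult_left_mono) auto
        then have "inv (Suc t) A B U'"
          using bar AH AB B1 c' dom' pot unfolding inv_def by auto
        then show ?thesis by blast
      next
        case False
        define A' where "A' = A(i := B i)"
        define U'' where "U'' = U' - layer i"
        have A'1: "A' j \<le> B j" if "j \<le> H" for j using AB that by (simp add: A'_def)
        have AA': "A j \<le> A' j" for j using AB iH by (simp add: A'_def)
        have A'H: "A' H = 1" "B H = 1" using AH bar iH by (auto simp: A'_def barrier_def)
        \<comment> \<open>The old \<open>B\<close> is a subsolution for the raised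
          \<open>A'\<close>, so the new barrier lies above it and earlier bounds persist.\<close>
        obtain B' where B': "barrier A' B'" "\<And>j. j \<le> H \<Longrightarrow> B j \<le> B' j" "\<And>j. j \<le> H \<Longrightarrow> B' j \<le> 1"
        proof (rule barrier_exists[of B A'])
          fix k assume k: "k < H"
          then have "tot k * B k = (\<Sum>j\<le>H. cond k j * ((A j + B j) / 2))" using bar by (simp add: barrier_def)
          also have "\<dots> \<le> (\<Sum>j\<le>H. cond k j * ((A' j + B j) / 2))"
            using AA' by (intro sum_mono mult_left_mono c_nonneg) auto
          finally show "tot k * B k \<le> (\<Sum>j\<le>H. cond k j * ((A' j + B j) / 2))" .
        next
          show "A' k \<le> 1" if "k \<le> H" for k using A'1[OF that] B1[OF that] by linarith
        qed (use tot_pos A'H B1 in auto)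
        have U''other: "U'' \<inter> layer j = U \<inter> layer j" if "j \<noteq> i" for j
          using U'other[OF that] that by (auto simp: U''_def layer_def)
        have U''i: "U'' \<inter> layer i = {}" by (auto simp: U''_def)
        have dom'': "dominated A' B' U'' (fs (Suc t))"
          unfolding dominated_def
        proof (intro conjI ballI impI)
          fix u assume u: "u \<in> V" "lay u < H"
          have "fs (Suc t) u \<le> (if u \<in> U' then B (lay u) else A (lay u))" using dom' u by (auto simp: dominated_def)
          moreover have "B (lay u) \<le> B' (lay u)" "A (lay u) \<le> A' (lay u)" "A (lay u) \<le> B (lay u)"
            using B' u AB AA' by auto
          ultimately show "fs (Suc t) u \<le> (if u \<in> U'' then B' (lay u) else A' (lay u))"
            using u by (auto simp: U''_def layer_def A'_def split: if_splits)
        qed (use le1 in auto)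
        have c'': "\<forall>j<H. card (U'' \<inter> layer j) \<le> \<epsilon> * width j"
          using cU U''other U''i \<epsilon> by (metis card.empty mult_nonneg_nonneg of_nat_0 of_nat_0_le_iff less_imp_le)
        define e where "e = B i - A i"
        have Psi': "Psi A' B' \<le> Psi A B - tot i * e\<^sup>2 / 4"
        proof -
          have "Psi A' B' \<le> Psi A' B" using B' A'H by (intro Psi_min) (auto simp: barrier_def)
          also have "\<dots> \<le> Psi A B - tot i * e\<^sup>2 / 4"
            unfolding A'_def e_def by (rule Psi_raise[OF bar AB iH])
          finally show ?thesis .
        qed
        have "(\<Sum>j\<in>I. A' j) \<le> K1 * (Q - Psi A' B') + K2 * (Suc t - (\<Sum>j\<in>I. real (card (U'' \<inter> layer j))))"
        proof (cases "i \<in> I")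
          case iI: True
          have s1: "(\<Sum>j\<in>I. A' j) = (\<Sum>j\<in>I. A j) + e"
            using finI iI sum.remove[of I i A] sum.remove[of I i A'] by (simp add: A'_def e_def)
          have s2: "(\<Sum>j\<in>I. real (card (U'' \<inter> layer j))) = (\<Sum>j\<in>I. real (card (U \<inter> layer j))) - real (card (U \<inter> layer i))"
            unfolding split_I[of U''] split_I[of U] using iI U''i U''other by simp
          have e1: "a * e\<^sup>2 \<le> K1 * (Psi A B - Psi A' B')"
          proof -
            have "a * e\<^sup>2 = K1 * (c0 * e\<^sup>2 / 4)" using pos by (simp add: K1_def)
            also have "\<dots> \<le> K1 * (tot i * e\<^sup>2 / 4)"
              using K I(4)[OF iI] by (intro mult_left_mono divide_right_mono mult_right_mono) auto
            also have "\<dots> \<le> K1 * (Psi A B - Psi A' B')" using Psi' K by (intro mult_left_mono) auto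
            finally show ?thesis .
          qed
          \<comment> \<open>The step that triggers the rise is the extra 1: with it the layer
            exceeds the fraction \<epsilon> of its width, hence \<epsilon> m.\<close>
          have e2: "1 / (4 * a) \<le> K2 * (1 + real (card (U \<inter> layer i)))"
          proof -
            have "\<epsilon> * m \<le> \<epsilon> * width i" using I(3)[OF iI] \<epsilon> by (intro mult_left_mono) auto
            also have "\<dots> \<le> 1 + real (card (U \<inter> layer i))" using False cardU' by linarith
            finally have "K2 * (\<epsilon> * m) \<le> K2 * (1 + real (card (U \<inter> layer i)))" using K by (intro mult_left_mono) auto
            then show ?thesis using pos \<epsilon> a0 by (simp add: K2_def)
          qed
          have e3: "e \<le> a * e\<^sup>2 + 1 / (4 * a)"
          proof -
            have "0 \<le> (2 * a * e - 1)\<^sup>2 / (4 * a)" using a0 by simp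
            also have "\<dots> = a * e\<^sup>2 - e + 1 / (4 * a)" using a0 by (simp add: power2_eq_square field_simps)
            finally show ?thesis by simp
          qed
          show ?thesis unfolding s1 s2 using pot e1 e2 e3 by (simp add: algebra_simps)
        next
          case False
          have sA: "(\<Sum>j\<in>I. A' j) = (\<Sum>j\<in>I. A j)" using False by (intro sum.cong) (auto simp: A'_def)
          have sU: "(\<Sum>j\<in>I. real (card (U'' \<inter> layer j))) = (\<Sum>j\<in>I. real (card (U \<inter> layer j)))"
            using False U''other by (intro sum.cong refl) metis
          have k1: "K1 * (Q - Psi A B) \<le> K1 * (Q - Psi A' B')"
          proof -
            have "0 \<le> tot i * e\<^sup>2 / 4" using tot_pos[OF iH] by simp
            then show ?thesis using Psi' K by (intro mult_left_mono) auto
          qed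
          have "K2 * (t - X) \<le> K2 * (Suc t - X)" for X :: real using K by (intro mult_left_mono) auto
          then show ?thesis unfolding sA sU using pot k1 by (meson add_mono order.trans)
        qed
        then have "inv (Suc t) A' B' U''"
          unfolding inv_def using B' A'H A'1 c'' dom'' by (meson order.trans)
        then show ?thesis by blast
      qed
    qed
  qed
  then obtain A B U where inv: "inv T A B U" by blast
  have "1 / 5 \<le> A i" if i: "i \<in> I" for i
  proof -
    have iH: "i < H" using i I by auto
    have "real (card (U \<inter> layer i)) < width i"
    proof -
      have "real (card (U \<inter> layer i)) \<le> \<epsilon> * width i" using inv iH by (simp add: inv_def)
      also have "\<dots> < 1 * real (width i)" using \<epsilon> width_pos[of i] iH by (intro mult_strict_right_mono) auto
      finally show ?thesis by simp
    qed
    \<comment> \<open>As \<epsilon> < 1, some vertex of the layer is unmarked; its value is bounded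
      by \<open>A i\<close> and at least 1/5 by \<open>high\<close>.\<close>
    then have "\<not> layer i \<subseteq> U" by (auto simp: width_def Int_absorb1)
    then obtain v where "v \<in> V" "lay v = i" "v \<notin> U" by (auto simp: layer_def)
    then show ?thesis using inv iH high[of v] i by (force simp: inv_def dominated_def)
  qed
  then have "(\<Sum>i\<in>I. 1 / 5) \<le> (\<Sum>i\<in>I. A i)" by (intro sum_mono) auto
  also have "\<dots> \<le> K1 * (Q - Psi A B) + K2 * (T - (\<Sum>i\<in>I. real (card (U \<inter> layer i))))"
    using inv by (simp add: inv_def)
  also have "\<dots> \<le> K1 * Q + K2 * T"
    using K Psi_nonneg[of A B] by (intro add_mono mult_left_mono) (auto simp: sum_nonneg)
  finally have "card I / 5 \<le> K1 * Q + K2 * T" by simp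
  moreover have "K1 * Q = card I / 10" using pos by (simp add: K1_def a_def)
  ultimately have "card I / 10 \<le> K2 * T" by simp
  then have "card I / 10 * (4 * a * \<epsilon> * m) \<le> T"
    using a0 \<epsilon> pos by (simp add: K2_def field_simps)
  moreover have "card I / 10 * (4 * a * \<epsilon> * m) = \<epsilon> * real m * c0 * (real (card I))\<^sup>2 / (100 * Q)"
    using pos by (simp add: a_def power2_eq_square field_simps)
  ultimately show ?thesis by linarith
qed

end

text \<open>Zero on the layers below \<open>h\<close>, linear on the path of the \<open>L\<close>
  layers h, ..., h + L - 1, and one beyond: the voltage of a unit drop over the path.\<close>

definition taper :: "nat \<Rightarrow> nat \<Rightarrow> nat \<Rightarrow> real" where
  "taper h L i = (if i < h then 0 else min 1 (real (i - h) / real (L - 1)))"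

lemma taper_bounds: "0 \<le> taper h L i" "taper h L i \<le> 1"
  by (auto simp: taper_def)

lemma taper_linear: "h \<le> i \<Longrightarrow> i \<le> h + L - 1 \<Longrightarrow> 2 \<le> L \<Longrightarrow> taper h L i = real (i - h) / real (L - 1)"
  by (auto simp: taper_def min_def field_simps)

text \<open>The dumbbell read from the other end sees the profile 1 - f, so one estimate serves both
  bells.\<close>

lemma taper_reflect:
  assumes "2 \<le> L" "i \<le> 2 * h + L - 1"
  shows "taper h L (2 * h + L - 1 - i) = 1 - taper h L i"
proof -
  consider "i < h" | "h \<le> i" "i \<le> h + L - 1" | "h + L - 1 < i" by linarith
  then show ?thesis
  proof cases
    case 1
    then have "1 \<le> real (2 * h + L - 1 - i - h) / real (L - 1)" using assms by (simp add: field_simps)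
    then show ?thesis using 1 assms by (simp add: taper_def)
  next
    case 2
    then have t1: "taper h L (2 * h + L - 1 - i) = real (2 * h + L - 1 - i - h) / real (L - 1)"
      using assms by (intro taper_linear) auto
    have t2: "taper h L i = real (i - h) / real (L - 1)" using 2 assms by (intro taper_linear) auto
    have e: "real (2 * h + L - 1 - i - h) = real (L - 1) - real (i - h)" using 2 assms by linarith
    have "(l - b) / l = 1 - b / l" if "l \<noteq> 0" for l b :: real using that by (simp add: diff_divide_distrib)
    moreover have "real (L - 1) \<noteq> 0" using assms by simp
    ultimately show ?thesis unfolding t1 t2 e by blast
  next
    case 3
    then have "1 \<le> real (i - h) / real (L - 1)" using assms by (simp add: field_simps)
    then show ?thesis using 3 assms by (auto simp: taper_def)
  qed
qed

text \<open>The taper is a subsolution: up to layer \<open>h\<close> it is zero with nonnegative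
  neighbours, and beyond it is linear with unit conductances.\<close>

lemma (in layered) slow_taper:
  fixes fs :: "nat \<Rightarrow> 'a \<Rightarrow> real" and \<epsilon> c0 :: real
  assumes \<epsilon>: "0 < \<epsilon>" "\<epsilon> < 1"
    and dbl: "\<And>s e. 0 \<le> e \<Longrightarrow> phi r (s - e / 2) \<le> (1 - \<epsilon>) * phi r s + \<epsilon> * phi r (s - e)"
    and step: "\<And>t. \<exists>v\<in>V. \<exists>y. fs (Suc t) = (fs t)(v := y) \<and> (\<Sum>u\<in>nbrs v. phi r (y - fs t u)) = 0"
    and le1: "\<And>t v. v \<in> V \<Longrightarrow> fs t v \<le> 1"
    and H: "H = h + L - 1" "1 \<le> h" "2 \<le> L"
    and narrow: "\<And>i. h \<le> i \<Longrightarrow> i \<le> H \<Longrightarrow> width i = 1"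
    and init: "\<And>v. v \<in> V \<Longrightarrow> fs 0 v \<le> taper h L (lay v)"
    and I: "I \<subseteq> {..<h}" "I \<noteq> {}" "\<And>i. i \<in> I \<Longrightarrow> m \<le> width i" "\<And>i. i \<in> I \<Longrightarrow> \<exists>j\<in>near i. c0 \<le> \<mu> i * \<mu> j"
    and pos: "0 < m" "0 < c0"
    and high: "\<And>v. v \<in> V \<Longrightarrow> lay v \<in> I \<Longrightarrow> 1 / 5 \<le> fs T v"
  shows "\<epsilon> * real m * c0 * (real (card I))\<^sup>2 * real (L - 1) / 200 \<le> T"
proof -
  let ?g = "taper h L"
  define l where "l = real (L - 1)"
  have l0: "0 < l" using H by (simp add: l_def)
  have \<mu>1: "\<mu> i = 1" if "h \<le> i" "i \<le> H" for i using narrow[OF that] by (simp add: \<mu>_def)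
  have sub: "tot i * ?g i \<le> (\<Sum>j\<le>H. cond i j * ?g j)" if i: "i < H" for i
  proof -
    have "tot i * ?g i = (\<Sum>j\<le>H. cond i j * ?g i)" by (simp add: tot_def sum_distrib_right)
    also have "\<dots> = \<mu> i * (\<Sum>j\<in>near i. \<mu> j * ?g i)" using i by (rule sum_cond)
    also have "\<dots> \<le> \<mu> i * (\<Sum>j\<in>near i. \<mu> j * ?g j)"
    proof (intro mult_left_mono)
      show "(\<Sum>j\<in>near i. \<mu> j * ?g i) \<le> (\<Sum>j\<in>near i. \<mu> j * ?g j)"
      proof (cases "i \<le> h")
        case True
        then have "?g i = 0" by (auto simp: taper_def)
        then show ?thesis by (auto intro!: sum_nonneg mult_nonneg_nonneg taper_bounds simp: \<mu>_def)
      next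
        case False
        then have "?g (i - 1) + ?g (i + 1) = 2 * ?g i"
        proof -
          have "?g (i - 1) = real (i - 1 - h) / l" "?g (i + 1) = real (i + 1 - h) / l" "?g i = real (i - h) / l"
            unfolding l_def by (rule taper_linear; use i H False in simp)+
          moreover have "real (i - 1 - h) + real (i + 1 - h) = 2 * real (i - h)" using False by linarith
          ultimately show ?thesis by (simp only: add_divide_distrib[symmetric] times_divide_eq_right)
        qed
        then show ?thesis using \<mu>1[of "i - 1"] \<mu>1[of "i + 1"] i False by (simp add: sum_near)
      qed
    qed (simp add: \<mu>_def)
    also have "\<dots> = (\<Sum>j\<le>H. cond i j * ?g j)" by (rule sum_cond[OF i, symmetric])
    finally show ?thesis .
  qed
  \<comment> \<open>The L - 1 path edges carry a difference 1 / l each, all others none; the 2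
    counts ordered pairs.\<close>
  have Q: "(\<Sum>i\<le>H. \<Sum>j\<le>H. cond i j * (?g i - ?g j)\<^sup>2) \<le> 2 / l"
  proof -
    have diff: "?g (Suc i) - ?g i = 1 / l" if "h \<le> i" "i < H" for i
      using that H by (subst (1 2) taper_linear) (auto simp: l_def diff_divide_distrib[symmetric])
    have zero: "?g (Suc i) - ?g i = 0" if "\<not> h \<le> i" for i
      using that by (auto simp: taper_def)
    have up: "cond i (Suc i) * (?g i - ?g (Suc i))\<^sup>2 = (if h \<le> i then 1 / l\<^sup>2 else 0)" if "i < H" for i
    proof (cases "h \<le> i")
      case True
      have "(?g i - ?g (Suc i))\<^sup>2 = (?g (Suc i) - ?g i)\<^sup>2" by (rule power2_commute)
      then show ?thesis using True that \<mu>1[of i] \<mu>1[of "Suc i"] diff[of i]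
        by (simp add: cond_def near_def power_divide)
    next
      case False
      then have "?g i - ?g (Suc i) = 0" using zero[OF False] by simp
      then show ?thesis using False by simp
    qed
    have "(\<Sum>i\<le>H. \<Sum>j\<le>H. cond i j * (?g i - ?g j)\<^sup>2)
       = (\<Sum>i\<le>H. \<Sum>j\<le>H. (if j = Suc i then cond i j * (?g i - ?g j)\<^sup>2 else 0)
            + (if i = Suc j then cond j i * (?g j - ?g i)\<^sup>2 else 0))"
      by (intro sum.cong refl) (auto simp: cond_def near_def power2_commute mult.commute)
    also have "\<dots> = 2 * (\<Sum>i\<le>H. \<Sum>j\<le>H. if j = Suc i then cond i j * (?g i - ?g j)\<^sup>2 else 0)"
      unfolding sum.distrib
      by (subst (2) sum.swap) simp
    also have "(\<Sum>i\<le>H. \<Sum>j\<le>H. if j = Suc i then cond i j * (?g i - ?g j)\<^sup>2 else 0)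
       = (\<Sum>i\<le>H. if i < H then cond i (Suc i) * (?g i - ?g (Suc i))\<^sup>2 else 0)"
      by (intro sum.cong refl) (auto simp: sum.delta)
    also have "\<dots> = (\<Sum>i\<le>H. if i \<in> {h..<H} then 1 / l\<^sup>2 else 0)"
      using up by (intro sum.cong refl) auto
    also have "\<dots> = (\<Sum>i\<in>{h..<H}. 1 / l\<^sup>2)"
    proof -
      have "{..H} \<inter> {h..<H} = {h..<H}" by auto
      then show ?thesis by (subst sum.inter_restrict[symmetric]) (simp_all only: finite_atMost)
    qed
    also have "\<dots> = l * (1 / l\<^sup>2)" using H by (simp add: l_def)
    also have "2 * \<dots> = 2 / l" using l0 by (simp add: power2_eq_square)
    finally show ?thesis by simp
  qed
  have "\<epsilon> * real m * c0 * (real (card I))\<^sup>2 / (100 * (2 / l)) \<le> T"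
  proof (rule slow_rise[OF \<epsilon> dbl step le1 _ _ sub _ _ _ _ _ pos _ I(2) Q high])
    show "?g H = 1" using H l0 by (subst taper_linear) (auto simp: l_def)
    show "fs 0 v \<le> ?g (lay v)" if "v \<in> V" for v using init[OF that] .
    show "I \<subseteq> {..<H}" using I H by auto
    show "?g i = 0" if "i \<in> I" for i using that I by (auto simp: taper_def)
    show "c0 \<le> tot i" if i: "i \<in> I" for i
    proof -
      obtain j where "j \<in> near i" "c0 \<le> \<mu> i * \<mu> j" using I(4)[OF i] by blast
      moreover have "i < H" using i I H by auto
      ultimately show ?thesis using tot_ge[of i j] by linarith
    qed
  qed (use taper_bounds I l0 in auto)
  then show ?thesis using l0 by (simp add: l_def)
qed

section \<open>Graphs with prescribed layer widths\<close>

definition lev :: "nat \<Rightarrow> nat" where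
  "lev v = fst (prod_decode v)"

text \<open>The k-th vertex of layer \<open>i\<close> is the natural number encoding (i, k).\<close>

definition layered_graph :: "nat \<Rightarrow> (nat \<Rightarrow> nat) \<Rightarrow> nat pair_pre_digraph" where
  "layered_graph M W = (let V = prod_encode ` (SIGMA i:{..M}. {..<W i}) in
    \<lparr> pverts = V, parcs = {(u, v). u \<in> V \<and> v \<in> V \<and> (lev v = Suc (lev u) \<or> lev u = Suc (lev v))} \<rparr>)"

locale layered_graph_params =
  fixes M :: nat and W :: "nat \<Rightarrow> nat"
  assumes M: "1 \<le> M" and W: "\<And>i. i \<le> M \<Longrightarrow> 0 < W i"
begin

abbreviation "G \<equiv> layered_graph M W"

lemma parcs_G: "(u, v) \<in> parcs G \<longleftrightarrow> u \<in> pverts G \<and> v \<in> pverts G \<and> (lev v = Suc (lev u) \<or> lev u = Suc (lev v))"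
  by (auto simp: layered_graph_def Let_def)

lemma pverts_G: "pverts G = prod_encode ` (SIGMA i:{..M}. {..<W i})"
  by (simp add: layered_graph_def Let_def)

lemma finite_G: "finite (pverts G)"
  by (simp add: pverts_G)

lemma card_G: "card (pverts G) = (\<Sum>i\<le>M. W i)"
  unfolding pverts_G by (subst card_image) (auto intro: inj_on_subset[OF inj_prod_encode])

lemma lev_le: "v \<in> pverts G \<Longrightarrow> lev v \<le> M"
  by (auto simp: pverts_G lev_def)

lemma card_level:
  assumes "i \<le> M"
  shows "card {v\<in>pverts G. lev v = i} = W i"
proof -
  have "{v\<in>pverts G. lev v = i} = prod_encode ` ({i} \<times> {..<W i})"
    using assms by (auto simp: pverts_G lev_def)
  moreover have "card (prod_encode ` ({i} \<times> {..<W i})) = W i"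
    by (subst card_image) (auto intro: inj_on_subset[OF inj_prod_encode] simp: card_cartesian_product)
  ultimately show ?thesis by simp
qed

lemma level_nonempty: "i \<le> M \<Longrightarrow> \<exists>v\<in>pverts G. lev v = i"
  using card_level[of i] W[of i] by (metis (mono_tags, lifting) card.empty empty_Collect_eq less_irrefl)

lemma pair_graph_G: "pair_graph G"
proof unfold_locales
  show "finite (parcs G)"
    by (rule finite_subset[of _ "pverts G \<times> pverts G"]) (auto simp: finite_G parcs_G)
  show "symmetric (with_proj G)"
    by (auto simp: symmetric_def sym_def parcs_G)
qed (auto simp: finite_G parcs_G)

text \<open>Every vertex descends to layer 0 and from there reaches a fixed vertex \<open>b\<close>
  of layer 1; layer 0 itself has no edges, so \<open>b\<close> cannot be taken there.\<close>

lemma connected_G: "Digraph_Component.connected (with_proj G)"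
proof -
  interpret pair_graph G by (rule pair_graph_G)
  let ?R = "\<lambda>u v. u \<rightarrow>\<^sup>*\<^bsub>with_proj G\<^esub> v"
  have adj: "?R u v" if "u \<in> pverts G" "v \<in> pverts G" "lev v = Suc (lev u) \<or> lev u = Suc (lev v)" for u v
    using that by (intro reachable_adjI) (simp add: parcs_G)
  obtain a where a: "a \<in> pverts G" "lev a = 0" using level_nonempty[of 0] by auto
  obtain b where b: "b \<in> pverts G" "lev b = 1" using level_nonempty[of 1] M by auto
  have to_b: "?R v b" if "v \<in> pverts G" "lev v = i" for v i
    using that
  proof (induction i arbitrary: v)
    case 0
    then show ?case using b by (intro adj) auto
  next
    case (Suc i)
    obtain u where u: "u \<in> pverts G" "lev u = i"
      using level_nonempty[of i] lev_le[OF Suc.prems(1)] Suc.prems by auto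
    then have "?R v u" using Suc.prems by (intro adj) auto
    then show ?case using Suc.IH[OF u] by (rule reachable_trans)
  qed
  have "?R u v" if "u \<in> pverts G" "v \<in> pverts G" for u v
    using to_b[OF that(1) refl] symmetric_reachable[OF pair_sym_arcs to_b[OF that(2) refl]]
    by (rule reachable_trans)
  then have "?R u v \<and> ?R v u" if "u \<in> pverts G" "v \<in> pverts G" for u v using that by blast
  then show ?thesis
    using a unfolding Digraph_Component.connected_def
    by (intro strongly_connectedI) (auto intro: reachable_mk_symmetricI)
qed

lemma card_arcs_le: "card (parcs G) \<le> 2 * (\<Sum>i<M. W i * W (Suc i))"
proof -
  define L where "L i = {v\<in>pverts G. lev v = i}" for i
  have fL: "finite (L i)" for i using finite_G by (simp add: L_def)
  have cL: "card (L i) = W i" if "i \<le> M" for i using card_level[OF that] by (simp add: L_def)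
  have *: "card (\<Union>i<M. L (f i) \<times> L (g i)) \<le> (\<Sum>i<M. W (f i) * W (g i))"
    if "\<And>i. i < M \<Longrightarrow> f i \<le> M" "\<And>i. i < M \<Longrightarrow> g i \<le> M" for f g
    using card_UN_le[of "{..<M}" "\<lambda>i. L (f i) \<times> L (g i)"] that by (simp add: card_cartesian_product cL)
  have "parcs G \<subseteq> (\<Union>i<M. L i \<times> L (Suc i)) \<union> (\<Union>i<M. L (Suc i) \<times> L i)"
  proof
    fix e assume "e \<in> parcs G"
    then obtain u v where e: "e = (u, v)" "u \<in> pverts G" "v \<in> pverts G" "lev v = Suc (lev u) \<or> lev u = Suc (lev v)"
      using parcs_G by (metis prod.collapse)
    then have "lev u \<le> M" "lev v \<le> M" using lev_le by auto
    then have "(lev u < M \<and> v \<in> L (Suc (lev u))) \<or> (lev v < M \<and> u \<in> L (Suc (lev v)))" "u \<in> L (lev u)" "v \<in> L (lev v)"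
      using e by (auto simp: L_def)
    then show "e \<in> (\<Union>i<M. L i \<times> L (Suc i)) \<union> (\<Union>i<M. L (Suc i) \<times> L i)" using e(1) by blast
  qed
  then have "card (parcs G) \<le> card ((\<Union>i<M. L i \<times> L (Suc i)) \<union> (\<Union>i<M. L (Suc i) \<times> L i))"
    using fL by (intro card_mono) auto
  also have "\<dots> \<le> card (\<Union>i<M. L i \<times> L (Suc i)) + card (\<Union>i<M. L (Suc i) \<times> L i)" by (rule card_Un_le)
  also have "\<dots> \<le> (\<Sum>i<M. W i * W (Suc i)) + (\<Sum>i<M. W (Suc i) * W i)"
    using *[of id Suc] *[of Suc id] by (intro add_mono) auto
  finally show ?thesis by (simp add: mult.commute)
qed

lemma layered_lev:
  assumes "H \<le> M" "0 < r"
  shows "layered (pverts G) lev H r"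
  by standard (use finite_G level_nonempty assms in auto)

lemma layered_rev:
  assumes "H \<le> M" "0 < r"
  shows "layered (pverts G) (\<lambda>v. M - lev v) H r"
proof
  fix i assume "i \<le> H"
  then obtain v where "v \<in> pverts G" "lev v = M - i" using level_nonempty[of "M - i"] by auto
  then show "\<exists>v\<in>pverts G. M - lev v = i" using \<open>i \<le> H\<close> assms by force
qed (use finite_G assms in auto)

end

subsection \<open>Dumbbell graphs\<close>

lemma osc_ge:
  assumes "finite (pverts G)" "v \<in> pverts G" "w \<in> pverts G"
  shows "f v - f w \<le> osc G f"
proof -
  have "f v \<le> Max (f ` pverts G)" "Min (f ` pverts G) \<le> f w" using assms by auto
  then show ?thesis unfolding osc_def by linarith
qed

text \<open>Two mirror-image bells of \<open>h\<close> layers, joined by a path of \<open>L\<close>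
  single vertices; index 0 is the outer end of the left bell.\<close>

definition widths :: "nat \<Rightarrow> nat \<Rightarrow> (nat \<Rightarrow> nat) \<Rightarrow> nat \<Rightarrow> nat" where
  "widths h L wl i = (if i < h then wl i else if i < h + L then 1 else wl (2 * h + L - 1 - i))"

locale dumbbell_params =
  fixes h L :: nat and wl :: "nat \<Rightarrow> nat"
  assumes h: "1 \<le> h" and L: "2 \<le> L" and wl: "\<And>i. i < h \<Longrightarrow> 0 < wl i"
begin

definition M :: nat where
  "M = 2 * h + L - 1"

abbreviation "W \<equiv> widths h L wl"

sublocale layered_graph_params M W
  by standard (use h L wl in \<open>auto simp: widths_def M_def\<close>)

lemma widths_reflect: "i \<le> M \<Longrightarrow> W (M - i) = W i"
  using h L by (auto simp: widths_def M_def)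

lemma card_dumbbell: "card (pverts G) = 2 * (\<Sum>i<h. wl i) + L"
proof -
  have "{..M} = {..<h} \<union> ({h..<h + L} \<union> {h + L..M})" using h L by (auto simp: M_def)
  then have "(\<Sum>i\<le>M. W i) = (\<Sum>i\<in>{..<h} \<union> ({h..<h + L} \<union> {h + L..M}). W i)" by simp
  also have "\<dots> = (\<Sum>i<h. W i) + ((\<Sum>i\<in>{h..<h + L}. W i) + (\<Sum>i\<in>{h + L..M}. W i))"
    by (subst sum.union_disjoint, simp, simp, force, subst sum.union_disjoint) auto
  also have "(\<Sum>i<h. W i) = (\<Sum>i<h. wl i)" by (simp add: widths_def)
  also have "(\<Sum>i\<in>{h..<h + L}. W i) = L" by (simp add: widths_def)
  also have "(\<Sum>i\<in>{h + L..M}. W i) = (\<Sum>i<h. wl i)"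
    using h L by (intro sum.reindex_bij_witness[of _ "\<lambda>i. M - i" "\<lambda>i. M - i"]) (auto simp: widths_def M_def)
  finally show ?thesis by (simp add: card_G)
qed

lemma card_ge_2: "2 \<le> card (pverts G)"
  using card_dumbbell L by simp

lemma avg_degree_le_if:
  assumes "real (\<Sum>i<M. W i * W (Suc i)) \<le> a * real (\<Sum>i\<le>M. W i)"
  shows "avg_degree G \<le> 2 * a"
proof -
  interpret F: finite_connected G
    by (rule finite_connected_if_pair_graph[OF pair_graph_G connected_G card_ge_2])
  have "card (pverts G) * avg_degree G = real (card (parcs G))" by (rule F.card_E[symmetric])
  also have "\<dots> \<le> real (2 * (\<Sum>i<M. W i * W (Suc i)))" using card_arcs_le by (simp only: of_nat_le_iff)
  also have "\<dots> \<le> card (pverts G) * (2 * a)" using assms by (simp add: card_G algebra_simps)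
  finally show ?thesis using card_ge_2 by simp
qed

text \<open>All inner layers are single vertices, so there are no more edges than vertices. This
  covers degrees D near 2, where the bound 4 d of \<open>avg_degree_dense\<close> is too
  weak.\<close>

lemma avg_degree_tree:
  assumes "\<And>i. 0 < i \<Longrightarrow> i < M \<Longrightarrow> W i = 1"
  shows "avg_degree G \<le> 2"
proof -
  have M2: "2 \<le> M" using h L by (simp add: M_def)
  then have "(\<Sum>i<M. W i * W (Suc i)) = (\<Sum>i<Suc (M - 1). W i * W (Suc i))" by simp
  also have "\<dots> = (\<Sum>i<M - 1. W i * W (Suc i)) + W (M - 1) * W M"
    by (simp only: sum.lessThan_Suc) (use M2 in simp)
  also have "(\<Sum>i<M - 1. W i * W (Suc i)) = (\<Sum>i<M - 1. W i)"
    using assms by (intro sum.cong refl) auto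
  also have "W (M - 1) * W M = W M" using assms[of "M - 1"] M2 by simp
  also have "(\<Sum>i<M - 1. W i) + W M \<le> (\<Sum>i<M. W i) + W M" by (intro add_right_mono sum_mono2) auto
  also have "\<dots> = (\<Sum>i\<le>M. W i)" by (simp add: lessThan_Suc_atMost[symmetric])
  finally have "real (\<Sum>i<M. W i * W (Suc i)) \<le> 1 * real (\<Sum>i\<le>M. W i)" by (simp only: of_nat_le_iff mult_1)
  from avg_degree_le_if[OF this] show ?thesis by simp
qed

lemma avg_degree_dense:
  assumes "\<And>i. i < M \<Longrightarrow> W i * W (Suc i) \<le> d * (W i + W (Suc i))"
  shows "avg_degree G \<le> 4 * real d"
proof -
  have "(\<Sum>i<M. W i * W (Suc i)) \<le> (\<Sum>i<M. d * (W i + W (Suc i)))"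
    using assms by (intro sum_mono) auto
  also have "\<dots> = d * ((\<Sum>i<M. W i) + (\<Sum>i<M. W (Suc i)))"
    by (simp add: sum_distrib_left[symmetric] sum.distrib)
  also have "(\<Sum>i<M. W i) \<le> (\<Sum>i\<le>M. W i)" by (intro sum_mono2) auto
  also have "(\<Sum>i<M. W (Suc i)) \<le> (\<Sum>i\<le>M. W i)"
    by (simp only: lessThan_Suc_atMost[symmetric] sum.lessThan_Suc_shift)
  finally have "(\<Sum>i<M. W i * W (Suc i)) \<le> 2 * d * (\<Sum>i\<le>M. W i)" by (simp add: algebra_simps)
  then have "real (\<Sum>i<M. W i * W (Suc i)) \<le> real (2 * d * (\<Sum>i\<le>M. W i))" by (simp only: of_nat_le_iff)
  also have "\<dots> = (2 * real d) * real (\<Sum>i\<le>M. W i)" by simp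
  finally show ?thesis using avg_degree_le_if[of "2 * real d"] by simp
qed

definition f0 :: "nat \<Rightarrow> real" where
  "f0 v = taper h L (lev v)"

lemma f0_bounds: "f0 \<in> pverts G \<rightarrow> {0..1}"
  using taper_bounds by (auto simp: f0_def)

lemma profile_dumbbell:
  assumes p: "1 < p" and \<omega>: "\<And>t. \<omega> t \<in> pverts G"
  defines "fs \<equiv> profile p G f0 \<omega>"
  shows profile_step: "\<exists>y. fs (Suc t) = (fs t)(\<omega> t := y) \<and> (\<Sum>u | (\<omega> t, u) \<in> parcs G. phi (p - 1) (y - fs t u)) = 0"
    and profile_bounds: "v \<in> pverts G \<Longrightarrow> 0 \<le> fs t v \<and> fs t v \<le> 1"
proof -
  interpret F: finite_connected G
    by (rule finite_connected_if_pair_graph[OF pair_graph_G connected_G card_ge_2])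
  have ne: "finite {u. (\<omega> t, u) \<in> parcs G}" "{u. (\<omega> t, u) \<in> parcs G} \<noteq> {}" for t
    using F.finite_N F.N_nonempty[OF \<omega>] by auto
  show "\<exists>y. fs (Suc t) = (fs t)(\<omega> t := y) \<and> (\<Sum>u | (\<omega> t, u) \<in> parcs G. phi (p - 1) (y - fs t u)) = 0" for t
    using lp_mean_balance[OF p ne[of t], of "fs t"] by (auto simp: fs_def update_def)
  show "0 \<le> fs t v \<and> fs t v \<le> 1" if "v \<in> pverts G" for v
    using that
  proof (induction t arbitrary: v)
    case 0
    then show ?case using taper_bounds by (simp add: fs_def f0_def)
  next
    case (Suc t)
    have nb: "0 \<le> fs t u \<and> fs t u \<le> 1" if "(\<omega> t, u) \<in> parcs G" for u
      using Suc.IH F.arcD[OF that] by blast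
    let ?y = "arg_min (\<lambda>y. \<Sum>w | (\<omega> t, w) \<in> parcs G. \<bar>fs t w - y\<bar> powr p) (\<lambda>_. True)"
    have "?y \<le> 1"
    proof (rule lp_mean_le[OF p ne])
      show "0 \<le> (\<Sum>w | (\<omega> t, w) \<in> parcs G. phi (p - 1) (1 - fs t w))"
        using nb by (intro sum_nonneg) (auto simp: phi_nonneg)
    qed
    moreover have "0 \<le> ?y"
    proof (rule lp_mean_ge[OF p ne])
      show "(\<Sum>w | (\<omega> t, w) \<in> parcs G. phi (p - 1) (0 - fs t w)) \<le> 0"
        using nb by (intro sum_nonpos) (auto simp: phi_nonpos)
    qed
    moreover have "fs (Suc t) = (fs t)(\<omega> t := ?y)" by (simp add: fs_def update_def)
    ultimately show ?case using Suc by auto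
  qed
qed

text \<open>The contrapositive of \<open>slow_taper\<close>, for an abstract layer map and sequence,
  so that it applies to the profile as well as to the reflected profile on the reversed
  layers.\<close>

lemma low_vertex:
  fixes lay :: "nat \<Rightarrow> nat" and \<epsilon> c0 :: real
  assumes p: "1 < p" and \<epsilon>: "0 < \<epsilon>" "\<epsilon> < 1"
    and dbl: "\<And>s e. 0 \<le> e \<Longrightarrow> phi (p - 1) (s - e / 2) \<le> (1 - \<epsilon>) * phi (p - 1) s + \<epsilon> * phi (p - 1) (s - e)"
    and lay: "layered (pverts G) lay (h + L - 1) (p - 1)"
      "\<And>i. i \<le> h + L - 1 \<Longrightarrow> card {v\<in>pverts G. lay v = i} = W i"
      "\<And>u v. u \<in> pverts G \<Longrightarrow> v \<in> pverts G \<Longrightarrow> (u, v) \<in> parcs G \<longleftrightarrow> lay v = Suc (lay u) \<or> lay u = Suc (lay v)"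
    and step: "\<And>t. \<exists>v\<in>pverts G. \<exists>y. fs (Suc t) = (fs t)(v := y) \<and> (\<Sum>u | (v, u) \<in> parcs G. phi (p - 1) (y - fs t u)) = 0"
    and le1: "\<And>t v. v \<in> pverts G \<Longrightarrow> fs t v \<le> 1"
    and init: "\<And>v. v \<in> pverts G \<Longrightarrow> fs 0 v = taper h L (lay v)"
    and I: "I \<subseteq> {..<h}" "I \<noteq> {}" "\<And>i. i \<in> I \<Longrightarrow> m \<le> W i"
      "\<And>i. i \<in> I \<Longrightarrow> \<exists>j\<le>h + L - 1. (j = Suc i \<or> i = Suc j) \<and> c0 \<le> (real (W i) * real (W j)) powr (1 / (p - 1))"
    and pos: "0 < m" "0 < c0"
    and T: "T < \<epsilon> * real m * c0 * (real (card I))\<^sup>2 * real (L - 1) / 200"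
  shows "\<exists>v\<in>pverts G. fs T v < 1 / 5"
proof (rule ccontr)
  assume no: "\<not> ?thesis"
  interpret A: layered "pverts G" lay "h + L - 1" "p - 1" by (rule lay(1))
  have width: "A.width i = W i" if "i \<le> h + L - 1" for i
    using lay(2)[OF that] by (simp add: A.width_def A.layer_def)
  have nbrs: "A.nbrs v = {u. (v, u) \<in> parcs G}" if "v \<in> pverts G" for v
    using lay(3)[OF that] parcs_G[of v] by (auto simp: A.nbrs_def A.near_def)
  have "\<epsilon> * real m * c0 * (real (card I))\<^sup>2 * real (L - 1) / 200 \<le> T"
  proof (rule A.slow_taper[OF \<epsilon> dbl _ le1 refl h L _ _ I(1,2) _ _ pos])
    show "\<exists>v\<in>pverts G. \<exists>y. fs (Suc t) = (fs t)(v := y) \<and> (\<Sum>u\<in>A.nbrs v. phi (p - 1) (y - fs t u)) = 0" for t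
      using step[of t] nbrs by metis
    show "A.width i = 1" if "h \<le> i" "i \<le> h + L - 1" for i
      using that L by (subst width) (auto simp: widths_def)
    show "m \<le> A.width i" if "i \<in> I" for i
      using I(3)[OF that] I(1) that by (subst width) auto
    show "\<exists>j\<in>A.near i. c0 \<le> A.\<mu> i * A.\<mu> j" if i: "i \<in> I" for i
    proof -
      obtain j where j: "j \<le> h + L - 1" "j = Suc i \<or> i = Suc j" "c0 \<le> (real (W i) * real (W j)) powr (1 / (p - 1))"
        using I(4)[OF i] by blast
      moreover have "i \<le> h + L - 1" using i I(1) by auto
      ultimately have "c0 \<le> A.\<mu> i * A.\<mu> j" by (simp add: A.\<mu>_def width powr_mult)
      then show ?thesis using j by (auto simp: A.near_def)
    qed
  qed (use no init in \<open>auto simp: not_less\<close>)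
  then show False using T by linarith
qed

text \<open>Before the given time one vertex is below 1/5 and, by reflection, another above 4/5,
  which exceeds an oscillation of 1/2. The bound holds for each single sequence \<omega>.\<close>

lemma consensus_time_ge:
  fixes \<epsilon> c0 :: real
  assumes p: "1 < p" and \<epsilon>: "0 < \<epsilon>" "\<epsilon> < 1"
    and dbl: "\<And>s e. 0 \<le> e \<Longrightarrow> phi (p - 1) (s - e / 2) \<le> (1 - \<epsilon>) * phi (p - 1) s + \<epsilon> * phi (p - 1) (s - e)"
    and \<omega>: "\<And>t. \<omega> t \<in> pverts G"
    and I: "I \<subseteq> {..<h}" "I \<noteq> {}" "\<And>i. i \<in> I \<Longrightarrow> m \<le> W i"
      "\<And>i. i \<in> I \<Longrightarrow> \<exists>j\<le>h + L - 1. (j = Suc i \<or> i = Suc j) \<and> c0 \<le> (real (W i) * real (W j)) powr (1 / (p - 1))"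
    and pos: "0 < m" "0 < c0"
  shows "ennreal (\<epsilon> * real m * c0 * (real (card I))\<^sup>2 * real (L - 1) / 200) \<le> consensus_time p G f0 (1 / 2) \<omega>"
proof -
  define X where "X = \<epsilon> * real m * c0 * (real (card I))\<^sup>2 * real (L - 1) / 200"
  define fs where "fs = profile p G f0 \<omega>"
  note step = profile_step[where \<omega> = \<omega>, OF p \<omega>, folded fs_def] and bounds = profile_bounds[where \<omega> = \<omega>, OF p \<omega>, folded fs_def]
  have HM: "h + L - 1 \<le> M" by (simp add: M_def)
  have "X \<le> T" if osc: "osc G (fs T) \<le> 1 / 2" for T
  proof (rule ccontr)
    assume "\<not> X \<le> T"
    then have T: "T < \<epsilon> * real m * c0 * (real (card I))\<^sup>2 * real (L - 1) / 200" by (simp only: X_def not_le)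
    have "\<exists>v\<in>pverts G. fs T v < 1 / 5"
    proof (rule low_vertex[OF p \<epsilon> dbl layered_lev[OF HM] _ _ _ _ _ I pos T])
      show "card {v \<in> pverts G. lev v = i} = W i" if "i \<le> h + L - 1" for i
        using that HM by (intro card_level) simp
      show "fs 0 v = taper h L (lev v)" for v by (simp add: fs_def f0_def)
      show "\<exists>v\<in>pverts G. \<exists>y. fs (Suc t) = (fs t)(v := y) \<and> (\<Sum>u | (v, u) \<in> parcs G. phi (p - 1) (y - fs t u)) = 0" for t
        using step[of t] \<omega>[of t] by blast
      show "(u, v) \<in> parcs G \<longleftrightarrow> lev v = Suc (lev u) \<or> lev u = Suc (lev v)"
        if "u \<in> pverts G" "v \<in> pverts G" for u v
        using that parcs_G[of u v] by simp
      show "fs t v \<le> 1" if "v \<in> pverts G" for t v using bounds[OF that] by simp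
    qed (use p in auto)
    moreover have "\<exists>v\<in>pverts G. 1 - fs T v < 1 / 5"
    proof (rule low_vertex[where fs = "\<lambda>t v. 1 - fs t v", OF p \<epsilon> dbl layered_rev[OF HM] _ _ _ _ _ I pos T])
      show "card {v \<in> pverts G. M - lev v = i} = W i" if i: "i \<le> h + L - 1" for i
      proof -
        have "{v \<in> pverts G. M - lev v = i} = {v \<in> pverts G. lev v = M - i}"
        proof (rule Collect_cong, rule conj_cong[OF refl])
          fix v assume "v \<in> pverts G"
          then have "lev v \<le> M" by (rule lev_le)
          then show "M - lev v = i \<longleftrightarrow> lev v = M - i" using i HM by linarith
        qed
        then show ?thesis using i HM card_level[of "M - i"] widths_reflect[of i] by simp
      qed
      show "(u, v) \<in> parcs G \<longleftrightarrow> M - lev v = Suc (M - lev u) \<or> M - lev u = Suc (M - lev v)"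
        if "u \<in> pverts G" "v \<in> pverts G" for u v
      proof -
        have "lev u \<le> M" "lev v \<le> M" using that by (auto intro: lev_le)
        then have "M - lev v = Suc (M - lev u) \<longleftrightarrow> lev u = Suc (lev v)"
            "M - lev u = Suc (M - lev v) \<longleftrightarrow> lev v = Suc (lev u)" by linarith+
        then show ?thesis using that parcs_G[of u v] by blast
      qed
      show "1 - fs 0 v = taper h L (M - lev v)" if "v \<in> pverts G" for v
        using taper_reflect[OF L, of "lev v" h, folded M_def] lev_le[OF that] by (simp add: fs_def f0_def)
      show "\<exists>v\<in>pverts G. \<exists>y. (\<lambda>v. 1 - fs (Suc t) v) = (\<lambda>v. 1 - fs t v)(v := y) \<and>
          (\<Sum>u | (v, u) \<in> parcs G. phi (p - 1) (y - (1 - fs t u))) = 0" for t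
      proof -
        obtain y where y: "fs (Suc t) = (fs t)(\<omega> t := y)" "(\<Sum>u | (\<omega> t, u) \<in> parcs G. phi (p - 1) (y - fs t u)) = 0"
          using step[of t] by blast
        have "phi (p - 1) (1 - y - (1 - z)) = - phi (p - 1) (y - z)" for z
          using phi_minus[of "p - 1" "y - z"] by simp
        then have "(\<Sum>u | (\<omega> t, u) \<in> parcs G. phi (p - 1) (1 - y - (1 - fs t u))) = 0"
          using y(2) by (simp only: sum_negf)
        moreover have "(\<lambda>v. 1 - fs (Suc t) v) = (\<lambda>v. 1 - fs t v)(\<omega> t := 1 - y)" using y(1) by auto
        ultimately show ?thesis using \<omega>[of t] by blast
      qed
      show "1 - fs t v \<le> 1" if "v \<in> pverts G" for t v using bounds[OF that] by simp
    qed (use p in auto)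
    ultimately obtain v w where vw: "v \<in> pverts G" "w \<in> pverts G" "fs T v < 1 / 5" "1 - fs T w < 1 / 5" by blast
    then show False using osc_ge[OF finite_G vw(2,1), of "fs T"] osc by linarith
  qed
  then show ?thesis
    unfolding consensus_time_def X_def[symmetric] fs_def[symmetric]
    by (intro INF_greatest) (auto simp: ennreal_of_nat_eq_real_of_nat intro!: ennreal_leI)
qed

end

subsection \<open>Choice of parameters\<close>

lemma dumbbell_witness:
  fixes \<epsilon> b :: real
  assumes p: "1 < p" and \<epsilon>: "0 < \<epsilon>" "\<epsilon> < 1"
    and dbl: "\<And>s e. 0 \<le> e \<Longrightarrow> phi (p - 1) (s - e / 2) \<le> (1 - \<epsilon>) * phi (p - 1) s + \<epsilon> * phi (p - 1) (s - e)"
    and params: "dumbbell_params h L wl"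
    and card: "2 * (\<Sum>i<h. wl i) + L \<le> N"
    and deg: "avg_degree (layered_graph (dumbbell_params.M h L) (widths h L wl)) \<le> D"
    and I: "I \<subseteq> {..<h}" "I \<noteq> {}" "\<And>i. i \<in> I \<Longrightarrow> m \<le> wl i"
      "\<And>i. i \<in> I \<Longrightarrow> \<exists>j\<le>h + L - 1. (j = Suc i \<or> i = Suc j) \<and> b \<le> (real (wl i) * real (widths h L wl j)) powr (1 / (p - 1))"
    and pos: "0 < m" "0 < b"
    and c: "c / F N p D \<le> \<epsilon> * real m * b * (real (card I))\<^sup>2 * real (L - 1) / 200"
  shows "\<exists>(G :: nat pair_pre_digraph) f0.
           pair_graph G \<and> Digraph_Component.connected (with_proj G) \<and>
           card (pverts G) \<le> N \<and> avg_degree G \<le> D \<and> f0 \<in> pverts G \<rightarrow> {0..1} \<and>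
           (\<forall>\<omega> \<in> space (vertex_seq G). ennreal (c / F N p D) \<le> consensus_time p G f0 (1 / 2) \<omega>)"
proof -
  interpret dumbbell_params h L wl by (rule params)
  have W: "W i = wl i" if "i \<in> I" for i using that I(1) by (auto simp: widths_def)
  have ge: "ennreal (c / F N p D) \<le> consensus_time p G f0 (1 / 2) \<omega>" if "\<omega> \<in> space (vertex_seq G)" for \<omega>
  proof -
    have \<omega>: "\<omega> t \<in> pverts G" for t
      using that by (auto simp: vertex_seq_def space_PiM space_uniform_count_measure)
    have "ennreal (c / F N p D) \<le> ennreal (\<epsilon> * real m * b * (real (card I))\<^sup>2 * real (L - 1) / 200)"
      by (rule ennreal_leI[OF c])
    also have "\<dots> \<le> consensus_time p G f0 (1 / 2) \<omega>"
      by (rule consensus_time_ge[OF p \<epsilon> dbl \<omega> I(1,2) _ _ pos]) (use I(3,4) W in auto)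
    finally show ?thesis .
  qed
  show ?thesis
    using pair_graph_G connected_G card deg f0_bounds ge by (intro exI[of _ G] exI[of _ f0]) (simp add: card_dumbbell)
qed

text \<open>Rounding down costs at most a factor 2, the source of most powers of 2 in the constants
  below.\<close>

lemma nat_floor_bounds:
  fixes x :: real
  assumes "1 \<le> x"
  shows "x / 2 \<le> real (nat \<lfloor>x\<rfloor>) \<and> x - 1 \<le> real (nat \<lfloor>x\<rfloor>) \<and> real (nat \<lfloor>x\<rfloor>) \<le> x \<and> 1 \<le> nat \<lfloor>x\<rfloor>"
proof -
  have "1 \<le> \<lfloor>x\<rfloor>" using assms by (simp add: le_floor_iff)
  then have "real (nat \<lfloor>x\<rfloor>) = of_int \<lfloor>x\<rfloor>" "1 \<le> real_of_int \<lfloor>x\<rfloor>" by auto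
  moreover have "1 \<le> nat \<lfloor>x\<rfloor>" using \<open>1 \<le> \<lfloor>x\<rfloor>\<close> by linarith
  moreover have "of_int \<lfloor>x\<rfloor> \<le> x" "x < of_int \<lfloor>x\<rfloor> + 1" by linarith+
  ultimately show ?thesis by linarith
qed

text \<open>About N / d layers of width d give m = d, c0 = d^(2/(p-1)) and |I| = h of order N / d,
  so m c0 h^2 L is of order N^3 d^((3-p)/(p-1)). For p < 3 this grows with d, which is taken of
  order D; for p \<ge> 3 it does not, and d = 1 suffices.\<close>

lemma lower_bound_gt2:
  assumes p: "2 < p"
  shows "\<exists>c > 0. \<exists>N0. \<forall>N \<ge> N0. \<forall>D. 2 \<le> D \<and> D \<le> real N \<longrightarrow>
        (\<exists>(G :: nat pair_pre_digraph) f0.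
           pair_graph G \<and> Digraph_Component.connected (with_proj G) \<and>
           card (pverts G) \<le> N \<and> avg_degree G \<le> D \<and> f0 \<in> pverts G \<rightarrow> {0..1} \<and>
           (\<forall>\<omega> \<in> space (vertex_seq G). ennreal (c / F N p D) \<le> consensus_time p G f0 (1 / 2) \<omega>))"
proof -
  have p1: "1 < p" using p by simp
  obtain \<epsilon> where \<epsilon>: "0 < \<epsilon>" "\<epsilon> < 1"
    and dbl: "\<And>s e. 0 \<le> e \<Longrightarrow> phi (p - 1) (s - e / 2) \<le> (1 - \<epsilon>) * phi (p - 1) s + \<epsilon> * phi (p - 1) (s - e)"
    using phi_doubling[of "p - 1"] p by auto
  define s where "s = max 0 ((3 - p) / (p - 1))"
  have s0: "0 \<le> s" by (simp add: s_def)
  \<comment> \<open>2048 is 16^2 * 8 from the bounds on \<open>h\<close> and \<open>L\<close>; 32 is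
    from D \<le> 32 d.\<close>
  define c where "c = \<epsilon> / (200 * 2048 * 32 powr s)"
  show ?thesis
  proof (intro exI[of _ c] conjI exI[of _ 64] allI impI)
    show "0 < c" using \<epsilon> by (simp add: c_def)
    fix N :: nat and D :: real assume N: "64 \<le> N" and D: "2 \<le> D \<and> D \<le> N"
    define d where "d = (if p < 3 \<and> 16 \<le> D then nat \<lfloor>D / 16\<rfloor> else 1)"
    define h where "h = nat \<lfloor>N / (8 * d)\<rfloor>"
    define L where "L = nat \<lfloor>N / 4\<rfloor>"
    have d: "1 \<le> d" "real d \<le> N / 16" "p < 3 \<Longrightarrow> D / 32 \<le> d" "p \<ge> 3 \<Longrightarrow> d = 1" "d = 1 \<or> 4 * real d \<le> D"
      using nat_floor_bounds[of "D / 16"] D N by (auto simp: d_def)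
    have "2 \<le> N / (8 * d)" using d by (simp add: field_simps)
    then have hb: "2 \<le> h" "N / (16 * d) \<le> h" "h \<le> N / (8 * d)"
      using nat_floor_bounds[of "N / (8 * d)"] unfolding h_def by (auto simp: le_nat_iff le_floor_iff)
    have L4: "N / 4 - 1 \<le> real L" "real L \<le> N / 4"
      using nat_floor_bounds[of "N / 4"] N unfolding L_def by auto
    then have L2: "2 \<le> L" using N by linarith
    then have "real (L - 1) = real L - 1" by simp
    then have Lb: "2 \<le> L" "N / 8 \<le> real (L - 1)" "L \<le> N / 4"
      using L2 L4 N by linarith+
    have FN: "1 / F N p D = real N ^ 3 * D powr s"
    proof (cases "p < 3")
      case True
      have "s = (3 - p) / (p - 1)" using True p by (simp add: s_def)
      then have "- s = (p - 3) / (p - 1)" by (simp add: minus_divide_left)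
      then have "F N p D = N powr (- 3) * D powr (- s)" using True p D N by (subst F_cases) auto
      then show ?thesis using N D by (simp add: powr_minus powr_numeral divide_inverse)
    next
      case False
      then have "(3 - p) / (p - 1) \<le> 0" using p by (intro divide_nonpos_pos) auto
      then have "s = 0" by (simp add: s_def)
      moreover have "F N p D = N powr (- 3)" using False p D N by (subst F_cases) auto
      ultimately show ?thesis using N D by (simp add: powr_minus powr_numeral divide_inverse)
    qed
    interpret dumbbell_params h L "\<lambda>_. d" using hb Lb d by unfold_locales auto
    have Wd: "W i = d \<or> W i = 1" for i by (simp add: widths_def)
    show "\<exists>(G :: nat pair_pre_digraph) f0.
           pair_graph G \<and> Digraph_Component.connected (with_proj G) \<and>
           card (pverts G) \<le> N \<and> avg_degree G \<le> D \<and> f0 \<in> pverts G \<rightarrow> {0..1} \<and>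
           (\<forall>\<omega> \<in> space (vertex_seq G). ennreal (c / F N p D) \<le> consensus_time p G f0 (1 / 2) \<omega>)"
    proof (rule dumbbell_witness[OF p1 \<epsilon> dbl dumbbell_params_axioms, where I = "{..<h}" and m = d and b = "real d powr (2 / (p - 1))"])
      have "real h * real d \<le> N / 8" using hb(3) d(1) by (simp add: field_simps)
      then have "real (2 * (\<Sum>i<h. d) + L) \<le> real N" using Lb(3) by simp
      then show "2 * (\<Sum>i<h. d) + L \<le> N" by (simp only: of_nat_le_iff)
      show "avg_degree (layered_graph M W) \<le> D"
      proof (cases "d = 1")
        case True
        then have "avg_degree G \<le> 2" using Wd by (intro avg_degree_tree) auto
        then show ?thesis using D by linarith
      next
        case False
        have "W i * W (Suc i) \<le> d * (W i + W (Suc i))" for i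
          using Wd[of i] Wd[of "Suc i"] d(1) by (auto simp: distrib_left)
        then have "avg_degree G \<le> 4 * real d" by (intro avg_degree_dense)
        then show ?thesis using False d(5) by linarith
      qed
      show "\<exists>j\<le>h + L - 1. (j = Suc i \<or> i = Suc j) \<and> real d powr (2 / (p - 1)) \<le> (real d * real (widths h L (\<lambda>_. d) j)) powr (1 / (p - 1))"
        if i: "i \<in> {..<h}" for i
      proof -
        \<comment> \<open>A neighbour inside the bell, again of width d; the layer next to the path
          would otherwise see only a single vertex there.\<close>
        define j where "j = (if i = 0 then 1 else i - 1)"
        have j: "j < h" "j = Suc i \<or> i = Suc j" using i hb by (auto simp: j_def)
        have "real d powr (2 / (p - 1)) = (real d * real d) powr (1 / (p - 1))"
          using d(1) by (simp add: powr_mult powr_add[symmetric])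
        also have "\<dots> = (real d * real (widths h L (\<lambda>_. d) j)) powr (1 / (p - 1))"
          using j by (simp add: widths_def)
        finally show ?thesis using j by (intro exI[of _ j]) auto
      qed
      show "c / F N p D \<le> \<epsilon> * real d * real d powr (2 / (p - 1)) * (real (card {..<h}))\<^sup>2 * real (L - 1) / 200"
      proof -
        have Ds: "D powr s \<le> 32 powr s * real d powr (2 / (p - 1) - 1)"
        proof (cases "p < 3")
          case True
          have "2 / (p - 1) - 1 = (3 - p) / (p - 1)" using p by (simp add: field_simps)
          then have "s = 2 / (p - 1) - 1" using True p by (simp add: s_def)
          moreover have "D powr s \<le> (32 * real d) powr s" using d(3)[OF True] D s0 by (intro powr_mono2) auto
          ultimately show ?thesis by (simp add: powr_mult)
        next
          case False
          then have "(3 - p) / (p - 1) \<le> 0" using p by (intro divide_nonpos_pos) auto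
      then have "s = 0" by (simp add: s_def)
          then show ?thesis using d(4) False D by simp
        qed
        have "c / F N p D = c * (real N ^ 3 * D powr s)" using FN by (simp add: divide_inverse)
        also have "\<dots> \<le> c * (real N ^ 3 * (32 powr s * real d powr (2 / (p - 1) - 1)))"
          using Ds \<epsilon> by (intro mult_left_mono) (auto simp: c_def)
        also have "\<dots> = \<epsilon> / 200 * (real d powr (2 / (p - 1) - 1) * real N ^ 3 / 2048)" by (simp add: c_def)
        also have "real d powr (2 / (p - 1) - 1) * real N ^ 3 / 2048
            = real d * real d powr (2 / (p - 1)) * (N / (16 * d))\<^sup>2 * (N / 8)"
          using d(1) by (simp add: powr_diff power2_eq_square power3_eq_cube)
        also have "\<epsilon> / 200 * \<dots> \<le> \<epsilon> / 200 * (real d * real d powr (2 / (p - 1)) * (real h)\<^sup>2 * real (L - 1))"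
          using hb Lb \<epsilon> by (intro mult_left_mono mult_mono power_mono) auto
        finally show ?thesis by simp
      qed
    qed (use d hb in \<open>auto simp: lessThan_empty_iff\<close>)
  qed
qed

text \<open>One layer of width m of order N, next to a layer of width d of order D, has c0 = (m
  d)^(1/(p-1)); with |I| = 1 and a path of order N the product m c0 L has order N^2 (N
  D)^(1/(p-1)).\<close>

lemma lower_bound_le2:
  assumes p: "1 < p" "p \<le> 2"
  shows "\<exists>c > 0. \<exists>N0. \<forall>N \<ge> N0. \<forall>D. 2 \<le> D \<and> D \<le> real N \<longrightarrow>
        (\<exists>(G :: nat pair_pre_digraph) f0.
           pair_graph G \<and> Digraph_Component.connected (with_proj G) \<and>
           card (pverts G) \<le> N \<and> avg_degree G \<le> D \<and> f0 \<in> pverts G \<rightarrow> {0..1} \<and>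
           (\<forall>\<omega> \<in> space (vertex_seq G). ennreal (c / F N p D) \<le> consensus_time p G f0 (1 / 2) \<omega>))"
proof -
  obtain \<epsilon> where \<epsilon>: "0 < \<epsilon>" "\<epsilon> < 1"
    and dbl: "\<And>s e. 0 \<le> e \<Longrightarrow> phi (p - 1) (s - e / 2) \<le> (1 - \<epsilon>) * phi (p - 1) s + \<epsilon> * phi (p - 1) (s - e)"
    using phi_doubling[of "p - 1"] p by auto
  define s where "s = 1 / (p - 1)"
  have s0: "0 < s" using p by (simp add: s_def)
  \<comment> \<open>128 is 16 * 8 from \<open>m\<close> and \<open>L\<close>; 512 is 16 * 32 from
    \<open>m\<close> and the second width inside the power.\<close>
  define c where "c = \<epsilon> / (200 * 128 * 512 powr s)"
  show ?thesis
  proof (intro exI[of _ c] conjI exI[of _ 64] allI impI)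
    show c0: "0 < c" using \<epsilon> by (simp add: c_def)
    fix N :: nat and D :: real assume N: "64 \<le> N" and D: "2 \<le> D \<and> D \<le> N"
    define m where "m = nat \<lfloor>N / 8\<rfloor>"
    define L where "L = nat \<lfloor>N / 4\<rfloor>"
    have m: "1 \<le> m" "N / 16 \<le> m" "m \<le> N / 8"
      using nat_floor_bounds[of "N / 8"] N unfolding m_def by auto
    have L4: "N / 4 - 1 \<le> real L" "real L \<le> N / 4"
      using nat_floor_bounds[of "N / 4"] N unfolding L_def by auto
    then have L2: "2 \<le> L" using N by linarith
    then have "real (L - 1) = real L - 1" by simp
    then have Lb: "2 \<le> L" "N / 8 \<le> real (L - 1)" "L \<le> N / 4"
      using L2 L4 N by linarith+
    have FN: "1 / F N p D = real N ^ 2 * real N powr s * D powr s"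
    proof -
      have "(1 - 2 * p) / (p - 1) = - 2 - s" using p by (simp add: s_def field_simps)
      moreover have "- 1 / (p - 1) = - s" by (simp add: s_def)
      ultimately have "F N p D = N powr (- 2 - s) * D powr (- s)" using p D N by (subst F_cases) auto
      then show ?thesis using N D by (simp add: powr_minus powr_diff powr_numeral divide_inverse)
    qed
    have bound: "c / F N p D \<le> \<epsilon> * real m * (real m * x) powr s * (real (card {i})) ^ 2 * real (L - 1) / 200"
      if x: "D / 32 \<le> x" for x and i :: nat
    proof -
      have "c / F N p D = c * (real N ^ 2 * real N powr s * D powr s)" using FN by (simp add: divide_inverse)
      also have "\<dots> = \<epsilon> / 200 * (N / 16 * (N / 16 * (D / 32)) powr s * (N / 8))"
      proof -
        have "(512 :: real) powr s = 16 powr s * 32 powr s" by (simp flip: powr_mult)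
        then show ?thesis using N D by (simp add: c_def powr_mult powr_divide power2_eq_square)
      qed
      also have "\<dots> \<le> \<epsilon> / 200 * (m * (real m * x) powr s * real (L - 1))"
        using m Lb x D \<epsilon> s0 N by (intro mult_left_mono mult_mono powr_mono2) auto
      finally show ?thesis by simp
    qed
    show "\<exists>(G :: nat pair_pre_digraph) f0.
           pair_graph G \<and> Digraph_Component.connected (with_proj G) \<and>
           card (pverts G) \<le> N \<and> avg_degree G \<le> D \<and> f0 \<in> pverts G \<rightarrow> {0..1} \<and>
           (\<forall>\<omega> \<in> space (vertex_seq G). ennreal (c / F N p D) \<le> consensus_time p G f0 (1 / 2) \<omega>)"
    proof (cases "D < 32")
      \<comment> \<open>For bounded D the first path vertex is the second layer: its width 1 is at
        least D / 32, and the graph is a tree.\<close>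
      case True
      interpret dumbbell_params 1 L "\<lambda>_. m" using Lb m by unfold_locales auto
      show ?thesis
      proof (rule dumbbell_witness[OF p(1) \<epsilon> dbl dumbbell_params_axioms, where I = "{0}" and m = m and b = "(real m * 1) powr s"])
        have "real (2 * (\<Sum>i<1::nat. m) + L) \<le> real N" using Lb(3) m(3) by simp
        then show "2 * (\<Sum>i<1::nat. m) + L \<le> N" by (simp only: of_nat_le_iff)
        have "M = Suc L" unfolding M_def by simp
        then have "W i = 1" if "0 < i" "i < M" for i using that by (simp add: widths_def)
        then have "avg_degree G \<le> 2" by (rule avg_degree_tree)
        then show "avg_degree (layered_graph M W) \<le> D" using D by linarith
        show "\<exists>j\<le>1 + L - 1. (j = Suc i \<or> i = Suc j) \<and> (real m * 1) powr s \<le> (real m * real (widths 1 L (\<lambda>_. m) j)) powr (1 / (p - 1))"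
          if "i \<in> {0}" for i
          using that Lb by (intro exI[of _ 1]) (auto simp: widths_def s_def)
        show "c / F N p D \<le> \<epsilon> * real m * (real m * 1) powr s * (real (card {0::nat}))\<^sup>2 * real (L - 1) / 200"
          using True by (intro bound) auto
      qed (use m in auto)
    next
      case False
      define d where "d = nat \<lfloor>D / 16\<rfloor>"
      have d: "1 \<le> d" "D / 32 \<le> d" "d \<le> D / 16"
        using nat_floor_bounds[of "D / 16"] False unfolding d_def by auto
      \<comment> \<open>The layer of width d sits at the outer end and the wide layer between it and
        the path, so of two adjacent layers one always has width at most d.\<close>
      define wl where "wl i = (if i = 0 then d else m)" for i :: nat
      interpret dumbbell_params 2 L wl using Lb m d by unfold_locales (auto simp: wl_def)
      have W: "W i = d \<or> W i = m \<and> (W (Suc i) = 1 \<or> W (Suc i) = d) \<or> W i = 1" for i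
        using Lb(1) by (auto simp: widths_def wl_def)
      show ?thesis
      proof (rule dumbbell_witness[OF p(1) \<epsilon> dbl dumbbell_params_axioms, where I = "{1}" and m = m and b = "(real m * real d) powr s"])
        have sum2: "(\<Sum>i<2::nat. wl i) = d + m" by (simp add: numeral_2_eq_2 wl_def)
        have "real (2 * (\<Sum>i<2::nat. wl i) + L) \<le> real N" using Lb(3) m(3) d(3) D by (simp add: sum2)
        then show "2 * (\<Sum>i<2::nat. wl i) + L \<le> N" by (simp only: of_nat_le_iff)
        have "W i * W (Suc i) \<le> d * (W i + W (Suc i))" for i
        proof -
          have "W i * W (Suc i) \<le> d * W i \<or> W i * W (Suc i) \<le> d * W (Suc i)"
            using W[of i] d(1) by (auto simp: mult.commute)
          then show ?thesis unfolding distrib_left by linarith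
        qed
        then have "avg_degree G \<le> 4 * real d" by (intro avg_degree_dense)
        then show "avg_degree (layered_graph M W) \<le> D" using d(3) D by linarith
        show "\<exists>j\<le>2 + L - 1. (j = Suc i \<or> i = Suc j) \<and> (real m * real d) powr s \<le> (real (wl i) * real (widths 2 L wl j)) powr (1 / (p - 1))"
          if "i \<in> {1}" for i
          using that Lb by (intro exI[of _ 0]) (auto simp: widths_def s_def wl_def)
        show "c / F N p D \<le> \<epsilon> * real m * (real m * real d) powr s * (real (card {1::nat}))\<^sup>2 * real (L - 1) / 200"
          using d by (intro bound) auto
      qed (use m d in \<open>auto simp: wl_def\<close>)
    qed
  qed
qed

text \<open>The one-step factor 1 - c1 F is replaced by exp(- c F) with c \<le> 1, the form in which
  decay and consensus time share one constant.\<close>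

lemma upper_bound:
  assumes p: "1 < p"
  shows "\<exists>c > 0. \<exists>C > 0. \<forall>n \<ge> 2. \<forall>(G :: 'a pair_pre_digraph) f0.
        pair_graph G \<and> Digraph_Component.connected (with_proj G) \<and> card (pverts G) = n \<and>
        f0 \<in> pverts G \<rightarrow> {0..1} \<longrightarrow>
          (\<forall>t > 0.
             integral\<^sup>L (vertex_seq G) (\<lambda>\<omega>. energy p G (profile p G f0 \<omega> t))
               \<le> energy p G f0 * exp (- c * F n p (avg_degree G) * real t)) \<and>
          (\<forall>\<epsilon>. 0 < \<epsilon> \<and> \<epsilon> \<le> 1 / 2 \<longrightarrow>
             integral\<^sup>N (vertex_seq G) (consensus_time p G f0 \<epsilon>)
               \<le> ennreal (C * ln (real n / \<epsilon>) / F n p (avg_degree G)))"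
proof -
  obtain c1 where c1: "0 < c1" "\<And>(G :: 'a pair_pre_digraph) f. finite_connected G \<Longrightarrow>
    (\<Sum>v\<in>pverts G. energy p G (update p G v f)) \<le> card (pverts G) * energy p G f * (1 - c1 * F (card (pverts G)) p (avg_degree G))"
    using energy_step_le2[of p, where 'a = 'a] energy_step_gt2[of p, where 'a = 'a] p by (metis linorder_not_le)
  define c where "c = min 1 c1"
  have c: "0 < c" "c \<le> 1" "c \<le> c1" using c1 by (auto simp: c_def)
  define C where "C = (p + 3) / c + 2"
  have C: "0 < C" using c p by (simp add: C_def add_pos_pos)
  show ?thesis
  proof (rule exI[of _ c], rule conjI[OF c(1)], rule exI[of _ C], rule conjI[OF C],
      intro allI impI, elim conjE, intro conjI allI impI)
    fix n :: nat and G :: "'a pair_pre_digraph" and f0 :: "'a \<Rightarrow> real"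
    assume A: "2 \<le> n" "pair_graph G" "Digraph_Component.connected (with_proj G)" "card (pverts G) = n"
      and f0: "f0 \<in> pverts G \<rightarrow> {0..1}"
    interpret finite_connected G using A by (intro finite_connected_if_pair_graph) auto
    let ?F = "F n p (avg_degree G)"
    have F: "0 < ?F" "?F \<le> 1" using avg_degree_ge_1 A p by (auto intro!: F_pos F_le_1)
    have step: "(\<Sum>v\<in>pverts G. energy p G (update p G v f)) \<le> card (pverts G) * energy p G f * exp (- c * ?F)" for f
    proof -
      have "1 - c1 * ?F \<le> 1 - c * ?F" using c F by (intro diff_left_mono mult_right_mono) auto
      also have "\<dots> \<le> exp (- c * ?F)" using exp_ge_add_one_self[of "- c * ?F"] by simp
      finally have "card (pverts G) * energy p G f * (1 - c1 * ?F) \<le> card (pverts G) * energy p G f * exp (- c * ?F)"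
        using energy_nonneg by (intro mult_left_mono) auto
      with c1(2)[OF finite_connected_axioms, of f, unfolded A(4)] show ?thesis
        unfolding A(4) by (rule order.trans)
    qed
    note decay = expected_energy_decay[OF _ step, of f0]
    show "integral\<^sup>L (vertex_seq G) (\<lambda>\<omega>. energy p G (profile p G f0 \<omega> t))
               \<le> energy p G f0 * exp (- c * ?F * real t)" for t
    proof (rule integral_real_bounded)
      show "(\<integral>\<^sup>+\<omega>. ennreal (energy p G (profile p G f0 \<omega> t)) \<partial>vertex_seq G) \<le> ennreal (energy p G f0 * exp (- c * ?F * real t))"
        using decay[of t] by (simp add: exp_of_nat_mult[symmetric] mult_ac)
    qed (use energy_nonneg in auto)
    show "integral\<^sup>N (vertex_seq G) (consensus_time p G f0 \<epsilon>) \<le> ennreal (C * ln (real n / \<epsilon>) / ?F)"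
      if "0 < \<epsilon> \<and> \<epsilon> \<le> 1 / 2" for \<epsilon> :: real
      using expected_consensus_time[OF p conjunct1[OF that] conjunct2[OF that] f0 c(1,2) F, OF decay] A by (simp add: C_def)
  qed
qed

theorem theorem1p9:
  fixes p :: real
  assumes "1 < p"
  shows
    "(\<exists>c > 0. \<exists>C > 0. \<forall>n \<ge> 2. \<forall>(G :: nat pair_pre_digraph) f0.
        pair_graph G \<and> Digraph_Component.connected (with_proj G) \<and> card (pverts G) = n \<and>
        f0 \<in> pverts G \<rightarrow> {0..1} \<longrightarrow>
          (\<forall>t > 0.
             integral\<^sup>L (vertex_seq G) (\<lambda>\<omega>. energy p G (profile p G f0 \<omega> t))
               \<le> energy p G f0 * exp (- c * F n p (avg_degree G) * real t)) \<and>
          (\<forall>\<epsilon>. 0 < \<epsilon> \<and> \<epsilon> \<le> 1 / 2 \<longrightarrow>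
             integral\<^sup>N (vertex_seq G) (consensus_time p G f0 \<epsilon>)
               \<le> ennreal (C * ln (real n / \<epsilon>) / F n p (avg_degree G))))
     \<and>
     (\<exists>c > 0. \<exists>N0. \<forall>N \<ge> N0. \<forall>D. 2 \<le> D \<and> D \<le> real N \<longrightarrow>
        (\<exists>(G :: nat pair_pre_digraph) f0.
           pair_graph G \<and> Digraph_Component.connected (with_proj G) \<and>
           card (pverts G) \<le> N \<and> avg_degree G \<le> D \<and> f0 \<in> pverts G \<rightarrow> {0..1} \<and>
           (\<forall>\<omega> \<in> space (vertex_seq G).
              ennreal (c / F N p D) \<le> consensus_time p G f0 (1 / 2) \<omega>)))"
proof (rule conjI[OF upper_bound[OF assms]])
qed (use assms lower_bound_le2[of p] lower_bound_gt2[of p] in \<open>cases "p \<le> 2"; simp\<close>)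

end
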